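(* Let $\Sigma\subset\mathbb{T}^2$ be a real analytic curve which is not a geodesic. There is $E_\Sigma$ such that for every $E\ge E_\Sigma$ and every eigenfunction $\varphi_E$ with eigenvalue $E$ and nodal set $N$, $$ c_\varepsilon E^{\frac12-\varepsilon}<\#(N\cap\Sigma)<C\,E^{\frac12}\quad\text{for all }\varepsilon>0, $$ where $C$ depends on $\Sigma$ and $c_\varepsilon>0$ depends on $\varepsilon$ and $\Sigma$.
   Context: $\mathbb{T}^2=\mathbb{R}^2/\mathbb{Z}^2$. An eigenfunction with eigenvalue $E\in\mathbb{Z}_{>0}$ is a non-zero real-valued function of the form $\varphi_E(x)=\sum_{\xi\in\mathbb{Z}^2,\,|\xi|^2=E}\hat\varphi(\xi)e^{2\pi i x\cdot\xi}$ (so $-\Delta\varphi_E=4\pi^2E\varphi_E$). Its nodal set is $N=\{x:\varphi_E(x)=0\}$. A geodesic of $\mathbb{T}^2$ is (the image of) a straight line segment. *)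

theory Defs
  imports "HOL-Analysis.Analysis"
begin

text \<open>Points of the plane are pairs of reals; the torus T^2 = R^2/Z^2 is represented
  by the fundamental domain [0,1)^2 via the projection below.\<close>

definition torus_proj :: "real \<times> real \<Rightarrow> real \<times> real" where
  "torus_proj p = (frac (fst p), frac (snd p))"

definition real_analytic_on :: "(real \<Rightarrow> real) \<Rightarrow> real set \<Rightarrow> bool" where
  "real_analytic_on f U \<longleftrightarrow>
     (\<forall>x\<in>U. \<exists>r>0. \<exists>a::nat \<Rightarrow> real. \<forall>y. \<bar>y - x\<bar> < r \<longrightarrow> (\<lambda>n. a n * (y - x) ^ n) sums f y)"

text \<open>A (regular) real analytic curve, given by a lift gamma : [0,1] -> R^2 which is
  real analytic on an open interval containing [0,1] with nonvanishing velocity.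
  The curve in T^2 is the projection of gamma([0,1]).\<close>
definition analytic_curve :: "(real \<Rightarrow> real \<times> real) \<Rightarrow> bool" where
  "analytic_curve \<gamma> \<longleftrightarrow>
     (\<exists>U. open U \<and> {0..1} \<subseteq> U \<and>
          real_analytic_on (\<lambda>t. fst (\<gamma> t)) U \<and> real_analytic_on (\<lambda>t. snd (\<gamma> t)) U) \<and>
     (\<forall>t\<in>{0..1}. \<exists>v. v \<noteq> 0 \<and> (\<gamma> has_vector_derivative v) (at t))"

definition curve_set :: "(real \<Rightarrow> real \<times> real) \<Rightarrow> (real \<times> real) set" where
  "curve_set \<gamma> = torus_proj ` \<gamma> ` {0..1}"

text \<open>The curve is (contained in) a geodesic of T^2 iff its (connected) lift lies on a
  straight line of R^2.\<close>
definition is_geodesic_curve :: "(real \<Rightarrow> real \<times> real) \<Rightarrow> bool" where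
  "is_geodesic_curve \<gamma> \<longleftrightarrow>
     (\<exists>p v. \<forall>t\<in>{0..1}. \<exists>s::real. \<gamma> t = p + s *\<^sub>R v)"

definition lattice_circle :: "nat \<Rightarrow> (int \<times> int) set" where
  "lattice_circle E = {\<xi>. (fst \<xi>)\<^sup>2 + (snd \<xi>)\<^sup>2 = int E}"

definition eigf :: "nat \<Rightarrow> (int \<times> int \<Rightarrow> complex) \<Rightarrow> real \<times> real \<Rightarrow> complex" where
  "eigf E c x = (\<Sum>\<xi>\<in>lattice_circle E.
      c \<xi> * exp (2 * of_real pi * \<i> *
        of_real (fst x * of_int (fst \<xi>) + snd x * of_int (snd \<xi>))))"

definition is_eigenfunction :: "nat \<Rightarrow> (int \<times> int \<Rightarrow> complex) \<Rightarrow> bool" where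
  "is_eigenfunction E c \<longleftrightarrow>
     E > 0 \<and> (\<forall>x. Im (eigf E c x) = 0) \<and> (\<exists>x. eigf E c x \<noteq> 0)"

definition nodal_count :: "nat \<Rightarrow> (int \<times> int \<Rightarrow> complex) \<Rightarrow> (real \<Rightarrow> real \<times> real) \<Rightarrow> nat" where
  "nodal_count E c \<gamma> = card {p \<in> curve_set \<gamma>. eigf E c p = 0}"

end

theory Submission
  imports Defs "HOL-Complex_Analysis.Complex_Analysis"
begin

text \<open>The number of lattice points on a circle of radius \<open>R = \<surd>E\<close> is \<open>O(E powr \<epsilon>)\<close>, and three of
  them never lie within distance about \<open>R powr (1/3)\<close> of each other. On a subarc with
  nonvanishing curvature, the integral of \<open>exp (2 \<pi> i \<zeta> \<cdot> \<gamma>)\<close> decays as a power of \<open>|\<zeta>|\<close> and stays away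
  from the length of the arc for lattice points \<open>\<zeta> \<noteq> 0\<close>. Hence the \<open>L\<^sup>2\<close> norm of an eigenfunction on
  the subarc is comparable to that of its coefficients.

  Lower bound: cut the subarc into \<open>E powr (1/2 - \<epsilon>)\<close> pieces. Away from the few pieces where some
  frequency is almost normal to the curve, the mean of the eigenfunction over a piece is tiny, so
  by the \<open>L\<^sup>2\<close> bound it changes sign on many of the pieces.

  Upper bound: near each point of the curve the eigenfunction extends to a holomorphic function of
  size at most \<open>exp (C R)\<close> times the coefficient norm, and the \<open>L\<^sup>2\<close> bound on a nearby subarc provides
  a point where it is not small. Jensen's inequality then allows only \<open>O(R)\<close> zeros.\<close>

section \<open>Lattice points on circles\<close>

text \<open>The curve may have inflection points, but every parameter interval contains a subarc
  with nonvanishing curvature, and this suffices: the lower bound counts zeros on one such subarc,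
  and the upper bound wants only one good point near each place. The L2 comparison is diagonal
  dominance of the Gram matrix of the frequencies. Two close frequencies may differ by a short
  lattice vector, where decay says nothing. There is at most one such neighbour, so it is enough
  that its entry is a fixed fraction of the diagonal; all others are so far apart that decay beats
  their number. Losses in the lower bound are powers of n, a bound on the number of frequencies that
  is eventually a tiny power of E. The squared l1 norm of the coefficients exceeds the squared l2
  norm by a factor of at most n, so the main term is of order 1/n and every error is arranged to be
  O(n^-2). The threshold for E must not depend on \<epsilon>: one fixed exponent already forces a
  zero, and then the E below an \<epsilon>-dependent threshold are absorbed into c.\<close>

lemma finite_lattice_circle: "finite (lattice_circle E)"
proof (rule finite_subset)
  show "lattice_circle E \<subseteq> {- int E..int E} \<times> {- int E..int E}"
  proof
    fix \<xi> assume "\<xi> \<in> lattice_circle E"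
    then have *: "(fst \<xi>)\<^sup>2 + (snd \<xi>)\<^sup>2 = int E" by (simp add: lattice_circle_def)
    have sq: "\<bar>z\<bar> \<le> z\<^sup>2" for z :: int
    proof (cases "z = 0")
      case False
      then have "\<bar>z\<bar> * 1 \<le> \<bar>z\<bar> * \<bar>z\<bar>" by (intro mult_left_mono) auto
      then show ?thesis by (simp add: power2_eq_square)
    qed simp
    have "\<bar>fst \<xi>\<bar> \<le> int E" "\<bar>snd \<xi>\<bar> \<le> int E"
      using sq[of "fst \<xi>"] sq[of "snd \<xi>"] * zero_le_power2[of "fst \<xi>"] zero_le_power2[of "snd \<xi>"]
      by linarith+
    then show "\<xi> \<in> {- int E..int E} \<times> {- int E..int E}" by (cases \<xi>) auto
  qed
qed auto

lemma lattice_circle_of_int: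
  "\<xi> \<in> lattice_circle E \<Longrightarrow> (of_int (fst \<xi>))\<^sup>2 + (of_int (snd \<xi>))\<^sup>2 = real E"
  unfolding lattice_circle_def
  by (metis (mono_tags, lifting) mem_Collect_eq of_int_add of_int_of_nat_eq of_int_power)

text \<open>Multiplication of Gaussian integers, \<open>(x, y)\<close> standing for x + yi.\<close>

definition gmul :: "int \<times> int \<Rightarrow> int \<times> int \<Rightarrow> int \<times> int" where
  "gmul w z = (fst w * fst z - snd w * snd z, fst w * snd z + snd w * fst z)"

lemma gmul_left_commute: "gmul v (gmul w z) = gmul w (gmul v z)"
  by (simp add: gmul_def algebra_simps)

text \<open>Thue's argument: by pigeonhole two pairs with entries at most sqrt p give the same
  residue of \<open>x * j - y * i\<close>. Their difference \<open>(u, v)\<close> is short and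
  proportional to \<open>(x, y)\<close> modulo p, so \<open>u\<^sup>2 + v\<^sup>2\<close> is a
  multiple of p strictly between 0 and 2p.\<close>

lemma prime_sum_two_squares:
  fixes p :: nat and x y :: int
  assumes p: "prime p" and dvd: "int p dvd x\<^sup>2 + y\<^sup>2" and nx: "\<not> int p dvd x"
  obtains u v :: int where "u\<^sup>2 + v\<^sup>2 = int p"
proof -
  define m where "m = floor_sqrt p"
  have m1: "m\<^sup>2 \<le> p" "p < (Suc m)\<^sup>2"
    by (auto simp: m_def floor_sqrt_power2_le Suc_floor_sqrt_power2_gt)
  \<comment> \<open>Strictness here is what excludes the value 2p for
    \<open>u\<^sup>2 + v\<^sup>2\<close>.\<close>
  have "m\<^sup>2 \<noteq> p" using p by (metis prime_power_iff numeral_One numeral_eq_iff semiring_norm(85))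
  with m1 have m2: "m\<^sup>2 < p" by simp
  have p0: "p > 0" using p prime_gt_0_nat by blast
  define A where "A = {0..int m} \<times> {0..int m}"
  define f where "f = (\<lambda>(i,j). (x * j - y * i) mod int p)"
  have "card A = (Suc m)\<^sup>2" by (simp add: A_def card_cartesian_product power2_eq_square nat_add_distrib)
  moreover have "f ` A \<subseteq> {0..<int p}" using p0 by (auto simp: f_def)
  then have "card (f ` A) \<le> p" using card_mono[of "{0..<int p}" "f ` A"] by simp
  ultimately have "card (f ` A) < card A" using m1 by linarith
  then have "\<not> inj_on f A" by (rule pigeonhole)
  then obtain z w where zw: "z \<in> A" "w \<in> A" "z \<noteq> w" "f z = f w"
    unfolding inj_on_def by blast
  obtain i j i' j' where "z = (i, j)" "w = (i', j')" by (cases z, cases w)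
  note ij = zw[unfolded this]
  define u where "u = i - i'"
  define v where "v = j - j'"
  have d: "int p dvd x * v - y * u"
  proof -
    have "int p dvd (x * j - y * i) - (x * j' - y * i')"
      using ij(4) by (simp add: f_def mod_eq_dvd_iff)
    then show ?thesis by (simp add: u_def v_def algebra_simps)
  qed
  have "x\<^sup>2 * (u\<^sup>2 + v\<^sup>2) = u\<^sup>2 * (x\<^sup>2 + y\<^sup>2) + (x * v - y * u) * (x * v + y * u)"
    by (simp add: algebra_simps power2_eq_square)
  then have "int p dvd x\<^sup>2 * (u\<^sup>2 + v\<^sup>2)" using dvd d by simp
  moreover have "prime (int p)" using p by simp
  ultimately have "int p dvd u\<^sup>2 + v\<^sup>2"
    using nx by (metis prime_dvd_mult_iff prime_dvd_power)
  then obtain k where k: "u\<^sup>2 + v\<^sup>2 = int p * k" by (auto elim: dvdE)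
  have "\<bar>u\<bar> \<le> int m" "\<bar>v\<bar> \<le> int m" using ij by (auto simp: A_def u_def v_def)
  then have "u\<^sup>2 \<le> (int m)\<^sup>2" "v\<^sup>2 \<le> (int m)\<^sup>2" by (auto simp: abs_le_square_iff[symmetric])
  moreover have "(int m)\<^sup>2 < int p" using m2 by (metis of_nat_less_iff of_nat_power)
  ultimately have "int p * k < int p * 2" using k by linarith
  then have "k < 2" using p0 by simp
  have "u \<noteq> 0 \<or> v \<noteq> 0" using ij by (auto simp: u_def v_def)
  then have "0 < u\<^sup>2 + v\<^sup>2" by (simp add: sum_power2_gt_zero_iff)
  then have "0 < k" using k p0 by (simp add: zero_less_mult_iff)
  with \<open>k < 2\<close> have "k = 1" by simp
  with k that show ?thesis by simp
qed

text \<open>One of the Gaussian primes \<open>a + bi\<close> and \<open>a - bi\<close> above \<open>p\<close> divides \<open>x + yi\<close>.\<close>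

lemma lattice_circle_prime_factor:
  assumes p: "prime p" and ab: "a\<^sup>2 + b\<^sup>2 = int p"
  shows "lattice_circle (p * n) \<subseteq> gmul (a, b) ` lattice_circle n \<union> gmul (a, - b) ` lattice_circle n"
proof -
  \<comment> \<open>\<open>a * x + b * y\<close> and \<open>a * y - b * x\<close> are the real and
    imaginary parts of x + yi times the conjugate of a + bi. Their squares add up to a multiple of
    p, so p divides both once it divides the first; the quotients form the cofactor
    \<open>(u, v)\<close>.\<close>
  have key: "(x, y) \<in> gmul (a, b) ` lattice_circle n"
    if xy: "x\<^sup>2 + y\<^sup>2 = int p * int n" and ab: "a\<^sup>2 + b\<^sup>2 = int p" and d: "int p dvd a * x + b * y"
    for a b x y
  proof -
    have p': "prime (int p)" using p by simp
    have p0: "int p > 0" using p prime_gt_0_nat by simp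
    obtain u where u: "a * x + b * y = int p * u" using d by (auto elim: dvdE)
    have id: "(a * x + b * y)\<^sup>2 + (a * y - b * x)\<^sup>2 = (a\<^sup>2 + b\<^sup>2) * (x\<^sup>2 + y\<^sup>2)"
      by (simp add: algebra_simps power2_eq_square)
    then have id': "(int p * u)\<^sup>2 + (a * y - b * x)\<^sup>2 = int p * (int p * int n)"
      unfolding u ab xy .
    then have "(a * y - b * x)\<^sup>2 = int p * (int p * int n) - (int p * u)\<^sup>2" by linarith
    also have "\<dots> = int p * (int p * int n - int p * u\<^sup>2)"
      by (simp add: right_diff_distrib power2_eq_square)
    finally have "(a * y - b * x)\<^sup>2 = int p * (int p * int n - int p * u\<^sup>2)" .
    then have "int p dvd (a * y - b * x)\<^sup>2" by simp
    then have "int p dvd a * y - b * x" using p' prime_dvd_power by blast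
    then obtain v where v: "a * y - b * x = int p * v" by (auto elim: dvdE)
    have "(int p)\<^sup>2 * (u\<^sup>2 + v\<^sup>2) = (int p)\<^sup>2 * int n"
      using id'[unfolded v] by (simp add: distrib_left power2_eq_square mult_ac)
    then have uv: "u\<^sup>2 + v\<^sup>2 = int n" using p0 by simp
    have "int p * (a * u - b * v) = a * (int p * u) - b * (int p * v)"
      "int p * (a * v + b * u) = a * (int p * v) + b * (int p * u)"
      by (simp_all add: algebra_simps)
    then have "int p * (a * u - b * v) = (a\<^sup>2 + b\<^sup>2) * x" "int p * (a * v + b * u) = (a\<^sup>2 + b\<^sup>2) * y"
      unfolding u[symmetric] v[symmetric] by (simp_all add: algebra_simps power2_eq_square)
    then have "a * u - b * v = x" "a * v + b * u = y" using p0 ab by auto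
    then show ?thesis using uv
      by (intro image_eqI[of _ _ "(u, v)"]) (auto simp: gmul_def lattice_circle_def)
  qed
  show ?thesis
  proof
    fix z assume "z \<in> lattice_circle (p * n)"
    then obtain x y where z: "z = (x, y)" and xy: "x\<^sup>2 + y\<^sup>2 = int p * int n"
      by (cases z) (auto simp: lattice_circle_def)
    \<comment> \<open>Primality selects one factor; the second one is \<open>key\<close> for the
      conjugate \<open>(a, - b)\<close>.\<close>
    have "(a * x + b * y) * (a * x - b * y) = a\<^sup>2 * (x\<^sup>2 + y\<^sup>2) - y\<^sup>2 * (a\<^sup>2 + b\<^sup>2)"
      by (simp add: algebra_simps power2_eq_square)
    then have "int p dvd (a * x + b * y) * (a * x - b * y)"
      using xy ab by simp
    moreover have "prime (int p)" using p by simp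
    ultimately have "int p dvd a * x + b * y \<or> int p dvd a * x + (- b) * y"
      using prime_dvd_mult_iff by (metis mult_minus_left uminus_add_conv_diff add.commute)
    then show "z \<in> gmul (a, b) ` lattice_circle n \<union> gmul (a, - b) ` lattice_circle n"
      using key[OF xy ab] key[OF xy, of a "- b"] ab z by auto
  qed
qed

text \<open>If p = a^2 + b^2, each of the k factors p is taken off as a + bi or a - bi. Only the
  multiplicities matter, which leaves k + 1 choices. Otherwise p divides both coordinates, and the
  exponent drops by two without creating points.\<close>

lemma card_lattice_circle_prime_power:
  assumes p: "prime p" and nd: "\<not> p dvd m"
  shows "card (lattice_circle (p ^ k * m)) \<le> Suc k * card (lattice_circle m)"
proof (cases "\<exists>a b. a\<^sup>2 + b\<^sup>2 = int p")
  case True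
  then obtain a b where ab: "a\<^sup>2 + b\<^sup>2 = int p" by blast
  define f where "f = gmul (a, b)"
  define g where "g = gmul (a, - b)"
  have fg: "f (g z) = g (f z)" for z by (simp add: f_def g_def gmul_left_commute)
  \<comment> \<open>Commutation sorts a mixed product of the two primes into powers of
    \<open>f\<close> after powers of \<open>g\<close>.\<close>
  have gf: "g ((f ^^ i) z) = (f ^^ i) (g z)" for i z
    by (induction i) (simp_all add: fg[symmetric])
  have "lattice_circle (p ^ k * m) \<subseteq> (\<Union>i\<le>k. (\<lambda>z. (f ^^ i) ((g ^^ (k - i)) z)) ` lattice_circle m)"
  proof (induction k)
    case 0
    then show ?case by simp
  next
    case (Suc k)
    have "lattice_circle (p ^ Suc k * m) \<subseteq> f ` lattice_circle (p ^ k * m) \<union> g ` lattice_circle (p ^ k * m)"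
      using lattice_circle_prime_factor[OF p ab, of "p ^ k * m"] by (simp add: f_def g_def mult.assoc)
    also have "\<dots> \<subseteq> (\<Union>i\<le>Suc k. (\<lambda>z. (f ^^ i) ((g ^^ (Suc k - i)) z)) ` lattice_circle m)"
    proof -
      have "f w \<in> (\<Union>i\<le>Suc k. (\<lambda>z. (f ^^ i) ((g ^^ (Suc k - i)) z)) ` lattice_circle m)
          \<and> g w \<in> (\<Union>i\<le>Suc k. (\<lambda>z. (f ^^ i) ((g ^^ (Suc k - i)) z)) ` lattice_circle m)"
        if w: "w \<in> lattice_circle (p ^ k * m)" for w
      proof -
        obtain i z where i: "i \<le> k" "z \<in> lattice_circle m" "w = (f ^^ i) ((g ^^ (k - i)) z)"
          using subsetD[OF Suc.IH w] by auto
        have "f w = (f ^^ Suc i) ((g ^^ (Suc k - Suc i)) z)" using i by simp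
        moreover have "g w = (f ^^ i) ((g ^^ (Suc k - i)) z)"
          using i by (simp add: gf Suc_diff_le)
        moreover have "Suc i \<in> {..Suc k}" "i \<in> {..Suc k}" using i by auto
        ultimately show ?thesis using i(2) by blast
      qed
      then show ?thesis by blast
    qed
    finally show ?case .
  qed
  then have "card (lattice_circle (p ^ k * m)) \<le> card (\<Union>i\<le>k. (\<lambda>z. (f ^^ i) ((g ^^ (k - i)) z)) ` lattice_circle m)"
    by (intro card_mono) (auto simp: finite_lattice_circle)
  also have "\<dots> \<le> (\<Sum>i\<le>k. card ((\<lambda>z. (f ^^ i) ((g ^^ (k - i)) z)) ` lattice_circle m))"
    by (rule card_UN_le) simp
  also have "\<dots> \<le> (\<Sum>i\<le>k. card (lattice_circle m))"
    by (intro sum_mono card_image_le finite_lattice_circle)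
  finally show ?thesis by simp
next
  case False
  have both: "int p dvd x \<and> int p dvd y" if "int p dvd x\<^sup>2 + y\<^sup>2" for x y
    using prime_sum_two_squares[OF p, of x y] prime_sum_two_squares[OF p, of y x] that False
    by (metis add.commute)
  have p0: "p > 0" using p prime_gt_0_nat by blast
  have "card (lattice_circle (p ^ k * m)) \<le> card (lattice_circle m)"
  proof (induction k rule: less_induct)
    case (less k)
    \<comment> \<open>Exponent 1 is a terminal case with no points: p^2 would divide p m although p
      does not divide m.\<close>
    consider "k = 0" | "k = 1" | j where "k = Suc (Suc j)"
      by (metis One_nat_def not0_implies_Suc)
    then show ?case
    proof cases
      case 2
      have False if "z \<in> lattice_circle (p ^ k * m)" for z
      proof -
        have e: "(fst z)\<^sup>2 + (snd z)\<^sup>2 = int p * int m" using that 2 by (simp add: lattice_circle_def)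
        then have "int p dvd fst z" "int p dvd snd z" using both[of "fst z" "snd z"] by auto
        then have "int p * int p dvd int p * int m"
          unfolding e[symmetric] by (intro dvd_add) (auto simp: power2_eq_square intro: mult_dvd_mono)
        then have "int p dvd int m" using p0 by simp
        then show False using nd by simp
      qed
      then have "lattice_circle (p ^ k * m) = {}" by blast
      then show ?thesis by simp
    next
      case 3
      have "lattice_circle (p ^ k * m) \<subseteq> (\<lambda>z. (int p * fst z, int p * snd z)) ` lattice_circle (p ^ j * m)"
      proof
        fix z assume "z \<in> lattice_circle (p ^ k * m)"
        then have e: "(fst z)\<^sup>2 + (snd z)\<^sup>2 = int p * int p * int (p ^ j * m)"
          using 3 by (simp add: lattice_circle_def)
        then have "int p dvd fst z" "int p dvd snd z" using both[of "fst z" "snd z"] by (auto simp: mult.assoc)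
        then obtain u v where uv: "fst z = int p * u" "snd z = int p * v" by (auto elim!: dvdE)
        have "int p * int p * (u\<^sup>2 + v\<^sup>2) = int p * int p * int (p ^ j * m)"
          using e unfolding uv by (simp add: power2_eq_square algebra_simps)
        then have "u\<^sup>2 + v\<^sup>2 = int (p ^ j * m)" using p0 by simp
        then show "z \<in> (\<lambda>z. (int p * fst z, int p * snd z)) ` lattice_circle (p ^ j * m)"
          using uv by (intro image_eqI[of _ _ "(u,v)"]) (auto simp: lattice_circle_def prod_eq_iff)
      qed
      then have "card (lattice_circle (p ^ k * m)) \<le> card (lattice_circle (p ^ j * m))"
        using finite_lattice_circle surj_card_le by blast
      then show ?thesis using less[of j] 3 by simp
    qed simp
  qed
  then show ?thesis by simp
qed

lemma Suc_le_powr_bound: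
  assumes "\<eta> > 0"
  obtains A :: real where "A \<ge> 1" "\<And>k. real (Suc k) \<le> A * 2 powr (real k * \<eta>)"
proof -
  define A where "A = max 1 (2 / (\<eta> * ln 2))"
  show ?thesis
  proof
    show A1: "A \<ge> 1" by (simp add: A_def)
    fix k
    define u where "u = real k * \<eta> * ln 2"
    have u0: "u \<ge> 0" using assms by (simp add: u_def)
    have "A * (u / 2) \<ge> (2 / (\<eta> * ln 2)) * (u / 2)"
      using u0 by (intro mult_right_mono) (auto simp: A_def)
    also have "(2 / (\<eta> * ln 2)) * (u / 2) = real k" using assms by (simp add: u_def)
    finally have "real (Suc k) \<le> A * (u / 2) + A" using A1 by simp
    also have "\<dots> \<le> A * (1 + u)" using A1 u0 by (simp add: algebra_simps)
    also have "\<dots> \<le> A * exp u" using A1 exp_ge_add_one_self[of u] by (intro mult_left_mono) auto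
    also have "exp u = 2 powr (real k * \<eta>)" by (simp add: powr_def u_def)
    finally show "real (Suc k) \<le> A * 2 powr (real k * \<eta>)" .
  qed
qed

text \<open>The divisor-bound argument: removing p^k costs a factor k + 1, which p^(k \<eta>) pays
  for outright when p is large. Only small primes cost the extra constant \<open>A\<close>, and
  their number is bounded in terms of \<eta>.\<close>

lemma card_lattice_circle_bound:
  assumes "\<eta> > 0"
  obtains C :: real where "C > 0" "\<And>E. E > 0 \<Longrightarrow> real (card (lattice_circle E)) \<le> C * real E powr \<eta>"
proof -
  obtain A where A: "A \<ge> 1" "\<And>k. real (Suc k) \<le> A * 2 powr (real k * \<eta>)"
    using Suc_le_powr_bound[OF assms] by blast
  \<comment> \<open>From this threshold on p^\<eta> is at least 2, hence k + 1 <= 2^k <= p^(k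
    \<eta>).\<close>
  define B where "B = nat \<lceil>2 powr (1 / \<eta>)\<rceil>"
  define T where "T E = {p. prime p \<and> p < B \<and> p dvd E}" for E :: nat
  have finT: "finite (T E)" for E by (rule finite_subset[of _ "{..<B}"]) (auto simp: T_def)
  define r where "r = real (card (lattice_circle 1))"
  have main: "real (card (lattice_circle E)) \<le> r * A ^ card (T E) * real E powr \<eta>" if "E > 0" for E
    using that
  proof (induction E rule: less_induct)
    case (less E)
    show ?case
    proof (cases "E = 1")
      case True
      have "r * 1 \<le> r * A ^ card (T E)" using A by (intro mult_left_mono) (auto simp: r_def)
      then show ?thesis using True by (simp add: r_def)
    next
      case False
      then obtain p where p: "prime p" "p dvd E" using prime_factor_nat by blast
      define k where "k = multiplicity p E"
      \<comment> \<open>The full power of p is removed, so p is missing from \<open>T m\<close> and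
        each small prime is charged only once.\<close>
      obtain m where m: "E = p ^ k * m" "\<not> p dvd m"
        using multiplicity_decompose'[of E p] less.prems p by (metis k_def not_prime_unit neq0_conv)
      have k0: "k > 0" using p less.prems by (simp add: k_def prime_multiplicity_gt_zero_iff)
      have p2: "p \<ge> 2" using p prime_ge_2_nat by blast
      have m0: "m > 0" using less.prems m by (cases m) auto
      have "1 < p ^ k" using p2 k0 by (metis one_less_power Suc_1 Suc_le_eq)
      then have mE: "m < E" using m m0 by simp
      have ER: "real E powr \<eta> = real p powr (real k * \<eta>) * real m powr \<eta>"
        using m p2 m0 by (simp add: powr_mult powr_realpow[symmetric] powr_powr)
      have TT: "T m \<subseteq> T E" using m by (auto simp: T_def)
      have step: "real (Suc k) * A ^ card (T m) \<le> A ^ card (T E) * real p powr (real k * \<eta>)"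
      proof (cases "p < B")
        case True
        have "insert p (T m) \<subseteq> T E" using TT True p by (auto simp: T_def)
        then have "card (insert p (T m)) \<le> card (T E)" using finT card_mono by blast
        moreover have "p \<notin> T m" using m by (auto simp: T_def)
        ultimately have c: "Suc (card (T m)) \<le> card (T E)" using finT by simp
        have "real (Suc k) * A ^ card (T m) \<le> (A * 2 powr (real k * \<eta>)) * A ^ card (T m)"
          using A by (intro mult_right_mono) auto
        also have "\<dots> = A ^ Suc (card (T m)) * 2 powr (real k * \<eta>)" by simp
        also have "\<dots> \<le> A ^ card (T E) * real p powr (real k * \<eta>)"
          using c A p2 assms by (intro mult_mono power_increasing powr_mono2) auto
        finally show ?thesis .
      next
        case False
        have "2 powr (1 / \<eta>) \<le> real p"
          using False unfolding B_def by linarith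
        then have "(2 powr (1 / \<eta>)) powr \<eta> \<le> real p powr \<eta>" using assms by (intro powr_mono2) auto
        then have two: "2 \<le> real p powr \<eta>" using assms by (simp add: powr_powr)
        have "real (Suc k) \<le> 2 ^ k" by (metis Suc_leI less_exp of_nat_le_iff of_nat_numeral of_nat_power)
        also have "\<dots> \<le> (real p powr \<eta>) ^ k" using two by (intro power_mono) auto
        also have "\<dots> = real p powr (real k * \<eta>)"
          using p2 by (simp add: powr_powr mult.commute flip: powr_realpow)
        finally have "real (Suc k) \<le> real p powr (real k * \<eta>)" .
        then show ?thesis using A card_mono[OF finT TT]
          by (subst mult.commute) (intro mult_mono power_increasing, auto)
      qed
      have "real (card (lattice_circle E)) \<le> real (Suc k) * real (card (lattice_circle m))"
        using card_lattice_circle_prime_power[OF p(1) m(2), of k] m(1) by (metis of_nat_le_iff of_nat_mult)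
      also have "\<dots> \<le> real (Suc k) * (r * A ^ card (T m) * real m powr \<eta>)"
        by (intro mult_left_mono less.IH mE m0) auto
      also have "\<dots> = (real (Suc k) * A ^ card (T m)) * (r * real m powr \<eta>)" by simp
      also have "\<dots> \<le> (A ^ card (T E) * real p powr (real k * \<eta>)) * (r * real m powr \<eta>)"
        by (intro mult_right_mono step) (auto simp: r_def)
      finally show ?thesis by (simp add: ER mult_ac)
    qed
  qed
  show ?thesis
  proof
    show "r * A ^ B + 1 > 0" using A by (smt (verit) r_def mult_nonneg_nonneg of_nat_0_le_iff zero_le_power)
    fix E :: nat assume E: "E > 0"
    have "T E \<subseteq> {..<B}" by (auto simp: T_def)
    then have "card (T E) \<le> B" using card_mono[of "{..<B}" "T E"] by simp
    then have "A ^ card (T E) \<le> A ^ B" using A by (intro power_increasing) auto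
    then have "r * A ^ card (T E) \<le> r * A ^ B" by (intro mult_left_mono) (auto simp: r_def)
    then have "r * A ^ card (T E) \<le> r * A ^ B + 1" by simp
    then show "real (card (lattice_circle E)) \<le> (r * A ^ B + 1) * real E powr \<eta>"
      using main[OF E] by (meson mult_right_mono order.trans powr_ge_zero)
  qed
qed

section \<open>Separation of lattice points on a circle\<close>

text \<open>This is \<open>abc = 4 R \<Delta>\<close> for a triangle with circumradius \<open>R\<close>; here \<open>D\<close> is twice the signed
  area, a nonzero integer.\<close>

lemma lattice_circle_triangle:
  fixes \<xi> \<eta> \<zeta> :: "int \<times> int"
  assumes "\<xi> \<in> lattice_circle E" "\<eta> \<in> lattice_circle E" "\<zeta> \<in> lattice_circle E"
    and "\<xi> \<noteq> \<eta>" "\<eta> \<noteq> \<zeta>" "\<xi> \<noteq> \<zeta>"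
  defines "d \<equiv> \<lambda>v w :: int \<times> int. (fst v - fst w)\<^sup>2 + (snd v - snd w)\<^sup>2"
  shows "4 * int E \<le> d \<xi> \<eta> * d \<eta> \<zeta> * d \<xi> \<zeta>"
proof -
  obtain a b where ab: "\<xi> = (a, b)" by fastforce
  obtain u v where uv: "\<eta> = (u, v)" by fastforce
  obtain x y where xy: "\<zeta> = (x, y)" by fastforce
  define D where "D = (u - a) * (y - b) - (x - a) * (v - b)"
  have e: "a\<^sup>2 + b\<^sup>2 = int E" "u\<^sup>2 + v\<^sup>2 = int E" "x\<^sup>2 + y\<^sup>2 = int E"
    using assms ab uv xy by (auto simp: lattice_circle_def)
  \<comment> \<open>These are the inner products of the three vectors; their Gram determinant
    vanishes in the plane, and this relation ties \<open>D\<close> to E.\<close>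
  define p where "p = a * u + b * v"
  define q where "q = u * x + v * y"
  define r where "r = a * x + b * y"
  have "(a\<^sup>2 + b\<^sup>2) * (u\<^sup>2 + v\<^sup>2) * (x\<^sup>2 + y\<^sup>2) + 2 * p * q * r
      - (a\<^sup>2 + b\<^sup>2) * q\<^sup>2 - (u\<^sup>2 + v\<^sup>2) * r\<^sup>2 - (x\<^sup>2 + y\<^sup>2) * p\<^sup>2 = 0"
    unfolding p_def q_def r_def by (simp add: algebra_simps power2_eq_square)
  then have gram: "int E ^ 3 + 2 * p * q * r - int E * (p\<^sup>2 + q\<^sup>2 + r\<^sup>2) = 0"
    unfolding e by (simp add: algebra_simps power3_eq_cube)
  have dd: "d \<xi> \<eta> = 2 * (int E - p)" "d \<eta> \<zeta> = 2 * (int E - q)" "d \<xi> \<zeta> = 2 * (int E - r)"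
    using e by (auto simp: d_def ab uv xy p_def q_def r_def power2_eq_square algebra_simps)
  have "D\<^sup>2 = ((u - a)\<^sup>2 + (v - b)\<^sup>2) * ((x - a)\<^sup>2 + (y - b)\<^sup>2) - ((u - a) * (x - a) + (v - b) * (y - b))\<^sup>2"
    by (simp add: D_def algebra_simps power2_eq_square)
  also have "(u - a)\<^sup>2 + (v - b)\<^sup>2 = 2 * (int E - p)"
    using e by (simp add: p_def power2_eq_square algebra_simps)
  also have "(x - a)\<^sup>2 + (y - b)\<^sup>2 = 2 * (int E - r)"
    using e by (simp add: r_def power2_eq_square algebra_simps)
  also have "(u - a) * (x - a) + (v - b) * (y - b) = q - p - r + int E"
    using e by (simp add: p_def q_def r_def power2_eq_square algebra_simps)
  finally have D2: "D\<^sup>2 = 2 * (int E - p) * (2 * (int E - r)) - (q - p - r + int E)\<^sup>2" .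
  have id: "d \<xi> \<eta> * d \<eta> \<zeta> * d \<xi> \<zeta> = 4 * int E * D\<^sup>2"
    unfolding dd D2 using gram by algebra
  have pos: "d \<xi> \<eta> > 0" "d \<eta> \<zeta> > 0" "d \<xi> \<zeta> > 0"
    using assms(4-6) ab uv xy by (auto simp: d_def sum_power2_gt_zero_iff)
  then have "0 < 4 * int E * D\<^sup>2" unfolding id[symmetric] by simp
  \<comment> \<open>Positive side lengths force the integer \<open>D\<close> to be nonzero through
    the identity \<open>id\<close>.\<close>
  then have "D\<^sup>2 \<ge> 1" by (smt (verit) mult_eq_0_iff zero_le_power2)
  then show ?thesis unfolding id by (simp add: mult_le_cancel_left1)
qed

section \<open>Oscillatory integrals along curved arcs\<close>

lemma has_vector_derivative_cis:
  assumes "(\<phi> has_real_derivative \<phi>') (at t within A)"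
  shows "((\<lambda>t. cis (\<phi> t)) has_vector_derivative (\<phi>' *\<^sub>R (\<i> * cis (\<phi> t)))) (at t within A)"
  using has_derivative_cis[OF assms[unfolded has_field_derivative_def]]
  by (simp add: has_vector_derivative_def mult.commute)

text \<open>Integration by parts. Monotonicity of the phase derivative is not assumed, so the term
  containing \<open>\<phi>''\<close> is estimated by its size, at the price of 1 / h^2.\<close>

lemma nonstationary_phase:
  fixes \<phi> \<phi>' \<phi>'' :: "real \<Rightarrow> real"
  assumes st: "s \<le> t" and h: "h > 0"
    and d1: "\<And>\<tau>. \<tau> \<in> {s..t} \<Longrightarrow> (\<phi> has_real_derivative \<phi>' \<tau>) (at \<tau> within {s..t})"
    and d2: "\<And>\<tau>. \<tau> \<in> {s..t} \<Longrightarrow> (\<phi>' has_real_derivative \<phi>'' \<tau>) (at \<tau> within {s..t})"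
    and c2: "continuous_on {s..t} \<phi>''"
    and low: "\<And>\<tau>. \<tau> \<in> {s..t} \<Longrightarrow> h \<le> \<bar>\<phi>' \<tau>\<bar>"
    and up: "\<And>\<tau>. \<tau> \<in> {s..t} \<Longrightarrow> \<bar>\<phi>'' \<tau>\<bar> \<le> B"
  shows "norm (integral {s..t} (\<lambda>\<tau>. cis (\<phi> \<tau>))) \<le> 2 / h + (t - s) * B / h\<^sup>2"
proof -
  define G where "G \<tau> = (1 / \<phi>' \<tau>) *\<^sub>R (- \<i> * cis (\<phi> \<tau>))" for \<tau>
  define H where "H \<tau> = (\<phi>'' \<tau> / (\<phi>' \<tau>)\<^sup>2) *\<^sub>R (\<i> * cis (\<phi> \<tau>))" for \<tau>
  have nz: "\<phi>' \<tau> \<noteq> 0" if "\<tau> \<in> {s..t}" for \<tau> using low[OF that] h by auto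
  have c0: "continuous_on {s..t} \<phi>" using d1 by (meson DERIV_continuous_on)
  have c1: "continuous_on {s..t} \<phi>'" using d2 by (meson DERIV_continuous_on)
  have "(G has_vector_derivative (cis (\<phi> \<tau>) + H \<tau>)) (at \<tau> within {s..t})" if \<tau>: "\<tau> \<in> {s..t}" for \<tau>
  proof -
    have "((\<lambda>\<tau>. 1 / \<phi>' \<tau>) has_real_derivative - (\<phi>'' \<tau> / (\<phi>' \<tau>)\<^sup>2)) (at \<tau> within {s..t})"
      using d2[OF \<tau>] nz[OF \<tau>] by (auto intro!: derivative_eq_intros simp: power2_eq_square)
    moreover have "((\<lambda>\<tau>. - \<i> * cis (\<phi> \<tau>)) has_vector_derivative (- \<i> * (\<phi>' \<tau> *\<^sub>R (\<i> * cis (\<phi> \<tau>))))) (at \<tau> within {s..t})"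
      by (intro has_vector_derivative_mult_right has_vector_derivative_cis d1 \<tau>)
    ultimately have "(G has_vector_derivative ((1 / \<phi>' \<tau>) *\<^sub>R (- \<i> * (\<phi>' \<tau> *\<^sub>R (\<i> * cis (\<phi> \<tau>))))
        + (- (\<phi>'' \<tau> / (\<phi>' \<tau>)\<^sup>2)) *\<^sub>R (- \<i> * cis (\<phi> \<tau>)))) (at \<tau> within {s..t})"
      unfolding G_def by (rule has_vector_derivative_scaleR)
    moreover have "(1 / \<phi>' \<tau>) *\<^sub>R (- \<i> * (\<phi>' \<tau> *\<^sub>R (\<i> * cis (\<phi> \<tau>))))
        + (- (\<phi>'' \<tau> / (\<phi>' \<tau>)\<^sup>2)) *\<^sub>R (- \<i> * cis (\<phi> \<tau>)) = cis (\<phi> \<tau>) + H \<tau>"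
      using nz[OF \<tau>] by (simp add: H_def)
    ultimately show ?thesis by simp
  qed
  then have I: "((\<lambda>\<tau>. cis (\<phi> \<tau>) + H \<tau>) has_integral (G t - G s)) {s..t}"
    using st by (intro fundamental_theorem_of_calculus) auto
  have cH: "continuous_on {s..t} H"
    unfolding H_def using nz c0 c1 c2 by (auto intro!: continuous_intros)
  have "(\<lambda>\<tau>. cis (\<phi> \<tau>)) integrable_on {s..t}" "H integrable_on {s..t}"
    using c0 cH by (auto intro!: integrable_continuous_real continuous_intros)
  then have "integral {s..t} (\<lambda>\<tau>. cis (\<phi> \<tau>)) = G t - G s - integral {s..t} H"
    using integral_unique[OF I] integral_add by (metis add_diff_cancel_right')
  then have "norm (integral {s..t} (\<lambda>\<tau>. cis (\<phi> \<tau>))) \<le> norm (G t - G s) + norm (integral {s..t} H)"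
    using norm_triangle_ineq4 by metis
  also have "norm (G t - G s) \<le> norm (G t) + norm (G s)" by (rule norm_triangle_ineq4)
  finally have "norm (integral {s..t} (\<lambda>\<tau>. cis (\<phi> \<tau>))) \<le> norm (G t) + norm (G s) + norm (integral {s..t} H)"
    by simp
  moreover have "norm (G \<tau>) \<le> 1 / h" if "\<tau> \<in> {s..t}" for \<tau>
    using low[OF that] h by (auto simp: G_def norm_mult intro!: divide_left_mono)
  then have "norm (G t) \<le> 1 / h" "norm (G s) \<le> 1 / h" using st by auto
  moreover have "norm (integral {s..t} H) \<le> (B / h\<^sup>2) * (t - s)"
  proof (rule integral_bound[OF st cH])
    fix \<tau> assume \<tau>: "\<tau> \<in> {s..t}"
    have "h\<^sup>2 \<le> (\<phi>' \<tau>)\<^sup>2" using low[OF \<tau>] h by (metis abs_le_square_iff abs_of_pos)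
    then show "norm (H \<tau>) \<le> B / h\<^sup>2"
      using up[OF \<tau>] h by (auto simp: H_def norm_mult intro!: frac_le)
  qed
  ultimately show ?thesis by (simp add: mult.commute)
qed

text \<open>\<open>curved\<close> is nonvanishing curvature in two-point form: the cross product of
  two tangents measures how far the direction has turned between them. This is the shape that limits
  the set where a phase is slow.\<close>

locale curved_arc =
  fixes x y x1 y1 x2 y2 :: "real \<Rightarrow> real" and a b M \<kappa> :: real
  assumes ab: "a < b"
    and dx: "\<And>t. t \<in> {a..b} \<Longrightarrow> (x has_real_derivative x1 t) (at t)"
    and dy: "\<And>t. t \<in> {a..b} \<Longrightarrow> (y has_real_derivative y1 t) (at t)"
    and dx1: "\<And>t. t \<in> {a..b} \<Longrightarrow> (x1 has_real_derivative x2 t) (at t)"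
    and dy1: "\<And>t. t \<in> {a..b} \<Longrightarrow> (y1 has_real_derivative y2 t) (at t)"
    and cx2: "continuous_on {a..b} x2"
    and cy2: "continuous_on {a..b} y2"
    and Mx1: "\<And>t. t \<in> {a..b} \<Longrightarrow> \<bar>x1 t\<bar> \<le> M"
    and My1: "\<And>t. t \<in> {a..b} \<Longrightarrow> \<bar>y1 t\<bar> \<le> M"
    and Mx2: "\<And>t. t \<in> {a..b} \<Longrightarrow> \<bar>x2 t\<bar> \<le> M"
    and My2: "\<And>t. t \<in> {a..b} \<Longrightarrow> \<bar>y2 t\<bar> \<le> M"
    and \<kappa>: "\<kappa> > 0"
    and curved: "\<And>s t. s \<in> {a..b} \<Longrightarrow> t \<in> {a..b} \<Longrightarrow> \<kappa> * \<bar>s - t\<bar> \<le> \<bar>x1 s * y1 t - y1 s * x1 t\<bar>"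
begin

lemma M_nonneg: "M \<ge> 0"
  using Mx1[of a] ab by fastforce

definition osc :: "real \<Rightarrow> real \<Rightarrow> real \<Rightarrow> real \<Rightarrow> complex" where
  "osc u v s t = integral {s..t} (\<lambda>\<tau>. cis (2 * pi * (u * x \<tau> + v * y \<tau>)))"

lemma cont_x: "continuous_on {a..b} x" and cont_y: "continuous_on {a..b} y"
  using dx dy by (meson DERIV_atLeastAtMost_imp_continuous_on has_field_derivative_at_within DERIV_continuous_on)+

lemma osc_combine:
  assumes "a \<le> s" "s \<le> m" "m \<le> t" "t \<le> b"
  shows "osc u v s t = osc u v s m + osc u v m t"
proof -
  have "(\<lambda>\<tau>. cis (2 * pi * (u * x \<tau> + v * y \<tau>))) integrable_on {s..t}"
    using assms by (intro integrable_continuous_real continuous_intros continuous_on_subset[OF cont_x] continuous_on_subset[OF cont_y]) auto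
  then show ?thesis
    unfolding osc_def by (rule Henstock_Kurzweil_Integration.integral_combine[OF assms(2,3), symmetric])
qed

lemma norm_osc_le:
  assumes "a \<le> s" "s \<le> t" "t \<le> b"
  shows "norm (osc u v s t) \<le> t - s"
proof -
  have "norm (osc u v s t) \<le> 1 * (t - s)"
    unfolding osc_def
    using assms by (intro integral_bound continuous_intros continuous_on_subset[OF cont_x] continuous_on_subset[OF cont_y]) auto
  then show ?thesis by simp
qed

lemma osc_uminus: "osc (- u) (- v) s t = cnj (osc u v s t)"
proof -
  have "cis (2 * pi * (- u * x \<tau> + - v * y \<tau>)) = cnj (cis (2 * pi * (u * x \<tau> + v * y \<tau>)))" for \<tau>
    by (simp add: cis_cnj algebra_simps)
  then show ?thesis unfolding osc_def by (simp only: integral_cnj)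
qed

lemma osc_nonstationary:
  assumes st: "a \<le> s" "s \<le> t" "t \<le> b" and h: "h > 0" and r: "\<bar>u\<bar> \<le> r" "\<bar>v\<bar> \<le> r"
    and low: "\<And>\<tau>. \<tau> \<in> {s..t} \<Longrightarrow> h \<le> \<bar>u * x1 \<tau> + v * y1 \<tau>\<bar>"
  shows "norm (osc u v s t) \<le> 1 / h + (t - s) * (r * M) / h\<^sup>2"
proof -
  have sub: "\<tau> \<in> {a..b}" if "\<tau> \<in> {s..t}" for \<tau> using that st by auto
  have "norm (osc u v s t) \<le> 2 / (2 * pi * h) + (t - s) * (4 * pi * (r * M)) / (2 * pi * h)\<^sup>2"
    unfolding osc_def
  proof (rule nonstationary_phase[where \<phi>' = "\<lambda>\<tau>. 2 * pi * (u * x1 \<tau> + v * y1 \<tau>)" and \<phi>'' = "\<lambda>\<tau>. 2 * pi * (u * x2 \<tau> + v * y2 \<tau>)"])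
    fix \<tau> assume \<tau>: "\<tau> \<in> {s..t}"
    note t = sub[OF \<tau>]
    show "((\<lambda>\<tau>. 2 * pi * (u * x \<tau> + v * y \<tau>)) has_real_derivative 2 * pi * (u * x1 \<tau> + v * y1 \<tau>)) (at \<tau> within {s..t})"
      by (rule has_field_derivative_at_within) (use dx[OF t] dy[OF t] in \<open>auto intro!: derivative_eq_intros\<close>)
    show "((\<lambda>\<tau>. 2 * pi * (u * x1 \<tau> + v * y1 \<tau>)) has_real_derivative 2 * pi * (u * x2 \<tau> + v * y2 \<tau>)) (at \<tau> within {s..t})"
      by (rule has_field_derivative_at_within) (use dx1[OF t] dy1[OF t] in \<open>auto intro!: derivative_eq_intros\<close>)
    show "2 * pi * h \<le> \<bar>2 * pi * (u * x1 \<tau> + v * y1 \<tau>)\<bar>"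
      using low[OF \<tau>] by (simp add: abs_mult)
    have "\<bar>u * x2 \<tau> + v * y2 \<tau>\<bar> \<le> \<bar>u\<bar> * \<bar>x2 \<tau>\<bar> + \<bar>v\<bar> * \<bar>y2 \<tau>\<bar>"
      using abs_triangle_ineq[of "u * x2 \<tau>" "v * y2 \<tau>"] by (simp add: abs_mult)
    also have "\<dots> \<le> r * M + r * M"
      using r Mx2[OF t] My2[OF t] by (intro add_mono mult_mono) auto
    finally show "\<bar>2 * pi * (u * x2 \<tau> + v * y2 \<tau>)\<bar> \<le> 4 * pi * (r * M)"
      by (simp add: abs_mult)
  next
    show "continuous_on {s..t} (\<lambda>\<tau>. 2 * pi * (u * x2 \<tau> + v * y2 \<tau>))"
      using sub by (intro continuous_intros continuous_on_subset[OF cx2] continuous_on_subset[OF cy2]) auto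
  qed (use st h in auto)
  \<comment> \<open>Slope 2 pi h and second derivative 4 pi r M leave a common factor 1/pi, which is
    then bounded by 1.\<close>
  also have "\<dots> = (1 / pi) * (1 / h + (t - s) * (r * M) / h\<^sup>2)"
    using h by (simp add: field_simps power2_eq_square)
  also have "\<dots> \<le> 1 * (1 / h + (t - s) * (r * M) / h\<^sup>2)"
  proof (rule mult_right_mono)
    show "1 / pi \<le> 1" using pi_ge_two by (simp add: divide_simps)
    have "0 \<le> r * M" using r M_nonneg by (auto intro: mult_nonneg_nonneg)
    then show "0 \<le> 1 / h + (t - s) * (r * M) / h\<^sup>2" using h st by auto
  qed
  finally show ?thesis by simp
qed

text \<open>Tangents at s and t that are both almost orthogonal to \<open>(u, v)\<close> are almost
  parallel, which curvature forbids for distant s and t. Eliminating v or u as in Cramer's rule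
  makes this quantitative.\<close>

lemma slow_phase_diameter:
  assumes st: "s \<in> {a..b}" "t \<in> {a..b}"
    and slow: "\<bar>u * x1 s + v * y1 s\<bar> \<le> h" "\<bar>u * x1 t + v * y1 t\<bar> \<le> h"
  shows "\<kappa> * \<bar>s - t\<bar> * sqrt (u\<^sup>2 + v\<^sup>2) \<le> 4 * M * h"
proof -
  define X where "X = x1 s * y1 t - y1 s * x1 t"
  have *: "\<bar>p * m - q * n\<bar> \<le> h * M + h * M" if "\<bar>p\<bar> \<le> h" "\<bar>q\<bar> \<le> h" "\<bar>m\<bar> \<le> M" "\<bar>n\<bar> \<le> M" for p q m n :: real
  proof -
    have "\<bar>p * m - q * n\<bar> \<le> \<bar>p\<bar> * \<bar>m\<bar> + \<bar>q\<bar> * \<bar>n\<bar>" using abs_triangle_ineq4[of "p * m" "q * n"] by (simp add: abs_mult)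
    also have "\<dots> \<le> h * M + h * M" using that by (intro add_mono mult_mono) auto
    finally show ?thesis .
  qed
  have "u * X = (u * x1 s + v * y1 s) * y1 t - (u * x1 t + v * y1 t) * y1 s"
    by (simp add: X_def algebra_simps)
  then have u: "\<bar>u\<bar> * \<bar>X\<bar> \<le> h * M + h * M"
    using *[OF slow My1[OF st(2)] My1[OF st(1)]] by (simp add: abs_mult)
  have "v * X = (u * x1 t + v * y1 t) * x1 s - (u * x1 s + v * y1 s) * x1 t"
    by (simp add: X_def algebra_simps)
  then have v: "\<bar>v\<bar> * \<bar>X\<bar> \<le> h * M + h * M"
    using *[OF slow(2,1) Mx1[OF st(1)] Mx1[OF st(2)]] by (simp add: abs_mult)
  have "\<kappa> * \<bar>s - t\<bar> * sqrt (u\<^sup>2 + v\<^sup>2) \<le> \<bar>X\<bar> * (\<bar>u\<bar> + \<bar>v\<bar>)"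
    using curved[OF st] sqrt_sum_squares_le_sum_abs[of u v] \<kappa> by (intro mult_mono) (auto simp: X_def)
  also have "\<dots> \<le> 4 * M * h" using u v by (simp add: algebra_simps)
  finally show ?thesis .
qed

text \<open>Outside the slow zone the phase is nonstationary; the zone itself is estimated by its
  length. The exponent 1/3 reflects the 1 / h^2 term, and any positive power would serve because the
  lattice points are fewer than every power of E.\<close>

lemma osc_decay:
  obtains C where "C > 0"
    "\<And>u v. sqrt (u\<^sup>2 + v\<^sup>2) \<ge> 1 \<Longrightarrow> norm (osc u v a b) \<le> C * sqrt (u\<^sup>2 + v\<^sup>2) powr (- 1/3)"
proof -
  define L where "L = 1 + (b - a) * M"
  define W where "W = 4 * M / \<kappa> + 1"
  have L1: "L \<ge> 1" and W1: "W \<ge> 1" using M_nonneg ab \<kappa> by (auto simp: L_def W_def)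
  show ?thesis
  proof
    show "2 * L + 2 * W > 0" using L1 W1 by simp
    fix u v :: real
    define r where "r = sqrt (u\<^sup>2 + v\<^sup>2)"
    assume "sqrt (u\<^sup>2 + v\<^sup>2) \<ge> 1"
    then have r1: "r \<ge> 1" by (simp add: r_def)
    have ur: "\<bar>u\<bar> \<le> r" "\<bar>v\<bar> \<le> r" by (auto simp: r_def intro: real_sqrt_ge_abs1 real_sqrt_ge_abs2)
    \<comment> \<open>the phase is slow (slope below \<open>\<delta> r\<close>) only within \<open>O(\<delta>)\<close> of one point, and
      this choice of \<open>\<delta>\<close> balances the lengths against \<open>1 / (\<delta>\<^sup>2 r)\<close>\<close>
    define \<delta> where "\<delta> = r powr (- 1/3)"
    have \<delta>: "0 < \<delta>" "\<delta> \<le> 1" using r1 using powr_mono[of "-1/3" 0 r] by (auto simp: \<delta>_def)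
    have "\<delta> ^ 3 = \<delta> powr 3" using \<delta> by (simp add: powr_numeral)
    also have "\<dots> = r powr (- 1)" unfolding \<delta>_def powr_powr by simp
    also have "\<dots> = 1 / r" using r1 by (simp add: powr_minus_divide)
    finally have "\<delta> ^ 3 = 1 / r" .
    then have \<delta>r: "r = 1 / \<delta> ^ 3" using r1 by simp
    have good: "norm (osc u v s t) \<le> L * \<delta>"
      if st: "a \<le> s" "s \<le> t" "t \<le> b" and low: "\<And>\<tau>. \<tau> \<in> {s..t} \<Longrightarrow> \<delta> * r \<le> \<bar>u * x1 \<tau> + v * y1 \<tau>\<bar>" for s t
    proof -
      have "norm (osc u v s t) \<le> 1 / (\<delta> * r) + (t - s) * (r * M) / (\<delta> * r)\<^sup>2"
        using r1 \<delta> by (intro osc_nonstationary st ur low) auto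
      also have "\<dots> = \<delta>\<^sup>2 + (t - s) * M * \<delta>"
        using \<delta> by (simp add: \<delta>r field_simps power2_eq_square power3_eq_cube)
      also have "\<dots> \<le> \<delta> + (b - a) * M * \<delta>"
        using \<delta> st M_nonneg by (intro add_mono mult_right_mono) (auto simp: power2_eq_square mult_le_one intro: mult_left_le)
      finally show ?thesis by (simp add: L_def algebra_simps)
    qed
    have "norm (osc u v a b) \<le> (2 * L + 2 * W) * \<delta>"
    proof (cases "\<exists>s\<in>{a..b}. \<bar>u * x1 s + v * y1 s\<bar> < \<delta> * r")
      case False
      then have "norm (osc u v a b) \<le> L * \<delta>" using ab by (intro good) (auto simp: not_less)
      also have "\<dots> \<le> (2 * L + 2 * W) * \<delta>" using L1 W1 \<delta> by (intro mult_right_mono) auto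
      finally show ?thesis .
    next
      case True
      then obtain c where c: "c \<in> {a..b}" "\<bar>u * x1 c + v * y1 c\<bar> < \<delta> * r" by blast
      have far: "\<delta> * r \<le> \<bar>u * x1 \<tau> + v * y1 \<tau>\<bar>" if "\<tau> \<in> {a..b}" "\<bar>c - \<tau>\<bar> \<ge> W * \<delta>" for \<tau>
      proof (rule ccontr)
        assume "\<not> ?thesis"
        then have "\<kappa> * \<bar>c - \<tau>\<bar> * r \<le> 4 * M * (\<delta> * r)"
          using slow_phase_diameter[OF c(1) that(1), of u v "\<delta> * r"] c(2) by (simp add: r_def)
        then have "\<kappa> * \<bar>c - \<tau>\<bar> \<le> 4 * M * \<delta>" using r1 by simp
        then have "\<bar>c - \<tau>\<bar> \<le> 4 * M / \<kappa> * \<delta>" using \<kappa> by (simp add: field_simps)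
        then show False using that(2) \<delta> by (simp add: W_def algebra_simps)
      qed
      define p where "p = max a (c - W * \<delta>)"
      define q where "q = min b (c + W * \<delta>)"
      have w0: "W * \<delta> > 0" using W1 \<delta> by simp
      have pq: "a \<le> p" "p \<le> c" "c \<le> q" "q \<le> b" using c w0 by (auto simp: p_def q_def)
      have "osc u v a b = osc u v a p + osc u v p q + osc u v q b"
        using osc_combine[of a p b u v] osc_combine[of p q b u v] pq ab by simp
      moreover have "norm (osc u v a p) \<le> L * \<delta>"
      \<comment> \<open>If the slow zone reaches the endpoint, \<open>a\<close> may itself be slow
        and \<open>good\<close> does not apply, but then the piece is a single point.\<close>
      proof (cases "p = a")
        case True
        then show ?thesis using L1 \<delta> by (simp add: osc_def)
      next
        case False
        then show ?thesis using pq c w0 by (intro good far) (auto simp: p_def)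
      qed
      moreover have "norm (osc u v q b) \<le> L * \<delta>"
      proof (cases "q = b")
        case True
        then show ?thesis using L1 \<delta> by (simp add: osc_def)
      next
        case False
        then show ?thesis using pq c w0 by (intro good far) (auto simp: q_def)
      qed
      moreover have "norm (osc u v p q) \<le> 2 * W * \<delta>"
        using norm_osc_le[of p q u v] pq by (simp add: p_def q_def)
      ultimately show ?thesis
        using norm_triangle_ineq[of "osc u v a p + osc u v p q" "osc u v q b"] norm_triangle_ineq[of "osc u v a p" "osc u v p q"]
        by (simp add: algebra_simps)
    qed
    then show "norm (osc u v a b) \<le> (2 * L + 2 * W) * sqrt (u\<^sup>2 + v\<^sup>2) powr (- 1/3)"
      by (simp add: \<delta>_def r_def)
  qed
qed

text \<open>Equality in the triangle inequality would force the integrand to be constant;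
  \<open>(u, v)\<close> would then be orthogonal to every tangent, against curvature.\<close>

lemma norm_osc_less:
  assumes "(u, v) \<noteq> (0, 0)"
  shows "norm (osc u v a b) < b - a"
proof (rule ccontr)
  assume "\<not> ?thesis"
  then have nI: "norm (osc u v a b) = b - a" using norm_osc_le[of a b u v] ab by simp
  define \<phi> where "\<phi> \<tau> = 2 * pi * (u * x \<tau> + v * y \<tau>)" for \<tau>
  define \<omega> where "\<omega> = osc u v a b / of_real (b - a)"
  have n\<omega>: "norm \<omega> = 1" unfolding \<omega>_def norm_divide nI norm_of_real using ab by simp
  have cphi: "continuous_on {a..b} (\<lambda>\<tau>. cis (\<phi> \<tau>))"
    unfolding \<phi>_def by (intro continuous_intros cont_x cont_y)
  have int: "((\<lambda>\<tau>. cis (\<phi> \<tau>)) has_integral osc u v a b) {a..b}"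
    unfolding osc_def using integrable_integral[OF integrable_continuous_real[OF cphi]] by (simp add: \<phi>_def)
  have "((\<lambda>\<tau>. Re (cnj \<omega> * cis (\<phi> \<tau>))) has_integral Re (cnj \<omega> * osc u v a b)) {a..b}"
    using has_integral_linear[OF has_integral_mult_right[OF int, of "cnj \<omega>"] bounded_linear_Re] by (simp add: o_def)
  moreover have "Re (cnj \<omega> * osc u v a b) = b - a"
  proof -
    have "cnj \<omega> * osc u v a b = (cnj \<omega> * \<omega>) * of_real (b - a)"
      using ab by (simp add: \<omega>_def)
    also have "cnj \<omega> * \<omega> = 1" using n\<omega> by (metis complex_norm_square mult.commute of_real_1 power_one)
    finally show ?thesis by simp
  qed
  ultimately have "((\<lambda>\<tau>. 1 - Re (cnj \<omega> * cis (\<phi> \<tau>))) has_integral ((b - a) - (b - a))) {a..b}"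
    using has_integral_const_real[of "1::real" a b] ab by (intro has_integral_diff) (simp_all del: has_integral_const_real)
  then have z: "integral {a..b} (\<lambda>\<tau>. 1 - Re (cnj \<omega> * cis (\<phi> \<tau>))) = 0" by (simp add: integral_unique)
  have n1: "norm (cnj \<omega> * cis \<theta>) = 1" for \<theta> using n\<omega> by (simp add: norm_mult)
  have "continuous_on {a..b} (\<lambda>\<tau>. 1 - Re (cnj \<omega> * cis (\<phi> \<tau>)))" by (intro continuous_intros cphi)
  moreover have "1 - Re (cnj \<omega> * cis (\<phi> \<tau>)) \<ge> 0" for \<tau> using complex_Re_le_cmod[of "cnj \<omega> * cis (\<phi> \<tau>)"] n1 by simp
  ultimately have one: "Re (cnj \<omega> * cis (\<phi> \<tau>)) = 1" if "\<tau> \<in> {a..b}" for \<tau>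
    using z integral_eq_0_iff[of a b "\<lambda>\<tau>. 1 - Re (cnj \<omega> * cis (\<phi> \<tau>))"] ab that by auto
  have const: "cis (\<phi> \<tau>) = \<omega>" if "\<tau> \<in> {a..b}" for \<tau>
  proof -
    have "cnj \<omega> * cis (\<phi> \<tau>) = 1"
      using one[OF that] n1[of "\<phi> \<tau>"] by (simp add: complex_eq_iff cmod_def)
    then have "\<omega> * cnj \<omega> * cis (\<phi> \<tau>) = \<omega>" by (simp add: mult.assoc)
    moreover have "\<omega> * cnj \<omega> = 1" using n\<omega> by (metis complex_norm_square of_real_1 power_one)
    ultimately show ?thesis by simp
  qed
  have flat: "u * x1 t + v * y1 t = 0" if t: "t \<in> {a..b}" for t
  proof -
    have "(\<phi> has_real_derivative 2 * pi * (u * x1 t + v * y1 t)) (at t)"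
      unfolding \<phi>_def using dx[OF t] dy[OF t] by (auto intro!: derivative_eq_intros)
    then have D1: "((\<lambda>\<tau>. cis (\<phi> \<tau>)) has_vector_derivative ((2 * pi * (u * x1 t + v * y1 t)) *\<^sub>R (\<i> * cis (\<phi> t)))) (at t within {a..b})"
      by (rule has_vector_derivative_cis[OF has_field_derivative_at_within])
    have D2: "((\<lambda>\<tau>. cis (\<phi> \<tau>)) has_vector_derivative 0) (at t within {a..b})"
      by (rule has_vector_derivative_transform[OF t const has_vector_derivative_const])
    have "(2 * pi * (u * x1 t + v * y1 t)) *\<^sub>R (\<i> * cis (\<phi> t)) = 0"
      by (rule vector_derivative_unique_within_closed_interval[OF ab _ D1[folded cbox_interval] D2[folded cbox_interval]])
        (use t in simp)
    then have "2 * pi * (u * x1 t + v * y1 t) = 0"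
      by (simp only: scaleR_eq_0_iff mult_eq_0_iff cis_neq_zero complex_i_not_zero simp_thms)
    then show ?thesis using pi_neq_zero by (simp only: mult_eq_0_iff) simp
  qed
  have "\<kappa> * \<bar>a - b\<bar> * sqrt (u\<^sup>2 + v\<^sup>2) \<le> 4 * M * 0"
    by (rule slow_phase_diameter) (use flat ab in auto)
  moreover have "sqrt (u\<^sup>2 + v\<^sup>2) > 0" using assms by (auto simp: sum_power2_gt_zero_iff)
  ultimately show False using \<kappa> ab by (simp add: mult_le_0_iff)
qed

text \<open>Decay leaves finitely many integer frequencies with a factor above 1/2, and
  \<open>norm_osc_less\<close> treats each of them. Integrality matters: for real frequencies
  tending to 0 the integral tends to b - a.\<close>

lemma osc_gap:
  obtains q where "0 \<le> q" "q < 1"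
    "\<And>(m::int) (n::int). m \<noteq> 0 \<or> n \<noteq> 0 \<Longrightarrow> norm (osc (of_int m) (of_int n) a b) \<le> q * (b - a)"
proof -
  obtain C where C: "C > 0"
    "\<And>u v. sqrt (u\<^sup>2 + v\<^sup>2) \<ge> 1 \<Longrightarrow> norm (osc u v a b) \<le> C * sqrt (u\<^sup>2 + v\<^sup>2) powr (- 1/3)"
    using osc_decay by blast
  \<comment> \<open>Beyond this radius C r^(-1/3) is at most (b - a) / 2.\<close>
  define R where "R = max 1 ((2 * C / (b - a)) ^ 3)"
  define K where "K = \<lceil>R\<rceil>"
  define k where "k = (\<lambda>(m::int, n::int). norm (osc m n a b) / (b - a))"
  define P where "P = {(m::int, n::int). (m, n) \<noteq> (0, 0) \<and> \<bar>m\<bar> \<le> K \<and> \<bar>n\<bar> \<le> K}"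
  have "finite P"
    by (rule finite_subset[of _ "{-K..K} \<times> {-K..K}"]) (auto simp: P_def)
  define q where "q = Max (insert (1/2) (k ` P))"
  have fin: "finite (insert (1/2) (k ` P))" using \<open>finite P\<close> by simp
  have kP: "k z < 1" if "z \<in> P" for z
    using that norm_osc_less[of "fst z" "snd z"] ab by (auto simp: k_def P_def split: prod.splits)
  show ?thesis
  proof
    have q12: "q \<ge> 1/2" unfolding q_def using fin by (intro Max_ge) auto
    then show "0 \<le> q" by simp
    show "q < 1" unfolding q_def using fin kP by (subst Max_less_iff) auto
    fix m n :: int assume mn: "m \<noteq> 0 \<or> n \<noteq> 0"
    have "norm (osc m n a b) / (b - a) \<le> q"
    proof (cases "(m, n) \<in> P")
      case True
      then show ?thesis unfolding q_def using fin by (intro Max_ge) (auto simp: k_def image_iff intro!: bexI[of _ "(m,n)"])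
    next
      case False
      define r where "r = sqrt ((real_of_int m)\<^sup>2 + (real_of_int n)\<^sup>2)"
      have "R \<le> \<bar>real_of_int m\<bar> \<or> R \<le> \<bar>real_of_int n\<bar>"
        using False mn by (auto simp: P_def K_def not_le ceiling_less_iff less_ceiling_iff)
      then have Rr: "R \<le> r"
        using real_sqrt_ge_abs1[of "real_of_int m" "real_of_int n"] real_sqrt_ge_abs2[of "real_of_int n" "real_of_int m"] unfolding r_def by linarith
      have r1: "r \<ge> 1" and rC: "(2 * C / (b - a)) ^ 3 \<le> r" using Rr by (auto simp: R_def)
      have "2 * C / (b - a) > 0" using C ab by simp
      then have "(2 * C / (b - a)) ^ 3 = (2 * C / (b - a)) powr 3" by (simp only: powr_numeral)
      then have "2 * C / (b - a) = ((2 * C / (b - a)) ^ 3) powr (1/3)"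
        using C ab by (simp only: powr_powr) simp
      also have "\<dots> \<le> r powr (1/3)" using rC C ab by (intro powr_mono2) auto
      finally have "C * r powr (- 1/3) \<le> (b - a) / 2"
        using r1 C ab by (simp add: powr_minus_divide field_simps)
      then have "norm (osc m n a b) \<le> (b - a) / 2"
        using C(2)[of "real_of_int m" "real_of_int n"] r1 by (simp add: r_def)
      then have "norm (osc m n a b) / (b - a) \<le> 1/2" using ab by (simp add: field_simps)
      then show ?thesis using q12 by linarith
    qed
    then show "norm (osc m n a b) \<le> q * (b - a)" using ab by (simp add: field_simps)
  qed
qed

end

section \<open>The L2 norm on curved arcs\<close>

text \<open>The product of two entries is at most half the sum of their squares, and symmetry of the
  kernel turns both halves into row sums.\<close>

lemma schur_test:
  fixes k :: "'a \<Rightarrow> 'a \<Rightarrow> real" and \<alpha> :: "'a \<Rightarrow> real"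
  assumes sym: "\<And>i j. k i j = k j i" and nonneg: "\<And>i j. 0 \<le> k i j"
    and row: "\<And>i. i \<in> S \<Longrightarrow> (\<Sum>j\<in>S. k i j) \<le> \<Lambda>"
  shows "(\<Sum>i\<in>S. \<Sum>j\<in>S. k i j * \<alpha> i * \<alpha> j) \<le> \<Lambda> * (\<Sum>i\<in>S. (\<alpha> i)\<^sup>2)"
proof -
  have "(\<Sum>i\<in>S. \<Sum>j\<in>S. k i j * \<alpha> i * \<alpha> j) \<le> (\<Sum>i\<in>S. \<Sum>j\<in>S. k i j * (\<alpha> i)\<^sup>2 / 2 + k i j * (\<alpha> j)\<^sup>2 / 2)"
  proof (intro sum_mono)
    fix i j
    have "\<alpha> i * \<alpha> j \<le> ((\<alpha> i)\<^sup>2 + (\<alpha> j)\<^sup>2) / 2"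
      using sum_squares_bound[of "\<alpha> i" "\<alpha> j"] by simp
    then have "k i j * (\<alpha> i * \<alpha> j) \<le> k i j * (((\<alpha> i)\<^sup>2 + (\<alpha> j)\<^sup>2) / 2)"
      using nonneg by (intro mult_left_mono) auto
    then show "k i j * \<alpha> i * \<alpha> j \<le> k i j * (\<alpha> i)\<^sup>2 / 2 + k i j * (\<alpha> j)\<^sup>2 / 2"
      by (simp add: algebra_simps add_divide_distrib)
  qed
  also have "\<dots> = (\<Sum>i\<in>S. \<Sum>j\<in>S. k i j * (\<alpha> i)\<^sup>2 / 2) + (\<Sum>i\<in>S. \<Sum>j\<in>S. k i j * (\<alpha> j)\<^sup>2 / 2)"
    by (simp add: sum.distrib)
  also have "(\<Sum>i\<in>S. \<Sum>j\<in>S. k i j * (\<alpha> j)\<^sup>2 / 2) = (\<Sum>i\<in>S. \<Sum>j\<in>S. k i j * (\<alpha> i)\<^sup>2 / 2)"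
    by (subst sum.swap) (simp add: sym)
  also have "(\<Sum>i\<in>S. \<Sum>j\<in>S. k i j * (\<alpha> i)\<^sup>2 / 2) + (\<Sum>i\<in>S. \<Sum>j\<in>S. k i j * (\<alpha> i)\<^sup>2 / 2)
      = (\<Sum>i\<in>S. (\<Sum>j\<in>S. k i j) * (\<alpha> i)\<^sup>2)"
    by (simp add: sum_distrib_right flip: sum.distrib)
  also have "\<dots> \<le> (\<Sum>i\<in>S. \<Lambda> * (\<alpha> i)\<^sup>2)"
    by (intro sum_mono mult_right_mono row) auto
  finally show ?thesis by (simp add: sum_distrib_left)
qed

text \<open>The condition means distance below E^(1/6). Two neighbours within squared distance m of
  \<xi> are within 4m of each other, so the squared sides multiply to at most 4 m^3 < 4E, against
  \<open>lattice_circle_triangle\<close>.\<close>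

lemma lattice_circle_card_near:
  assumes "\<xi> \<in> lattice_circle E"
  shows "card {\<eta> \<in> lattice_circle E. \<eta> \<noteq> \<xi> \<and> ((fst \<xi> - fst \<eta>)\<^sup>2 + (snd \<xi> - snd \<eta>)\<^sup>2) ^ 3 < int E} \<le> 1"
proof -
  define d where "d v w = (fst v - fst w)\<^sup>2 + (snd v - snd w)\<^sup>2" for v w :: "int \<times> int"
  have "\<eta> = \<zeta>" if \<eta>: "\<eta> \<in> lattice_circle E" "\<eta> \<noteq> \<xi>" "d \<xi> \<eta> ^ 3 < int E"
    and \<zeta>: "\<zeta> \<in> lattice_circle E" "\<zeta> \<noteq> \<xi>" "d \<xi> \<zeta> ^ 3 < int E" for \<eta> \<zeta>
  proof (rule ccontr)
    assume "\<eta> \<noteq> \<zeta>"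
    then have big: "4 * int E \<le> d \<xi> \<eta> * d \<eta> \<zeta> * d \<xi> \<zeta>"
      using lattice_circle_triangle[OF assms \<eta>(1) \<zeta>(1)] \<eta>(2) \<zeta>(2) by (simp add: d_def)
    define m where "m = max (d \<xi> \<eta>) (d \<xi> \<zeta>)"
    have nn: "0 \<le> d v w" for v w by (simp add: d_def)
    have sq: "(p - q)\<^sup>2 \<le> 2 * ((r - p)\<^sup>2 + (r - q)\<^sup>2)" for p q r :: int
      using zero_le_power2[of "(r - p) + (r - q)"] by (simp add: power2_eq_square algebra_simps)
    have "d \<eta> \<zeta> \<le> 2 * (d \<xi> \<eta> + d \<xi> \<zeta>)"
      unfolding d_def
      by (rule order.trans[OF add_mono[OF sq[of _ _ "fst \<xi>"] sq[of _ _ "snd \<xi>"]]]) (simp add: algebra_simps)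
    then have "d \<eta> \<zeta> \<le> 4 * m" by (simp add: m_def)
    then have "d \<xi> \<eta> * d \<eta> \<zeta> * d \<xi> \<zeta> \<le> m * (4 * m) * m"
      using nn by (intro mult_mono) (auto simp: m_def le_max_iff_disj)
    also have "\<dots> = 4 * m ^ 3" by (simp add: power3_eq_cube)
    also have "\<dots> < 4 * int E" using \<eta>(3) \<zeta>(3) by (simp add: m_def max_def)
    finally show False using big by simp
  qed
  then show ?thesis
    unfolding d_def[symmetric]
    by (simp add: card_le_Suc0_iff_eq finite_lattice_circle)
qed

lemma powr_decay:
  fixes K \<eta> e :: real
  assumes "\<eta> > 0" "e > 0"
  obtains E0 :: nat where "E0 > 0" "\<And>E. E \<ge> E0 \<Longrightarrow> K * real E powr (- \<eta>) \<le> e"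
proof -
  have "((\<lambda>E::nat. real E powr (- \<eta>)) \<longlongrightarrow> 0) sequentially"
    using assms by (intro tendsto_neg_powr filterlim_real_sequentially) auto
  then have "((\<lambda>E::nat. K * real E powr (- \<eta>)) \<longlongrightarrow> K * 0) sequentially"
    by (intro tendsto_intros)
  then have "eventually (\<lambda>E. K * real E powr (- \<eta>) < e) sequentially"
    using order_tendstoD(2)[of _ "K * 0"] assms by simp
  then obtain E1 where "\<And>E. E \<ge> E1 \<Longrightarrow> K * real E powr (- \<eta>) < e"
    by (auto simp: eventually_sequentially)
  then show ?thesis using that[of "Suc E1"] by (force intro: less_imp_le)
qed

section \<open>Energy of an eigenfunction restricted to a curved arc\<close>

context curved_arc
begin

definition wave :: "nat \<Rightarrow> (int \<times> int \<Rightarrow> complex) \<Rightarrow> real \<Rightarrow> complex" where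
  "wave E c t = (\<Sum>\<xi>\<in>lattice_circle E. c \<xi> * cis (2 * pi * (of_int (fst \<xi>) * x t + of_int (snd \<xi>) * y t)))"

lemma eigf_eq_wave: "eigf E c (x t, y t) = wave E c t"
  unfolding eigf_def wave_def by (intro sum.cong) (auto simp: cis_conv_exp mult_ac)

lemma cont_wave: "continuous_on {a..b} (wave E c)"
  unfolding wave_def by (intro continuous_intros cont_x cont_y)

lemma wave_has_integral:
  assumes "a \<le> s" "s \<le> t" "t \<le> b"
  shows "(wave E c has_integral (\<Sum>\<xi>\<in>lattice_circle E. c \<xi> * osc (of_int (fst \<xi>)) (of_int (snd \<xi>)) s t)) {s..t}"
proof -
  have "((\<lambda>\<tau>. cis (2 * pi * (u * x \<tau> + v * y \<tau>))) has_integral osc u v s t) {s..t}" for u v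
    unfolding osc_def
    using assms by (intro integrable_integral integrable_continuous_real continuous_intros continuous_on_subset[OF cont_x] continuous_on_subset[OF cont_y]) auto
  then show ?thesis
    unfolding wave_def by (intro has_integral_sum has_integral_mult_right finite_lattice_circle)
qed

text \<open>Expanding the square produces differences of lattice points: integer vectors, nonzero
  off the diagonal, to which \<open>osc_gap\<close> and \<open>osc_decay\<close> apply.\<close>

lemma wave_energy_has_integral:
  "((\<lambda>t. (norm (wave E c t))\<^sup>2) has_integral
     (\<Sum>\<xi>\<in>lattice_circle E. \<Sum>\<eta>\<in>lattice_circle E.
       Re (c \<xi> * cnj (c \<eta>) * osc (of_int (fst \<xi> - fst \<eta>)) (of_int (snd \<xi> - snd \<eta>)) a b))) {a..b}"
proof -
  define e where "e \<xi> t = cis (2 * pi * (of_int (fst \<xi>) * x t + of_int (snd \<xi>) * y t))" for \<xi> :: "int \<times> int" and t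
  have sq: "of_real ((norm (wave E c t))\<^sup>2) = (\<Sum>\<xi>\<in>lattice_circle E. \<Sum>\<eta>\<in>lattice_circle E.
      c \<xi> * cnj (c \<eta>) * cis (2 * pi * (of_int (fst \<xi> - fst \<eta>) * x t + of_int (snd \<xi> - snd \<eta>) * y t)))" for t
  proof -
    have ee: "e \<xi> t * cnj (e \<eta> t) = cis (2 * pi * (of_int (fst \<xi> - fst \<eta>) * x t + of_int (snd \<xi> - snd \<eta>) * y t))" for \<xi> \<eta>
      by (simp add: e_def cis_cnj cis_mult algebra_simps)
    have "of_real ((norm (wave E c t))\<^sup>2) = wave E c t * cnj (wave E c t)" by (rule complex_norm_square)
    also have "\<dots> = (\<Sum>\<xi>\<in>lattice_circle E. \<Sum>\<eta>\<in>lattice_circle E. (c \<xi> * e \<xi> t) * (cnj (c \<eta>) * cnj (e \<eta> t)))"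
      by (simp add: wave_def e_def sum_product)
    also have "\<dots> = (\<Sum>\<xi>\<in>lattice_circle E. \<Sum>\<eta>\<in>lattice_circle E. c \<xi> * cnj (c \<eta>) * (e \<xi> t * cnj (e \<eta> t)))"
      by (simp add: mult_ac)
    finally show ?thesis by (simp only: ee)
  qed
  have "((\<lambda>\<tau>. cis (2 * pi * (u * x \<tau> + v * y \<tau>))) has_integral osc u v a b) {a..b}" for u v
    unfolding osc_def
    by (intro integrable_integral integrable_continuous_real continuous_intros cont_x cont_y)
  then have "((\<lambda>t. complex_of_real ((norm (wave E c t))\<^sup>2)) has_integral
     (\<Sum>\<xi>\<in>lattice_circle E. \<Sum>\<eta>\<in>lattice_circle E.
       c \<xi> * cnj (c \<eta>) * osc (of_int (fst \<xi> - fst \<eta>)) (of_int (snd \<xi> - snd \<eta>)) a b)) {a..b}"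
    unfolding sq by (intro has_integral_sum has_integral_mult_right finite_lattice_circle)
  from has_integral_linear[OF this bounded_linear_Re] show ?thesis by (simp add: o_def)
qed

text \<open>Each row of the Gram matrix has off-diagonal sum at most (b - a) - c0, so by Schur's
  test the diagonal b - a wins by c0.\<close>

lemma wave_energy_lower_bound:
  obtains E0 :: nat and c0 :: real where "c0 > 0"
    "\<And>E c. E \<ge> E0 \<Longrightarrow> c0 * (\<Sum>\<xi>\<in>lattice_circle E. (norm (c \<xi>))\<^sup>2) \<le> integral {a..b} (\<lambda>t. (norm (wave E c t))\<^sup>2)"
proof -
  obtain C where C: "C > 0"
    "\<And>u v. sqrt (u\<^sup>2 + v\<^sup>2) \<ge> 1 \<Longrightarrow> norm (osc u v a b) \<le> C * sqrt (u\<^sup>2 + v\<^sup>2) powr (- 1/3)"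
    using osc_decay by blast
  obtain q where q: "0 \<le> q" "q < 1"
    "\<And>(m::int) (n::int). m \<noteq> 0 \<or> n \<noteq> 0 \<Longrightarrow> norm (osc (of_int m) (of_int n) a b) \<le> q * (b - a)"
    using osc_gap by blast
  \<comment> \<open>Frequencies at distance at least E^(1/6) contribute O(E^(-1/18)) each; half of
    that exponent is allotted to their number.\<close>
  obtain B where B: "B > 0" "\<And>E. E > 0 \<Longrightarrow> real (card (lattice_circle E)) \<le> B * real E powr (1/36)"
    using card_lattice_circle_bound[of "1/36"] by auto
  \<comment> \<open>Half of the gap (1 - q)(b - a) is spent on the far frequencies, the other half
    remains.\<close>
  define c0 where "c0 = (1 - q) * (b - a) / 2"
  have c0: "c0 > 0" using q ab by (simp add: c0_def)
  obtain E0 :: nat where E0: "E0 > 0" "\<And>E. E \<ge> E0 \<Longrightarrow> (B * C) * real E powr (- (1/36)) \<le> c0"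
    using powr_decay[of "1/36" c0 "B * C"] c0 by auto
  show ?thesis
  proof
    show "c0 > 0" by (rule c0)
    fix E :: nat and c :: "int \<times> int \<Rightarrow> complex" assume "E \<ge> E0"
    then have E: "E > 0" "(B * C) * real E powr (- (1/36)) \<le> c0" using E0 by auto
    define S where "S = lattice_circle E"
    have finS: "finite S" by (simp add: S_def finite_lattice_circle)
    define A where "A = (\<Sum>\<xi>\<in>S. (norm (c \<xi>))\<^sup>2)"
    define o' where "o' \<xi> \<eta> = osc (of_int (fst \<xi> - fst \<eta>)) (of_int (snd \<xi> - snd \<eta>)) a b" for \<xi> \<eta> :: "int \<times> int"
    define k where "k \<xi> \<eta> = (if \<xi> = \<eta> then 0 else norm (o' \<xi> \<eta>))" for \<xi> \<eta>
    have "norm (o' \<xi> \<eta>) = norm (o' \<eta> \<xi>)" for \<xi> \<eta>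
      using osc_uminus[of "of_int (fst \<xi> - fst \<eta>)" "of_int (snd \<xi> - snd \<eta>)" a b]
      by (simp add: o'_def)
    then have ksym: "k \<xi> \<eta> = k \<eta> \<xi>" for \<xi> \<eta> by (simp add: k_def)
    define d where "d \<xi> \<eta> = (fst \<xi> - fst \<eta>)\<^sup>2 + (snd \<xi> - snd \<eta>)\<^sup>2" for \<xi> \<eta> :: "int \<times> int"
    define far where "far = C * real E powr (- 1/18)"
    have far0: "far \<ge> 0" using C by (simp add: far_def)
    \<comment> \<open>each frequency has at most one neighbour within \<open>E\<close> to the power \<open>1/6\<close>; that one is
      controlled by the gap, all the others by the decay\<close>
    have kle: "k \<xi> \<eta> \<le> (if \<eta> \<noteq> \<xi> \<and> d \<xi> \<eta> ^ 3 < int E then q * (b - a) else 0) + far" for \<xi> \<eta>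
    proof (cases "\<xi> = \<eta>")
      case True
      then show ?thesis using far0 by (simp add: k_def)
    next
      case False
      then have ne: "fst \<xi> - fst \<eta> \<noteq> 0 \<or> snd \<xi> - snd \<eta> \<noteq> 0" by (auto simp: prod_eq_iff)
      show ?thesis
      proof (cases "d \<xi> \<eta> ^ 3 < int E")
        case True
        then show ?thesis using q(3)[OF ne] False far0 by (auto simp: k_def o'_def)
      next
        case far: False
        define r where "r = sqrt ((real_of_int (fst \<xi> - fst \<eta>))\<^sup>2 + (real_of_int (snd \<xi> - snd \<eta>))\<^sup>2)"
        have rd: "r = sqrt (real_of_int (d \<xi> \<eta>))" by (simp add: r_def d_def)
        have "d \<xi> \<eta> > 0" using ne by (auto simp: d_def sum_power2_gt_zero_iff)
        then have d1: "real_of_int (d \<xi> \<eta>) \<ge> 1" by simp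
        have "real E \<le> real_of_int (d \<xi> \<eta> ^ 3)" using far by linarith
        then have E3: "real E \<le> real_of_int (d \<xi> \<eta>) powr 3" using d1 by (simp add: powr_numeral)
        have "r \<ge> 1" using d1 by (simp add: rd)
        then have "norm (o' \<xi> \<eta>) \<le> C * r powr (- 1/3)"
          unfolding o'_def r_def by (rule C(2))
        also have "r powr (- 1/3) = (real_of_int (d \<xi> \<eta>) powr 3) powr (- 1/18)"
          using d1 by (simp add: rd powr_powr powr_half_sqrt[symmetric] del: powr_numeral)
        also have "C * \<dots> \<le> far"
          unfolding far_def using E3 E C by (intro mult_left_mono powr_mono2') auto
        finally show ?thesis using False far0 far by (simp add: k_def)
      qed
    qed
    have row: "(\<Sum>\<eta>\<in>S. k \<xi> \<eta>) \<le> (b - a) - c0" if \<xi>: "\<xi> \<in> S" for \<xi>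
    proof -
      have "(\<Sum>\<eta>\<in>S. k \<xi> \<eta>) \<le> (\<Sum>\<eta>\<in>S. (if \<eta> \<noteq> \<xi> \<and> d \<xi> \<eta> ^ 3 < int E then q * (b - a) else 0) + far)"
        by (intro sum_mono kle)
      also have "\<dots> = real (card {\<eta> \<in> S. \<eta> \<noteq> \<xi> \<and> d \<xi> \<eta> ^ 3 < int E}) * (q * (b - a)) + real (card S) * far"
        using finS by (simp add: sum.distrib sum.If_cases Int_def)
      also have "\<dots> \<le> 1 * (q * (b - a)) + (B * real E powr (1/36)) * far"
        using lattice_circle_card_near[OF \<xi>[unfolded S_def]] q ab B(2)[OF E(1)] far0
        by (intro add_mono mult_right_mono) (auto simp: S_def d_def)
      also have "(B * real E powr (1/36)) * far = (B * C) * real E powr (- (1/36))"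
        by (simp add: far_def powr_add[symmetric])
      also have "\<dots> \<le> c0" by (rule E(2))
      finally show ?thesis by (simp add: c0_def field_simps)
    qed
    have "(\<Sum>\<xi>\<in>S. \<Sum>\<eta>\<in>S. Re (c \<xi> * cnj (c \<eta>) * o' \<xi> \<eta>))
        \<ge> (\<Sum>\<xi>\<in>S. \<Sum>\<eta>\<in>S. (if \<xi> = \<eta> then (b - a) * (norm (c \<xi>))\<^sup>2 else 0) - k \<xi> \<eta> * norm (c \<xi>) * norm (c \<eta>))"
    proof (intro sum_mono)
      fix \<xi> \<eta>
      show "(if \<xi> = \<eta> then (b - a) * (norm (c \<xi>))\<^sup>2 else 0) - k \<xi> \<eta> * norm (c \<xi>) * norm (c \<eta>) \<le> Re (c \<xi> * cnj (c \<eta>) * o' \<xi> \<eta>)"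
      proof (cases "\<xi> = \<eta>")
        case True
        have "o' \<eta> \<eta> = of_real (b - a)"
          using ab by (simp add: o'_def osc_def scaleR_conv_of_real)
        moreover have "c \<eta> * cnj (c \<eta>) = of_real ((norm (c \<eta>))\<^sup>2)" by (rule complex_norm_square[symmetric])
        ultimately show ?thesis using True by (simp add: k_def)
      next
        case False
        have "- Re (c \<xi> * cnj (c \<eta>) * o' \<xi> \<eta>) \<le> norm (c \<xi> * cnj (c \<eta>) * o' \<xi> \<eta>)"
          using abs_Re_le_cmod[of "c \<xi> * cnj (c \<eta>) * o' \<xi> \<eta>"] by linarith
        then show ?thesis using False by (simp add: k_def norm_mult mult_ac)
      qed
    qed
    moreover have "(\<Sum>\<xi>\<in>S. \<Sum>\<eta>\<in>S. (if \<xi> = \<eta> then (b - a) * (norm (c \<xi>))\<^sup>2 else 0) - k \<xi> \<eta> * norm (c \<xi>) * norm (c \<eta>))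
        = (b - a) * A - (\<Sum>\<xi>\<in>S. \<Sum>\<eta>\<in>S. k \<xi> \<eta> * norm (c \<xi>) * norm (c \<eta>))"
      using finS by (simp add: sum_subtractf A_def sum_distrib_left)
    moreover have "(\<Sum>\<xi>\<in>S. \<Sum>\<eta>\<in>S. k \<xi> \<eta> * norm (c \<xi>) * norm (c \<eta>)) \<le> ((b - a) - c0) * A"
      unfolding A_def by (rule schur_test[OF ksym _ row]) (simp add: k_def)
    moreover have "integral {a..b} (\<lambda>t. (norm (wave E c t))\<^sup>2) = (\<Sum>\<xi>\<in>S. \<Sum>\<eta>\<in>S. Re (c \<xi> * cnj (c \<eta>) * o' \<xi> \<eta>))"
      using integral_unique[OF wave_energy_has_integral[of E c]] by (simp only: S_def o'_def)
    ultimately have "integral {a..b} (\<lambda>t. (norm (wave E c t))\<^sup>2) \<ge> c0 * A" by (simp add: algebra_simps)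
    then show "c0 * (\<Sum>\<xi>\<in>lattice_circle E. (norm (c \<xi>))\<^sup>2) \<le> integral {a..b} (\<lambda>t. (norm (wave E c t))\<^sup>2)"
      by (simp add: A_def S_def)
  qed
qed

lemma norm_wave_le: "norm (wave E c t) \<le> (\<Sum>\<xi>\<in>lattice_circle E. norm (c \<xi>))"
  unfolding wave_def by (rule order.trans[OF norm_sum]) (simp add: norm_mult)

end

lemma sum_norm_squared_le:
  "(\<Sum>\<xi>\<in>S. norm (c \<xi>))\<^sup>2 \<le> real (card S) * (\<Sum>\<xi>\<in>S. (norm (c \<xi>))\<^sup>2)"
  using Cauchy_Schwarz_ineq_sum[of "\<lambda>_. 1" "\<lambda>\<xi>. norm (c \<xi>)" S] by simp

section \<open>Sign changes\<close>

lemma card_le_diameter: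
  fixes B :: real
  assumes "finite Q" "B \<ge> 0" and diam: "\<And>i j. i \<in> Q \<Longrightarrow> j \<in> Q \<Longrightarrow> i \<le> j \<Longrightarrow> real j \<le> real i + B"
  shows "real (card Q) \<le> B + 1"
proof (cases "Q = {}")
  case False
  define m where "m = Min Q"
  define M where "M = Max Q"
  have m: "m \<in> Q" "M \<in> Q" using assms False by (auto simp: m_def M_def)
  have sub: "Q \<subseteq> {m..M}" using assms by (auto simp: m_def M_def)
  have "card Q \<le> card {m..M}" by (rule card_mono[OF _ sub]) simp
  moreover have "m \<le> M" using sub m by auto
  ultimately show ?thesis using diam[OF m] by simp
qed (use assms in simp)

context curved_arc
begin

text \<open>With R = sqrt E, pieces have length of order n^5 / R, many wavelengths, and a frequency
  is slow where its phase slope is below R / n^3. Together with n^8 <= R these exponents make every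
  error O(n^-2), against c0 / n from the energy. Finiteness is assumed because \<open>card\<close>
  of an infinite set is 0.\<close>

lemma wave_sign_change_lower_bound:
  obtains E0 :: nat and n0 c1 :: real where "c1 > 0"
    "\<And>E c n. E \<ge> E0 \<Longrightarrow> n \<ge> n0 \<Longrightarrow> real (card (lattice_circle E)) \<le> n \<Longrightarrow> n ^ 8 \<le> sqrt (real E) \<Longrightarrow>
       \<forall>t\<in>{a..b}. Im (wave E c t) = 0 \<Longrightarrow> \<exists>\<xi>\<in>lattice_circle E. c \<xi> \<noteq> 0 \<Longrightarrow>
       finite {t \<in> {a..<b}. wave E c t = 0} \<Longrightarrow>
       c1 * sqrt (real E) / n ^ 6 \<le> real (card {t \<in> {a..<b}. wave E c t = 0})"
proof -
  obtain E0 :: nat and c0 where c0: "c0 > 0"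
    "\<And>E c. E \<ge> E0 \<Longrightarrow> c0 * (\<Sum>\<xi>\<in>lattice_circle E. (norm (c \<xi>))\<^sup>2) \<le> integral {a..b} (\<lambda>t. (norm (wave E c t))\<^sup>2)"
    using that by (rule wave_energy_lower_bound)
  define L where "L = b - a"
  have L0: "L > 0" using ab by (simp add: L_def)
  \<comment> \<open>The constants of the error terms \<open>t1\<close> to \<open>t4\<close>, each
    divided by n^2; \<open>n0\<close> then keeps D / n^2 below half of c0 / n.\<close>
  define D where "D = 4 * M / \<kappa> + 4 * L + 1 + L * M"
  define n0 where "n0 = max 1 (2 * D / c0)"
  show ?thesis
  proof
    show "c0 / (4 * L) > 0" using c0 L0 by simp
    fix E :: nat and c :: "int \<times> int \<Rightarrow> complex" and n :: real
    assume E: "E \<ge> E0" and n: "n \<ge> n0" and N: "real (card (lattice_circle E)) \<le> n" and n8: "n ^ 8 \<le> sqrt (real E)"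
      and real_valued: "\<forall>t\<in>{a..b}. Im (wave E c t) = 0"
      and nz: "\<exists>\<xi>\<in>lattice_circle E. c \<xi> \<noteq> 0"
      and finZ: "finite {t \<in> {a..<b}. wave E c t = 0}"
    define S where "S = lattice_circle E"
    have finS: "finite S" by (simp add: S_def finite_lattice_circle)
    define R where "R = sqrt (real E)"
    have n1: "n \<ge> 1" and nD: "2 * D / c0 \<le> n" using n by (auto simp: n0_def)
    have n8': "n ^ 8 \<le> R" using n8 by (simp add: R_def)
    have R1: "R \<ge> 1" using n8' one_le_power[OF n1, of 8] by linarith
    define A where "A = (\<Sum>\<xi>\<in>S. (norm (c \<xi>))\<^sup>2)"
    define T where "T = (\<Sum>\<xi>\<in>S. norm (c \<xi>))"
    obtain \<xi>0 where \<xi>0: "\<xi>0 \<in> S" "c \<xi>0 \<noteq> 0" using nz by (auto simp: S_def)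
    have A0: "A > 0" unfolding A_def using \<xi>0 finS by (intro sum_pos2[of S \<xi>0]) auto
    have T0: "T \<ge> 0" unfolding T_def by (intro sum_nonneg) auto
    \<comment> \<open>Cauchy-Schwarz. The factor n lost here is why errors must be small compared
      with 1/n.\<close>
    have TA: "T\<^sup>2 \<le> n * A"
      using sum_norm_squared_le[of c S] N A0 unfolding T_def[symmetric] A_def[symmetric]
      by (elim order.trans) (intro mult_right_mono, auto simp: S_def)
    define f where "f t = Re (wave E c t)" for t
    have wf: "wave E c t = of_real (f t)" if "t \<in> {a..b}" for t
      using real_valued that by (simp add: f_def complex_eq_iff)
    have cf: "continuous_on {a..b} f" unfolding f_def by (intro continuous_intros cont_wave)
    have fT: "\<bar>f t\<bar> \<le> T" for t
      using norm_wave_le[of E c t] abs_Re_le_cmod[of "wave E c t"] by (simp add: f_def T_def S_def)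
    have f2: "(f t)\<^sup>2 \<le> T\<^sup>2" for t using fT[of t] T0 by (metis abs_le_square_iff abs_of_nonneg)
    define K where "K = nat \<lfloor>R / n ^ 5\<rfloor>"
    have "n ^ 5 * 1 \<le> n ^ 5 * n ^ 3" using n1 by (intro mult_left_mono one_le_power) auto
    also have "n ^ 5 * n ^ 3 = n ^ 8" by (simp flip: power_add)
    finally have Rn: "1 \<le> R / n ^ 5" using n8' n1 by (simp add: field_simps)
    have K: "K \<ge> 1" "real K \<le> R / n ^ 5"
      using Rn unfolding K_def by linarith+
    have "R / n ^ 5 - 1 \<le> real K" unfolding K_def by linarith
    then have "R / n ^ 5 \<le> 2 * real K" using K(1) by linarith
    then have K2: "R / (2 * n ^ 5) \<le> real K" by simp
    have K0: "real K > 0" using K(1) by simp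
    define p where "p i = a + real i * L / real K" for i
    have pS: "p (Suc i) = p i + L / real K" for i by (simp add: p_def add_divide_distrib algebra_simps)
    have p0: "p 0 = a" and pK: "p K = b" using K0 by (auto simp: p_def L_def)
    have pmono: "p i \<le> p j" if "i \<le> j" for i j
      unfolding p_def using that L0 K0 by (intro add_left_mono divide_right_mono mult_right_mono) auto
    have pin: "a \<le> p i" "p i \<le> p (Suc i)" "p (Suc i) \<le> b" if "i < K" for i
      using pmono[of 0 i] pmono[of i "Suc i"] pmono[of "Suc i" K] that p0 pK by auto
    define \<delta> where "\<delta> = 1 / n ^ 3"
    have \<delta>0: "\<delta> > 0" using n1 by (simp add: \<delta>_def)
    define I where "I i = {p i..p (Suc i)}" for i
    have Isub: "I i \<subseteq> {a..b}" if "i < K" for i using pin[OF that] by (auto simp: I_def)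
    \<comment> \<open>on a piece that is neither bad nor hit, the wave has constant sign but small mean\<close>
    define bad where "bad = {i. i < K \<and> (\<exists>\<xi>\<in>S. \<exists>t\<in>I i. \<bar>of_int (fst \<xi>) * x1 t + of_int (snd \<xi>) * y1 t\<bar> < \<delta> * R)}"
    \<comment> \<open>Half-open pieces assign a zero at a common endpoint to one piece only, so
      zeros chosen from different pieces are distinct.\<close>
    define hit where "hit = {i. i < K \<and> (\<exists>t\<in>{p i..<p (Suc i)}. f t = 0)}"
    have fin: "finite bad" "finite hit" by (auto simp: bad_def hit_def)
    define B where "B = 1 / (\<delta> * R) + L / real K * (R * M) / (\<delta> * R)\<^sup>2"
    have B0: "B \<ge> 0" using \<delta>0 R1 L0 K0 M_nonneg by (auto simp: B_def)

    have "integral {a..p m} (\<lambda>t. (f t)\<^sup>2) = (\<Sum>i<m. integral (I i) (\<lambda>t. (f t)\<^sup>2))" if "m \<le> K" for m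
      using that
    proof (induction m)
      case 0
      then show ?case by (simp add: p0)
    next
      case (Suc m)
      have "(\<lambda>t. (f t)\<^sup>2) integrable_on {a..p (Suc m)}"
        using pin[of m] Suc.prems by (intro integrable_continuous_real continuous_intros continuous_on_subset[OF cf]) auto
      then have "integral {a..p m} (\<lambda>t. (f t)\<^sup>2) + integral {p m..p (Suc m)} (\<lambda>t. (f t)\<^sup>2) = integral {a..p (Suc m)} (\<lambda>t. (f t)\<^sup>2)"
        using pin[of m] Suc.prems by (intro Henstock_Kurzweil_Integration.integral_combine) auto
      then show ?case using Suc by (simp add: I_def)
    qed
    from this[of K] have split: "integral {a..b} (\<lambda>t. (f t)\<^sup>2) = (\<Sum>i<K. integral (I i) (\<lambda>t. (f t)\<^sup>2))"
      by (simp add: pK)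

    have cfI: "continuous_on (I i) f" if "i < K" for i
      using continuous_on_subset[OF cf Isub[OF that]] .
    have trivial: "integral (I i) (\<lambda>t. (f t)\<^sup>2) \<le> T\<^sup>2 * (L / real K)" if i: "i < K" for i
    proof -
      have "integral (I i) (\<lambda>t. (f t)\<^sup>2) \<le> integral (I i) (\<lambda>t. T\<^sup>2)"
        using cfI[OF i] f2 unfolding I_def
        by (intro integral_le integrable_continuous_real continuous_intros) auto
      also have "\<dots> = T\<^sup>2 * (L / real K)"
        using pin[OF i] by (simp add: I_def pS)
      finally show ?thesis .
    qed
    \<comment> \<open>With constant sign the integral of |f| equals the modulus of the integral of
      f, so f^2 <= T |f| reduces energy to the mean, in which every frequency oscillates.\<close>
    have good: "integral (I i) (\<lambda>t. (f t)\<^sup>2) \<le> T\<^sup>2 * B" if i: "i < K" "i \<notin> bad" "i \<notin> hit" for i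
    proof -
      have noz: "f t \<noteq> 0" if "t \<in> {p i..<p (Suc i)}" for t using i that by (auto simp: hit_def)
      \<comment> \<open>The right endpoint may still be a zero, hence the weak inequality.\<close>
      have sign: "s * f t \<ge> 0" if t: "t \<in> I i" and s: "s * f (p i) > 0" "s = 1 \<or> s = -1" for s t
      proof (rule ccontr)
        assume "\<not> 0 \<le> s * f t"
        then have neg: "s * f t < 0" by simp
        have "continuous_on {p i..t} (\<lambda>t. s * f t)"
          using t by (intro continuous_intros continuous_on_subset[OF cfI[OF i(1)]]) (auto simp: I_def)
        then obtain z where z: "p i \<le> z" "z \<le> t" "s * f z = 0"
          using IVT2'[of "\<lambda>t. s * f t" t 0 "p i"] neg s t by (auto simp: I_def)
        then have "z \<noteq> t" using neg by auto
        then have "f z \<noteq> 0" using z t by (intro noz) (auto simp: I_def)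
        then show False using z s by auto
      qed
      have "p i < p (Suc i)" using L0 K0 by (simp add: pS)
      then have "f (p i) \<noteq> 0" by (intro noz) auto
      then obtain s where s: "s * f (p i) > 0" "s = 1 \<or> s = (-1::real)"
        by (cases "f (p i) > 0") (auto intro: that[of 1] that[of "-1"])
      have int: "(f has_integral Re (\<Sum>\<xi>\<in>S. c \<xi> * osc (of_int (fst \<xi>)) (of_int (snd \<xi>)) (p i) (p (Suc i)))) (I i)"
        using has_integral_linear[OF wave_has_integral[OF pin[OF i(1)], of E c] bounded_linear_Re]
        by (simp add: f_def[abs_def] o_def S_def I_def)
      have oscB: "norm (osc (of_int (fst \<xi>)) (of_int (snd \<xi>)) (p i) (p (Suc i))) \<le> B" if \<xi>: "\<xi> \<in> S" for \<xi>
      proof -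
        have "(real_of_int (fst \<xi>))\<^sup>2 + (real_of_int (snd \<xi>))\<^sup>2 = real E"
            using \<xi> by (simp add: S_def lattice_circle_of_int)
        then have "\<bar>real_of_int (fst \<xi>)\<bar> \<le> R" "\<bar>real_of_int (snd \<xi>)\<bar> \<le> R"
          unfolding R_def by (metis real_sqrt_ge_abs1, metis real_sqrt_ge_abs2)
        then have "norm (osc (of_int (fst \<xi>)) (of_int (snd \<xi>)) (p i) (p (Suc i)))
            \<le> 1 / (\<delta> * R) + (p (Suc i) - p i) * (R * M) / (\<delta> * R)\<^sup>2"
          using i \<xi> \<delta>0 R1 by (intro osc_nonstationary pin[OF i(1)]) (auto simp: bad_def I_def not_less)
        then show ?thesis by (simp add: B_def pS)
      qed
      have "integral (I i) (\<lambda>t. (f t)\<^sup>2) \<le> integral (I i) (\<lambda>t. T * (s * f t))"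
      proof (rule integral_le)
        show "(\<lambda>t. (f t)\<^sup>2) integrable_on I i" "(\<lambda>t. T * (s * f t)) integrable_on I i"
          using cfI[OF i(1)] unfolding I_def by (auto intro!: integrable_continuous_real continuous_intros)
        fix t assume t: "t \<in> I i"
        have "\<bar>f t\<bar> = s * f t" using sign[OF t s] s(2) by auto
        then have "(f t)\<^sup>2 = \<bar>f t\<bar> * (s * f t)" by (metis abs_mult_self_eq power2_eq_square)
        also have "\<dots> \<le> T * (s * f t)" by (intro mult_right_mono fT sign t s)
        finally show "(f t)\<^sup>2 \<le> T * (s * f t)" .
      qed
      also have "\<dots> = T * (s * integral (I i) f)" by simp
      also have "\<dots> \<le> T * (T * B)"
      proof (rule mult_left_mono[OF _ T0])
        have "s * integral (I i) f \<le> \<bar>integral (I i) f\<bar>" using s(2) by auto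
        also have "\<dots> \<le> norm (\<Sum>\<xi>\<in>S. c \<xi> * osc (of_int (fst \<xi>)) (of_int (snd \<xi>)) (p i) (p (Suc i)))"
          unfolding integral_unique[OF int] by (rule abs_Re_le_cmod)
        also have "\<dots> \<le> (\<Sum>\<xi>\<in>S. norm (c \<xi>) * B)"
          by (rule order.trans[OF norm_sum]) (auto simp: norm_mult intro!: sum_mono mult_left_mono oscB)
        finally show "s * integral (I i) f \<le> T * B" by (simp add: T_def sum_distrib_right)
      qed
      finally show ?thesis by (simp add: power2_eq_square mult.assoc)
    qed
    have energy: "integral {a..b} (\<lambda>t. (f t)\<^sup>2) \<le> T\<^sup>2 * ((L / real K) * (real (card bad) + real (card hit)) + real K * B)"
    proof -
      have "integral {a..b} (\<lambda>t. (f t)\<^sup>2) \<le> (\<Sum>i<K. (if i \<in> bad \<union> hit then T\<^sup>2 * (L / real K) else 0) + T\<^sup>2 * B)"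
        unfolding split
      proof (intro sum_mono)
        fix i assume "i \<in> {..<K}"
        then have i: "i < K" by simp
        have "0 \<le> T\<^sup>2 * B" using B0 by simp
        then show "integral (I i) (\<lambda>t. (f t)\<^sup>2) \<le> (if i \<in> bad \<union> hit then T\<^sup>2 * (L / real K) else 0) + T\<^sup>2 * B"
          using trivial[OF i] good[OF i] by auto
      qed
      also have "\<dots> = real (card ({..<K} \<inter> (bad \<union> hit))) * (T\<^sup>2 * (L / real K)) + real K * (T\<^sup>2 * B)"
        by (simp add: sum.distrib sum.If_cases Un_def)
      also have "\<dots> \<le> (real (card bad) + real (card hit)) * (T\<^sup>2 * (L / real K)) + real K * (T\<^sup>2 * B)"
      proof -
        have "card ({..<K} \<inter> (bad \<union> hit)) \<le> card (bad \<union> hit)" using fin by (intro card_mono) auto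
        also have "\<dots> \<le> card bad + card hit" by (rule card_Un_le)
        finally have "real (card ({..<K} \<inter> (bad \<union> hit))) \<le> real (card bad) + real (card hit)" by linarith
        then show ?thesis using L0 by (intro add_right_mono mult_right_mono) auto
      qed
      finally show ?thesis by (simp add: algebra_simps add_divide_distrib)
    qed

    define H where "H = card {t \<in> {a..<b}. wave E c t = 0}"
    have hitH: "card hit \<le> H"
    proof -
      have "\<forall>i\<in>hit. \<exists>t. t \<in> {p i..<p (Suc i)} \<and> f t = 0" by (auto simp: hit_def)
      then obtain z where z: "\<And>i. i \<in> hit \<Longrightarrow> z i \<in> {p i..<p (Suc i)} \<and> f (z i) = 0"
        by metis
      have "inj_on z hit"
      proof (rule linorder_inj_onI')
        fix i j assume "i \<in> hit" "j \<in> hit" "i < j"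
        then have "z i < p (Suc i)" "p (Suc i) \<le> p j" "p j \<le> z j"
          using z[of i] z[of j] pmono[of "Suc i" j] by simp_all
        then show "z i \<noteq> z j" by linarith
      qed
      moreover have "z ` hit \<subseteq> {t \<in> {a..<b}. wave E c t = 0}"
      proof
        fix t assume "t \<in> z ` hit"
        then obtain i where i: "i \<in> hit" "t = z i" by blast
        then have "i < K" by (simp add: hit_def)
        then have "t \<in> {a..<b}" using z[OF i(1)] pin[of i] i(2) by auto
        then show "t \<in> {t \<in> {a..<b}. wave E c t = 0}" using z[OF i(1)] wf[of t] i(2) by auto
      qed
      ultimately show ?thesis unfolding H_def using finZ by (intro card_inj_on_le)
    qed
    define \<rho> where "\<rho> = 4 * M * \<delta> / \<kappa>"
    have \<rho>0: "\<rho> \<ge> 0" using M_nonneg \<delta>0 \<kappa> by (simp add: \<rho>_def)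
    \<comment> \<open>For one frequency the slow parameters lie within \<rho> of each other, so they
      meet about \<rho> K / L pieces; the additive 2 pays for pieces cut at the ends.\<close>
    have badN: "real (card bad) \<le> n * (\<rho> * real K / L + 2)"
    proof -
      define Q where "Q \<xi> = {i. i < K \<and> (\<exists>t\<in>I i. \<bar>of_int (fst \<xi>) * x1 t + of_int (snd \<xi>) * y1 t\<bar> < \<delta> * R)}" for \<xi> :: "int \<times> int"
      have Q: "real (card (Q \<xi>)) \<le> (\<rho> * real K / L + 1) + 1" if \<xi>: "\<xi> \<in> S" for \<xi>
      proof (rule card_le_diameter)
        show "finite (Q \<xi>)" by (simp add: Q_def)
        show "0 \<le> \<rho> * real K / L + 1" using \<rho>0 L0 by simp
        fix i j assume ij: "i \<in> Q \<xi>" "j \<in> Q \<xi>" "i \<le> j"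
        then obtain t t' where t: "t \<in> I i" "t' \<in> I j"
          "\<bar>of_int (fst \<xi>) * x1 t + of_int (snd \<xi>) * y1 t\<bar> \<le> \<delta> * R"
          "\<bar>of_int (fst \<xi>) * x1 t' + of_int (snd \<xi>) * y1 t'\<bar> \<le> \<delta> * R"
          by (auto simp: Q_def intro: less_imp_le)
        have K': "i < K" "j < K" using ij by (auto simp: Q_def)
        have "(real_of_int (fst \<xi>))\<^sup>2 + (real_of_int (snd \<xi>))\<^sup>2 = real E"
            using \<xi> by (simp add: S_def lattice_circle_of_int)
        then have "\<kappa> * \<bar>t - t'\<bar> * R \<le> 4 * M * (\<delta> * R)"
          using slow_phase_diameter[OF subsetD[OF Isub[OF K'(1)] t(1)] subsetD[OF Isub[OF K'(2)] t(2)] t(3,4)]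
          by (simp add: R_def)
        then have "\<kappa> * \<bar>t - t'\<bar> \<le> 4 * M * \<delta>" using R1 by simp
        then have "\<bar>t - t'\<bar> \<le> \<rho>" using \<kappa> by (simp add: \<rho>_def field_simps)
        moreover have "p j - p (Suc i) \<le> t' - t" using t(1,2) by (auto simp: I_def)
        ultimately have "p j - p (Suc i) \<le> \<rho>" by linarith
        then have "(real j - real i - 1) * (L / real K) \<le> \<rho>"
          by (simp add: p_def algebra_simps add_divide_distrib diff_divide_distrib)
        then have "real j - real i - 1 \<le> \<rho> / (L / real K)" using L0 K0 by (subst pos_le_divide_eq) auto
        then show "real j \<le> real i + (\<rho> * real K / L + 1)" by simp
      qed
      have "bad = (\<Union>\<xi>\<in>S. Q \<xi>)" by (auto simp: bad_def Q_def)
      then have "card bad \<le> (\<Sum>\<xi>\<in>S. card (Q \<xi>))" using card_UN_le[OF finS] by metis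
      then have "real (card bad) \<le> (\<Sum>\<xi>\<in>S. real (card (Q \<xi>)))" by (metis of_nat_le_iff of_nat_sum)
      also have "\<dots> \<le> (\<Sum>\<xi>\<in>S. \<rho> * real K / L + 2)" using Q by (intro sum_mono) force
      also have "\<dots> = real (card S) * (\<rho> * real K / L + 2)" by simp
      also have "\<dots> \<le> n * (\<rho> * real K / L + 2)" using N \<rho>0 L0 by (intro mult_right_mono) (auto simp: S_def)
      finally show ?thesis .
    qed

    have "c0 * A \<le> integral {a..b} (\<lambda>t. (f t)\<^sup>2)"
    proof -
      have "integral {a..b} (\<lambda>t. (norm (wave E c t))\<^sup>2) = integral {a..b} (\<lambda>t. (f t)\<^sup>2)"
        by (intro integral_cong) (simp add: wf)
      then show ?thesis using c0(2)[OF E, of c] by (simp add: A_def S_def)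
    qed
    also note energy
    also have "T\<^sup>2 * ((L / real K) * (real (card bad) + real (card hit)) + real K * B)
        \<le> (n * A) * ((L / real K) * (n * (\<rho> * real K / L + 2) + real H) + real K * B)"
    proof (rule mult_mono[OF TA])
      have "real (card bad) + real (card hit) \<le> n * (\<rho> * real K / L + 2) + real H"
        using badN hitH by linarith
      then show "(L / real K) * (real (card bad) + real (card hit)) + real K * B
          \<le> (L / real K) * (n * (\<rho> * real K / L + 2) + real H) + real K * B"
        using L0 by (intro add_right_mono mult_left_mono) auto
      show "0 \<le> n * A" using n1 A0 by simp
      show "0 \<le> (L / real K) * (real (card bad) + real (card hit)) + real K * B"
        using L0 B0 by simp
    qed
    finally have "c0 \<le> n * ((L / real K) * (n * (\<rho> * real K / L + 2) + real H) + real K * B)"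
      using A0 by (simp only: mult.commute[of c0] mult.commute[of n A] mult.assoc mult_le_cancel_left_pos)
    then have "c0 / n \<le> (L / real K) * (n * (\<rho> * real K / L + 2) + real H) + real K * B"
      using n1 by (simp add: pos_divide_le_eq mult.commute)
    also have "(L / real K) * (n * (\<rho> * real K / L + 2) + real H) = n * \<rho> + 2 * n * L / real K + real H * L / real K"
      using L0 K0 by (simp add: field_simps)
    also have "real K * B = real K / (\<delta> * R) + L * M / (\<delta>\<^sup>2 * R)"
    proof -
      have "real K * (L / real K * (R * M) / (\<delta> * R)\<^sup>2) = L * M / (\<delta>\<^sup>2 * R)"
        using K0 \<delta>0 R1 by (simp add: power2_eq_square)
      then show ?thesis by (simp add: B_def distrib_left)
    qed
    finally have sum: "c0 / n \<le> n * \<rho> + 2 * n * L / real K + real H * L / real K + (real K / (\<delta> * R) + L * M / (\<delta>\<^sup>2 * R))" .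
    have t1: "n * \<rho> = (4 * M / \<kappa>) / n\<^sup>2"
      using n1 \<kappa> by (simp add: \<rho>_def \<delta>_def field_simps power2_eq_square power3_eq_cube)
    have Kinv: "1 / real K \<le> 2 * n ^ 5 / R"
      using K2 R1 n1 K0 by (simp add: field_simps)
    have Rinv: "1 / R \<le> 1 / n ^ 8" using n8' n1 R1 by (intro divide_left_mono) auto
    have t2: "2 * n * L / real K \<le> 4 * L / n\<^sup>2"
    proof -
      have "2 * n * L / real K = 2 * n * L * (1 / real K)" by simp
      also have "\<dots> \<le> 2 * n * L * (2 * n ^ 5 / R)" using n1 L0 by (intro mult_left_mono Kinv) auto
      also have "\<dots> = 4 * n ^ 6 * L * (1 / R)" by (simp add: eval_nat_numeral)
      also have "\<dots> \<le> 4 * n ^ 6 * L * (1 / n ^ 8)" using n1 L0 by (intro mult_left_mono Rinv) auto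
      also have "\<dots> = 4 * L / n\<^sup>2" using n1 by (simp add: field_simps flip: power_add)
      finally show ?thesis .
    qed
    have t3: "real K / (\<delta> * R) \<le> 1 / n\<^sup>2"
    proof -
      have "real K / (\<delta> * R) \<le> (R / n ^ 5) / (\<delta> * R)" using K(2) \<delta>0 R1 by (intro divide_right_mono) auto
      also have "\<dots> = 1 / n\<^sup>2" using R1 n1 by (simp add: \<delta>_def field_simps flip: power_add)
      finally show ?thesis .
    qed
    have t4: "L * M / (\<delta>\<^sup>2 * R) \<le> L * M / n\<^sup>2"
    proof -
      have "L * M / (\<delta>\<^sup>2 * R) = L * M * n ^ 6 * (1 / R)" using n1 by (simp add: \<delta>_def field_simps flip: power_mult)
      also have "\<dots> \<le> L * M * n ^ 6 * (1 / n ^ 8)" using n1 L0 M_nonneg by (intro mult_left_mono Rinv) auto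
      also have "\<dots> = L * M / n\<^sup>2" using n1 by (simp add: field_simps flip: power_add)
      finally show ?thesis .
    qed
    have "c0 / n \<le> D / n\<^sup>2 + real H * L / real K"
      using sum t1 t2 t3 t4 by (simp add: D_def add_divide_distrib)
    moreover have "D / n\<^sup>2 \<le> c0 / (2 * n)"
      using nD c0 n1 by (simp add: field_simps power2_eq_square)
    \<comment> \<open>The errors use up at most half of c0 / n; the pieces with a zero must carry
      the rest.\<close>
    ultimately have "c0 / (2 * n) \<le> real H * L / real K" by simp
    then have "c0 / (2 * n) * real K \<le> real H * L" using K0 by (simp add: field_simps)
    moreover have "c0 / (2 * n) * (R / (2 * n ^ 5)) \<le> c0 / (2 * n) * real K"
      using c0 n1 by (intro mult_left_mono K2) auto
    ultimately have "c0 / (2 * n) * (R / (2 * n ^ 5)) \<le> real H * L" by linarith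
    moreover have "c0 / (2 * n) * (R / (2 * n ^ 5)) = c0 * R / (4 * n ^ 6)"
      by (simp add: eval_nat_numeral)
    ultimately have "c0 * R / (4 * n ^ 6) / L \<le> real H" using L0 by (subst pos_divide_le_eq) auto
    moreover have "c0 * R / (4 * n ^ 6) / L = c0 / (4 * L) * R / n ^ 6" by simp
    ultimately have "c0 / (4 * L) * R / n ^ 6 \<le> real H" by (simp only:)
    then show "c0 / (4 * L) * sqrt (real E) / n ^ 6 \<le> real (card {t \<in> {a..<b}. wave E c t = 0})"
      unfolding H_def R_def .
  qed
qed

end

section \<open>Real analytic functions and their complexifications\<close>

text \<open>Dividing out a zero w divides the bound on the outer circle by 2 \<rho>, the least
  distance from w to it, but divides the value at the centre by at most \<rho>. Each zero thus gains
  a factor 2, and the maximum principle settles the case without zeros.\<close>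

lemma jensen_zero_bound:
  fixes f :: "complex \<Rightarrow> complex"
  assumes fin: "finite Z" and f: "f holomorphic_on S" and S: "open S" "cball z0 (3 * \<rho>) \<subseteq> S" and \<rho>: "\<rho> > 0"
    and B: "\<And>z. norm (z - z0) = 3 * \<rho> \<Longrightarrow> norm (f z) \<le> B"
    and Z: "Z \<subseteq> cball z0 \<rho>" "\<And>z. z \<in> Z \<Longrightarrow> f z = 0"
  shows "2 ^ card Z * norm (f z0) \<le> B"
  using fin f B Z
proof (induction Z arbitrary: f B rule: finite_induct)
  case empty
  have "norm (f z0) \<le> B"
  proof (rule maximum_modulus_frontier[of f "cball z0 (3 * \<rho>)"])
    show "f holomorphic_on interior (cball z0 (3 * \<rho>))"
      using empty(1) S(2) interior_subset by (meson holomorphic_on_subset subset_trans)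
    show "continuous_on (closure (cball z0 (3 * \<rho>))) f"
      using continuous_on_subset[OF holomorphic_on_imp_continuous_on[OF empty(1)] S(2)] by simp
    show "norm (f z) \<le> B" if "z \<in> frontier (cball z0 (3 * \<rho>))" for z
      using that \<rho> by (intro empty(2)) (simp add: dist_norm norm_minus_commute)
  qed (use \<rho> in auto)
  then show ?case by simp
next
  case (insert w Z)
  \<comment> \<open>The value at w removes the singularity, so the induction hypothesis applies to
    the quotient on all of \<open>S\<close>.\<close>
  define h where "h z = (if z = w then deriv f w else (f z - f w) / (z - w))" for z
  have fw: "f w = 0" using insert.prems by simp
  have wz: "norm (z0 - w) \<le> \<rho>" using insert.prems by (simp add: dist_norm)
  have "2 ^ card Z * norm (h z0) \<le> B / (2 * \<rho>)"
  proof (rule insert.IH)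
    show "h holomorphic_on S" unfolding h_def[abs_def] by (rule pole_lemma_open[OF insert.prems(1) S(1)])
    fix z assume z: "norm (z - z0) = 3 * \<rho>"
    have "norm (z - z0) \<le> norm (z - w) + norm (z0 - w)"
      using norm_triangle_ineq4[of "z - w" "z0 - w"] by simp
    then have "2 * \<rho> \<le> norm (z - w)" using wz z by simp
    then have "norm (f z) / norm (z - w) \<le> B / (2 * \<rho>)"
      using insert.prems(2)[OF z] order.trans[OF norm_ge_zero insert.prems(2)[OF z]] \<rho> by (intro frac_le) auto
    moreover have "z \<noteq> w" using \<open>2 * \<rho> \<le> norm (z - w)\<close> \<rho> by auto
    ultimately show "norm (h z) \<le> B / (2 * \<rho>)" by (simp add: h_def fw norm_divide)
  next
    show "Z \<subseteq> cball z0 \<rho>" using insert.prems by auto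
    show "h z = 0" if "z \<in> Z" for z using that insert.hyps insert.prems fw by (auto simp: h_def)
  qed
  moreover have "norm (f z0) \<le> \<rho> * norm (h z0)"
  proof (cases "z0 = w")
    case True
    then show ?thesis using fw \<rho> by simp
  next
    case False
    then have "f z0 = (z0 - w) * h z0" by (simp add: h_def fw)
    then show ?thesis using wz by (simp add: norm_mult mult_right_mono)
  qed
  ultimately have "2 ^ card Z * norm (f z0) \<le> \<rho> * (B / (2 * \<rho>))"
    using \<rho> by (smt (verit) mult.left_commute mult_left_mono zero_le_power)
  then show ?case using insert.hyps \<rho> by simp
qed

text \<open>Replaces local power series by a holomorphic function on a disc, so that derivatives and
  the identity theorem come from complex analysis. The radius is explicit so that two extensions can
  be restricted to a common disc.\<close>

definition complexifies :: "(complex \<Rightarrow> complex) \<Rightarrow> (real \<Rightarrow> real) \<Rightarrow> real \<Rightarrow> real \<Rightarrow> bool" where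
  "complexifies g f x r \<longleftrightarrow>
     g holomorphic_on ball (of_real x) r \<and> (\<forall>t. \<bar>t - x\<bar> < r \<longrightarrow> g (of_real t) = of_real (f t))"

definition real_analytic_at :: "(real \<Rightarrow> real) \<Rightarrow> real \<Rightarrow> bool" where
  "real_analytic_at f x \<longleftrightarrow> (\<exists>r>0. \<exists>g. complexifies g f x r)"

lemma complexifies_subset:
  assumes "complexifies g f x r" "\<bar>t - x\<bar> + s \<le> r"
  shows "complexifies g f t s"
proof -
  have "ball (complex_of_real t) s \<subseteq> ball (of_real x) r"
  proof
    fix z assume "z \<in> ball (complex_of_real t) s"
    moreover have "dist (complex_of_real x) z \<le> dist (complex_of_real x) (of_real t) + dist (complex_of_real t) z"
      by (rule dist_triangle)
    moreover have "dist (complex_of_real x) (of_real t) = \<bar>t - x\<bar>"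
      by (simp add: dist_of_real dist_real_def abs_minus_commute)
    ultimately show "z \<in> ball (of_real x) r" using assms(2) by simp
  qed
  then show ?thesis
    using assms unfolding complexifies_def by (auto intro: holomorphic_on_subset)
qed

lemma real_analytic_on_imp_at:
  assumes "real_analytic_on f U" "x \<in> U"
  shows "real_analytic_at f x"
proof -
  obtain r a where r: "r > 0" and a: "\<And>y. \<bar>y - x\<bar> < r \<Longrightarrow> (\<lambda>n. a n * (y - x) ^ n) sums f y"
    using assms unfolding real_analytic_on_def by blast
  define g where "g z = (\<Sum>n. of_real (a n) * (z - of_real x) ^ n)" for z :: complex
  have "(\<lambda>n. of_real (a n) * (w - of_real x) ^ n) sums g w" if w: "w \<in> ball (of_real x) r" for w :: complex
  proof -
    define s where "s = (norm (w - of_real x) + r) / 2"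
    have s: "norm (w - of_real x) < s" "s < r" "s \<ge> 0"
      using w r norm_ge_zero[of "w - of_real x"] by (auto simp: s_def dist_norm norm_minus_commute simp del: norm_ge_zero)
    have "summable (\<lambda>n. a n * s ^ n)" using a[of "x + s"] s by (auto simp: sums_iff)
    then have "summable (\<lambda>n. of_real (a n * s ^ n) :: complex)" by (rule summable_of_real)
    then have "summable (\<lambda>n. of_real (a n) * (of_real s :: complex) ^ n)" by simp
    then have "summable (\<lambda>n. of_real (a n) * (w - of_real x) ^ n)"
      by (rule powser_inside) (use s in simp)
    then show ?thesis unfolding g_def by (rule summable_sums)
  qed
  then have "g holomorphic_on ball (of_real x) r" by (rule power_series_holomorphic)
  moreover have "g (of_real t) = of_real (f t)" if "\<bar>t - x\<bar> < r" for t
  proof -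
    have "(\<lambda>n. of_real (a n * (t - x) ^ n) :: complex) sums of_real (f t)"
      using a[OF that] by (rule sums_of_real)
    then show ?thesis unfolding g_def by (simp add: sums_iff)
  qed
  ultimately show ?thesis using r unfolding real_analytic_at_def complexifies_def by blast
qed

text \<open>The extension is real on the real axis, hence so is its derivative there. Thus
  \<open>deriv g\<close> extends \<open>deriv f\<close>, and analyticity passes to
  derivatives.\<close>

lemma complexifies_deriv:
  assumes c: "complexifies g f x r" and t: "\<bar>t - x\<bar> < r"
  shows "(f has_real_derivative deriv f t) (at t)" and "deriv g (of_real t) = of_real (deriv f t)"
proof -
  define D where "D = deriv g (of_real t)"
  have "(g has_field_derivative D) (at (of_real t))"
    unfolding D_def using c t
    by (intro holomorphic_derivI[of g "ball (of_real x) r"]) (auto simp: complexifies_def dist_of_real dist_real_def abs_minus_commute)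
  then have "((\<lambda>t. g (of_real t)) has_vector_derivative D) (at t)"
    by (rule has_vector_derivative_real_field)
  then have d: "((\<lambda>t. complex_of_real (f t)) has_vector_derivative D) (at t)"
  proof (rule has_vector_derivative_transform_within_open)
    show "open {x - r<..<x + r}" by simp
    show "t \<in> {x - r<..<x + r}" using t by (auto simp: abs_less_iff)
    show "g (of_real s) = of_real (f s)" if "s \<in> {x - r<..<x + r}" for s
      using c that by (auto simp: complexifies_def abs_less_iff)
  qed
  have "((\<lambda>t. Re (complex_of_real (f t))) has_vector_derivative Re D) (at t)"
    using bounded_linear.has_vector_derivative[OF bounded_linear_Re d] .
  then have re: "(f has_real_derivative Re D) (at t)"
    by (simp add: has_real_derivative_iff_has_vector_derivative)
  have "((\<lambda>t. Im (complex_of_real (f t))) has_vector_derivative Im D) (at t)"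
    using bounded_linear.has_vector_derivative[OF bounded_linear_Im d] .
  then have "((\<lambda>_. 0) has_real_derivative Im D) (at t)"
    by (simp add: has_real_derivative_iff_has_vector_derivative)
  then have im: "Im D = 0" using DERIV_unique DERIV_const by blast
  have "deriv f t = Re D" using re by (rule DERIV_imp_deriv)
  then show "(f has_real_derivative deriv f t) (at t)" "deriv g (of_real t) = of_real (deriv f t)"
    using re im by (auto simp: D_def complex_eq_iff)
qed

lemma real_analytic_at_deriv:
  assumes "real_analytic_at f x"
  shows "(f has_real_derivative deriv f x) (at x)" and "real_analytic_at (deriv f) x"
proof -
  obtain r g where r: "r > 0" and g: "complexifies g f x r" using assms by (auto simp: real_analytic_at_def)
  show "(f has_real_derivative deriv f x) (at x)" using complexifies_deriv(1)[OF g, of x] r by simp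
  have "complexifies (deriv g) (deriv f) x r"
    using g complexifies_deriv(2)[OF g] unfolding complexifies_def by (auto intro: holomorphic_deriv)
  then show "real_analytic_at (deriv f) x" using r by (auto simp: real_analytic_at_def)
qed

lemma real_analytic_at_continuous: "real_analytic_at f x \<Longrightarrow> isCont f x"
  using real_analytic_at_deriv(1) DERIV_isCont by blast

lemma real_analytic_at_affine:
  assumes "real_analytic_at f x" "real_analytic_at h x"
  shows "real_analytic_at (\<lambda>t. \<alpha> * f t + \<beta> * h t - \<gamma>) x"
proof -
  obtain r g where r: "r > 0" "complexifies g f x r" using assms by (auto simp: real_analytic_at_def)
  obtain s k where s: "s > 0" "complexifies k h x s" using assms by (auto simp: real_analytic_at_def)
  have "complexifies g f x (min r s)" "complexifies k h x (min r s)"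
    using complexifies_subset[OF r(2), of x "min r s"] complexifies_subset[OF s(2), of x "min r s"] by auto
  then have "complexifies (\<lambda>z. of_real \<alpha> * g z + of_real \<beta> * k z - of_real \<gamma>) (\<lambda>t. \<alpha> * f t + \<beta> * h t - \<gamma>) x (min r s)"
    unfolding complexifies_def by (auto intro!: holomorphic_intros)
  then show ?thesis using r s unfolding real_analytic_at_def by (intro exI[of _ "min r s"]) auto
qed

lemma complexifies_identity:
  assumes c: "complexifies g f x r" and st: "s < t" "{s<..<t} \<subseteq> {x - r<..<x + r}"
    and z: "\<And>u. u \<in> {s<..<t} \<Longrightarrow> f u = 0" and u: "\<bar>u - x\<bar> < r"
  shows "f u = 0"
proof -
  define m where "m = (s + t) / 2"
  have m: "m \<in> {s<..<t}" using st by (simp add: m_def)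
  have sub: "\<bar>v - x\<bar> < r" if "v \<in> {s<..<t}" for v using that st by (auto simp: abs_less_iff)
  have "g (of_real u) = 0"
  proof (rule analytic_continuation[of g "ball (of_real x) r" "of_real ` {s<..<t}" "of_real m"])
    show "complex_of_real m islimpt of_real ` {s<..<t}"
      unfolding islimpt_approachable
    proof (intro allI impI)
      fix e :: real assume e: "e > 0"
      define v where "v = m + min (e / 2) ((t - m) / 2)"
      have "v \<in> {s<..<t}" "v \<noteq> m" "\<bar>v - m\<bar> < e" using m e by (auto simp: v_def min_def field_simps)
      then show "\<exists>x'\<in>of_real ` {s<..<t}. x' \<noteq> complex_of_real m \<and> dist x' (of_real m) < e"
        by (intro bexI[of _ "of_real v"]) (auto simp: dist_of_real dist_real_def)
    qed
  qed (use c z sub m u in \<open>auto simp: complexifies_def dist_of_real dist_real_def abs_minus_commute\<close>)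
  then show ?thesis using c u by (simp add: complexifies_def)
qed

text \<open>A single disc need not cover the interval. Vanishing near a point is locally constant by
  the identity theorem on each disc, and connectedness spreads it.\<close>

lemma real_analytic_identity:
  assumes an: "\<And>t. t \<in> {0..1} \<Longrightarrow> real_analytic_at f t"
    and st: "s < t" "{s<..<t} \<subseteq> {0..1}" and z: "\<And>u. u \<in> {s<..<t} \<Longrightarrow> f u = 0" and u: "u \<in> {0..1}"
  shows "f u = 0"
proof -
  define P where "P a \<longleftrightarrow> (\<exists>e>0. \<forall>v. \<bar>v - a\<bar> < e \<longrightarrow> f v = 0)" for a
  define m where "m = (s + t) / 2"
  have m: "m \<in> {s<..<t}" using st by (simp add: m_def)
  have "P m"
    unfolding P_def
  proof (intro exI[of _ "(t - s) / 2"] conjI allI impI)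
    show "(t - s) / 2 > 0" using st by simp
    fix v assume "\<bar>v - m\<bar> < (t - s) / 2"
    then show "f v = 0" by (intro z) (auto simp: m_def abs_less_iff field_simps)
  qed
  have "P u"
  proof (rule connected_induction_simple[of "{0..1::real}" m u P])
    show "m \<in> {0..1}" using m st by auto
    fix a :: real assume a: "a \<in> {0..1}"
    obtain r g where r: "r > 0" "complexifies g f a r" using an[OF a] by (auto simp: real_analytic_at_def)
    show "\<exists>T. openin (top_of_set {0..1}) T \<and> a \<in> T \<and> (\<forall>x\<in>T. \<forall>y\<in>T. P x \<longrightarrow> P y)"
    proof (intro exI[of _ "{0..1} \<inter> {a - r<..<a + r}"] conjI ballI impI)
      show "openin (top_of_set {0..1}) ({0..1} \<inter> {a - r<..<a + r})" by (simp add: openin_open_Int)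
      show "a \<in> {0..1} \<inter> {a - r<..<a + r}" using a r by simp
      fix x y assume x: "x \<in> {0..1} \<inter> {a - r<..<a + r}" and y: "y \<in> {0..1} \<inter> {a - r<..<a + r}" and "P x"
      then obtain e where e: "e > 0" "\<And>v. \<bar>v - x\<bar> < e \<Longrightarrow> f v = 0" by (auto simp: P_def)
      have z': "f v = 0" if "\<bar>v - a\<bar> < r" for v
      proof (rule complexifies_identity[OF r(2) _ _ _ that])
        show "max (a - r) (x - e) < min (a + r) (x + e)" using x e r by auto
      qed (use e(2) in \<open>auto simp: abs_less_iff\<close>)
      show "P y"
        unfolding P_def
      proof (intro exI[of _ "r - \<bar>y - a\<bar>"] conjI allI impI)
        show "r - \<bar>y - a\<bar> > 0" using y by (auto simp: abs_less_iff)
        fix v assume "\<bar>v - y\<bar> < r - \<bar>y - a\<bar>"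
        then show "f v = 0" by (intro z') linarith
      qed
    qed
  qed (use u \<open>P m\<close> in auto)
  then obtain e where "e > 0" "\<And>v. \<bar>v - u\<bar> < e \<Longrightarrow> f v = 0" by (auto simp: P_def)
  then show ?thesis by simp
qed

text \<open>The Wronskian is the numerator of (y' / x')', so y' = c x' near m and y - c x is
  constant there.\<close>

lemma vanishing_wronskian_imp_line:
  fixes x y x' y' x'' y'' :: "real \<Rightarrow> real"
  assumes d: "\<And>u. u \<in> {s<..<t} \<Longrightarrow> (x has_real_derivative x' u) (at u)"
      "\<And>u. u \<in> {s<..<t} \<Longrightarrow> (y has_real_derivative y' u) (at u)"
      "\<And>u. u \<in> {s<..<t} \<Longrightarrow> (x' has_real_derivative x'' u) (at u)"
      "\<And>u. u \<in> {s<..<t} \<Longrightarrow> (y' has_real_derivative y'' u) (at u)"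
    and W: "\<And>u. u \<in> {s<..<t} \<Longrightarrow> x' u * y'' u - y' u * x'' u = 0"
    and m: "m \<in> {s<..<t}" "x' m \<noteq> 0"
  obtains s' t' k l where "s' < t'" "{s'<..<t'} \<subseteq> {s<..<t}" "\<And>u. u \<in> {s'<..<t'} \<Longrightarrow> k * x u + y u = l"
proof -
  have "isCont x' m" using d(3)[OF m(1)] DERIV_isCont by blast
  then have "eventually (\<lambda>u. x' u \<noteq> 0) (nhds m)"
    using m(2) tendsto_imp_eventually_ne continuous_at_imp_continuous_at_within
    by (metis isCont_def tendsto_at_iff_tendsto_nhds)
  moreover have "eventually (\<lambda>u. u \<in> {s<..<t}) (nhds m)" using m(1) by (intro eventually_nhds_in_open) auto
  ultimately have "eventually (\<lambda>u. x' u \<noteq> 0 \<and> u \<in> {s<..<t}) (nhds m)" by eventually_elim simp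
  then obtain e where e: "e > 0" "\<And>u. dist u m < e \<Longrightarrow> x' u \<noteq> 0 \<and> u \<in> {s<..<t}"
    by (auto simp: eventually_nhds_metric)
  define J where "J = {m - e<..<m + e}"
  have J: "x' u \<noteq> 0" "u \<in> {s<..<t}" if "u \<in> J" for u
    using e(2)[of u] that by (auto simp: J_def dist_real_def abs_less_iff)
  have "\<exists>c. \<forall>u\<in>J. y' u / x' u = c"
  proof (rule has_field_derivative_zero_constant)
    fix u assume u: "u \<in> J"
    have "((\<lambda>u. y' u / x' u) has_real_derivative (y'' u * x' u - y' u * x'' u) / (x' u * x' u)) (at u)"
      by (rule DERIV_divide[OF d(4)[OF J(2)[OF u]] d(3)[OF J(2)[OF u]] J(1)[OF u]])
    moreover have "y'' u * x' u - y' u * x'' u = 0" using W[OF J(2)[OF u]] by (simp add: mult.commute)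
    ultimately show "((\<lambda>u. y' u / x' u) has_real_derivative 0) (at u within J)"
      by (simp add: has_field_derivative_at_within)
  qed (simp add: J_def)
  then obtain c where c: "\<And>u. u \<in> J \<Longrightarrow> y' u = c * x' u" using J(1) by (metis nonzero_divide_eq_eq)
  have "\<exists>l. \<forall>u\<in>J. - c * x u + y u = l"
  proof (rule has_field_derivative_zero_constant)
    fix u assume u: "u \<in> J"
    have "((\<lambda>u. - c * x u + y u) has_real_derivative (- c * x' u + y' u)) (at u)"
      by (intro DERIV_add DERIV_cmult d J(2) u)
    then show "((\<lambda>u. - c * x u + y u) has_real_derivative 0) (at u within J)"
      using c[OF u] by (simp add: has_field_derivative_at_within)
  qed (simp add: J_def)
  then obtain l where l: "\<And>u. u \<in> J \<Longrightarrow> - c * x u + y u = l" by blast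
  show ?thesis
    by (rule that[of "m - e" "m + e" "- c" l]) (use e J(2) l in \<open>auto simp: J_def\<close>)
qed

section \<open>Nonlinear analytic curves\<close>

text \<open>Lets zeros be located on the lift: an integer translation changes each phase by a
  multiple of 2 pi.\<close>

lemma eigf_torus_proj: "eigf E c (torus_proj p) = eigf E c p"
  unfolding eigf_def
proof (intro sum.cong refl arg_cong2[where f = "(*)"])
  fix \<xi> :: "int \<times> int"
  define k where "k = \<lfloor>fst p\<rfloor> * fst \<xi> + \<lfloor>snd p\<rfloor> * snd \<xi>"
  define w where "w = fst p * of_int (fst \<xi>) + snd p * of_int (snd \<xi>)"
  have e: "fst (torus_proj p) * of_int (fst \<xi>) + snd (torus_proj p) * of_int (snd \<xi>) = w - of_int k"
    by (simp add: torus_proj_def frac_def w_def k_def algebra_simps)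
  have "exp (2 * of_real pi * \<i> * of_real (fst (torus_proj p) * of_int (fst \<xi>) + snd (torus_proj p) * of_int (snd \<xi>)))
      = cis (2 * pi * w - 2 * pi * of_int k)"
    unfolding e by (simp add: cis_conv_exp algebra_simps)
  also have "\<dots> = cis (2 * pi * w) / cis (2 * pi * of_int k)" by (rule cis_divide[symmetric])
  also have "\<dots> = cis (2 * pi * w)" by (simp add: cis_multiple_2pi)
  also have "\<dots> = exp (2 * of_real pi * \<i> * of_real w)" by (simp add: cis_conv_exp mult_ac)
  finally show "exp (2 * of_real pi * \<i> * of_real (fst (torus_proj p) * of_int (fst \<xi>) + snd (torus_proj p) * of_int (snd \<xi>)))
      = exp (2 * of_real pi * \<i> * of_real (fst p * of_int (fst \<xi>) + snd p * of_int (snd \<xi>)))"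
    by (simp add: w_def)
qed

lemma frac_eq_imp_eq:
  fixes u v :: real
  assumes "frac u = frac v" "\<bar>u - v\<bar> < 1"
  shows "u = v"
proof -
  have *: "u - v = of_int (\<lfloor>u\<rfloor> - \<lfloor>v\<rfloor>)" using assms(1) by (simp add: frac_def)
  then have "\<bar>\<lfloor>u\<rfloor> - \<lfloor>v\<rfloor>\<bar> < 1" using assms(2) by linarith
  then show ?thesis using * by simp
qed

text \<open>The hypotheses are symmetric in the coordinates, so a point where \<open>deriv x\<close>
  vanishes is handled by exchanging them.\<close>

locale nonlinear_analytic_curve =
  fixes x y :: "real \<Rightarrow> real"
  assumes an_x: "\<And>t. t \<in> {0..1} \<Longrightarrow> real_analytic_at x t"
    and an_y: "\<And>t. t \<in> {0..1} \<Longrightarrow> real_analytic_at y t"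
    and velocity: "\<And>t. t \<in> {0..1} \<Longrightarrow> deriv x t \<noteq> 0 \<or> deriv y t \<noteq> 0"
    and not_line: "\<And>\<alpha> \<beta> \<gamma>. \<alpha> \<noteq> 0 \<or> \<beta> \<noteq> 0 \<Longrightarrow> \<exists>t\<in>{0..1}. \<alpha> * x t + \<beta> * y t \<noteq> \<gamma>"
begin

lemma swap: "nonlinear_analytic_curve y x"
proof
  fix \<alpha> \<beta> \<gamma> :: real assume "\<alpha> \<noteq> 0 \<or> \<beta> \<noteq> 0"
  then show "\<exists>t\<in>{0..1}. \<alpha> * y t + \<beta> * x t \<noteq> \<gamma>" using not_line[of \<beta> \<alpha> \<gamma>] by (simp add: add.commute disj_commute)
qed (use an_x an_y velocity in auto)

lemma derivs:
  assumes "t \<in> {0..1}"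
  shows "(x has_real_derivative deriv x t) (at t)" "(y has_real_derivative deriv y t) (at t)"
    "(deriv x has_real_derivative deriv (deriv x) t) (at t)" "(deriv y has_real_derivative deriv (deriv y) t) (at t)"
    "isCont (deriv (deriv x)) t" "isCont (deriv (deriv y)) t"
  using an_x[OF assms] an_y[OF assms] by (auto intro: real_analytic_at_deriv real_analytic_at_continuous)

text \<open>Otherwise part of the arc would be straight and, by the identity theorem, the whole
  curve would lie on a line.\<close>

lemma wronskian_nonzero_aux:
  assumes st: "s < t" "{s<..<t} \<subseteq> {0..1}" and m: "m \<in> {s<..<t}" "deriv x m \<noteq> 0"
  shows "\<exists>u\<in>{s<..<t}. deriv x u * deriv (deriv y) u - deriv y u * deriv (deriv x) u \<noteq> 0"
proof (rule ccontr)
  assume "\<not> ?thesis"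
  then have W: "deriv x u * deriv (deriv y) u - deriv y u * deriv (deriv x) u = 0" if "u \<in> {s<..<t}" for u
    using that by blast
  have in01: "u \<in> {0..1}" if "u \<in> {s<..<t}" for u using that st by blast
  obtain s' t' k l where l: "s' < t'" "{s'<..<t'} \<subseteq> {s<..<t}" "\<And>u. u \<in> {s'<..<t'} \<Longrightarrow> k * x u + y u = l"
    using vanishing_wronskian_imp_line[OF derivs(1)[OF in01] derivs(2)[OF in01] derivs(3)[OF in01] derivs(4)[OF in01] W m]
    by blast
  have "k * x u + 1 * y u - l = 0" if "u \<in> {0..1}" for u
  proof (rule real_analytic_identity[OF _ l(1) _ _ that])
    show "real_analytic_at (\<lambda>u. k * x u + 1 * y u - l) v" if "v \<in> {0..1}" for v
      by (intro real_analytic_at_affine an_x an_y that)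
  qed (use l st in auto)
  then show False using not_line[of k 1 l] by auto
qed

lemma wronskian_nonzero:
  assumes st: "s < t" "{s<..<t} \<subseteq> {0..1}"
  obtains u where "u \<in> {s<..<t}" "deriv x u * deriv (deriv y) u - deriv y u * deriv (deriv x) u \<noteq> 0"
proof -
  define m where "m = (s + t) / 2"
  have m: "m \<in> {s<..<t}" using st by (simp add: m_def)
  interpret sw: nonlinear_analytic_curve y x by (rule swap)
  show ?thesis
  proof (cases "deriv x m = 0")
    case True
    then have "deriv y m \<noteq> 0" using velocity m st by blast
    then obtain u where u: "u \<in> {s<..<t}" "deriv y u * deriv (deriv x) u - deriv x u * deriv (deriv y) u \<noteq> 0"
      using sw.wronskian_nonzero_aux[OF st m] by blast
    show ?thesis by (rule that[OF u(1)]) (use u(2) in linarith)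
  next
    case False
    then show ?thesis using wronskian_nonzero_aux[OF st m] that by blast
  qed
qed

text \<open>Shrinks a neighbourhood of a point with nonzero Wronskian. Injectivity on the torus is
  included so that zeros at different parameters give different points there.\<close>

lemma curved_subarc:
  assumes st: "s < t" "{s<..<t} \<subseteq> {0..1}"
  obtains a b M \<kappa> where "{a..b} \<subseteq> {s<..<t}"
    "curved_arc x y (deriv x) (deriv y) (deriv (deriv x)) (deriv (deriv y)) a b M \<kappa>"
    "inj_on (\<lambda>t. torus_proj (x t, y t)) {a..b}"
proof -
  define x1 where "x1 = deriv x"
  define y1 where "y1 = deriv y"
  define x2 where "x2 = deriv (deriv x)"
  define y2 where "y2 = deriv (deriv y)"
  note D = derivs[folded x1_def y1_def x2_def y2_def, folded x1_def y1_def x2_def y2_def]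
  obtain u where u: "u \<in> {s<..<t}" and "deriv x u * deriv (deriv y) u - deriv y u * deriv (deriv x) u \<noteq> 0"
    using wronskian_nonzero[OF st] by blast
  then have W: "x1 u * y2 u - y1 u * x2 u \<noteq> 0" by (simp add: x1_def y1_def x2_def y2_def)
  have u01: "u \<in> {0..1}" using u st by blast
  have lim: "(f \<longlongrightarrow> f u) (nhds u)" if "isCont f u" for f :: "real \<Rightarrow> real"
    using that unfolding isCont_def tendsto_at_iff_tendsto_nhds .
  note C = lim[OF DERIV_isCont[OF D(1)[OF u01]]] lim[OF DERIV_isCont[OF D(2)[OF u01]]]
    lim[OF DERIV_isCont[OF D(3)[OF u01]]] lim[OF DERIV_isCont[OF D(4)[OF u01]]]
    lim[OF D(5)[OF u01]] lim[OF D(6)[OF u01]]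
  define \<kappa> where "\<kappa> = \<bar>x1 u * y2 u - y1 u * x2 u\<bar> / 2"
  have \<kappa>0: "\<kappa> > 0" using W by (simp add: \<kappa>_def)
  \<comment> \<open>Joint continuity at (u, u): the mean value argument below freezes one tangent at
    v while the derivative is taken at another point.\<close>
  have "((\<lambda>p. \<bar>x1 (fst p) * y2 (snd p) - y1 (fst p) * x2 (snd p)\<bar>) \<longlongrightarrow> \<bar>x1 u * y2 u - y1 u * x2 u\<bar>)
      (nhds u \<times>\<^sub>F nhds u)"
    by (intro tendsto_intros filterlim_compose[OF C(3) filterlim_fst] filterlim_compose[OF C(4) filterlim_fst]
        filterlim_compose[OF C(5) filterlim_snd] filterlim_compose[OF C(6) filterlim_snd])
  then have "eventually (\<lambda>p. \<kappa> < \<bar>x1 (fst p) * y2 (snd p) - y1 (fst p) * x2 (snd p)\<bar>) (nhds u \<times>\<^sub>F nhds u)"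
    by (rule order_tendstoD) (use W in \<open>simp add: \<kappa>_def\<close>)
  then obtain P where P: "eventually P (nhds u)"
    "\<And>v w. P v \<Longrightarrow> P w \<Longrightarrow> \<kappa> < \<bar>x1 v * y2 w - y1 v * x2 w\<bar>"
    unfolding eventually_prod_same by auto
  define M where "M = \<bar>x1 u\<bar> + \<bar>y1 u\<bar> + \<bar>x2 u\<bar> + \<bar>y2 u\<bar> + 1"
  have bnd: "eventually (\<lambda>v. \<bar>f v\<bar> < M) (nhds u)" if "(f \<longlongrightarrow> f u) (nhds u)" "\<bar>f u\<bar> < M" for f :: "real \<Rightarrow> real"
    using order_tendstoD(2)[OF tendsto_rabs[OF that(1)] that(2)] .
  have near: "eventually (\<lambda>v. \<bar>f v - f u\<bar> < 1/2) (nhds u)" if "(f \<longlongrightarrow> f u) (nhds u)" for f :: "real \<Rightarrow> real"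
    using tendstoD[OF that, of "1/2"] by (simp add: dist_real_def)
  have "x1 u \<noteq> 0 \<or> y1 u \<noteq> 0" using velocity[OF u01] by (simp add: x1_def y1_def)
  then obtain z z1 where z: "z = x \<and> z1 = x1 \<or> z = y \<and> z1 = y1" "z1 u \<noteq> 0" by auto
  have "(z1 \<longlongrightarrow> z1 u) (nhds u)" using C z(1) by auto
  then have "eventually (\<lambda>v. z1 v \<noteq> 0) (nhds u)" by (rule tendsto_imp_eventually_ne) (rule z(2))
  moreover have "eventually (\<lambda>v. v \<in> {s<..<t}) (nhds u)" using u by (intro eventually_nhds_in_open) auto
  moreover have "eventually (\<lambda>v. \<bar>x1 v\<bar> < M) (nhds u)" "eventually (\<lambda>v. \<bar>y1 v\<bar> < M) (nhds u)"
    "eventually (\<lambda>v. \<bar>x2 v\<bar> < M) (nhds u)" "eventually (\<lambda>v. \<bar>y2 v\<bar> < M) (nhds u)"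
    by (intro bnd C; simp add: M_def)+
  moreover note near[OF C(1)] near[OF C(2)] P(1)
  ultimately have "eventually (\<lambda>v. z1 v \<noteq> 0 \<and> v \<in> {s<..<t} \<and> \<bar>x1 v\<bar> < M \<and> \<bar>y1 v\<bar> < M \<and> \<bar>x2 v\<bar> < M \<and> \<bar>y2 v\<bar> < M
      \<and> \<bar>x v - x u\<bar> < 1/2 \<and> \<bar>y v - y u\<bar> < 1/2 \<and> P v) (nhds u)"
    by eventually_elim simp
  then obtain e where e: "e > 0" "\<And>v. dist v u < e \<Longrightarrow> z1 v \<noteq> 0 \<and> v \<in> {s<..<t} \<and> \<bar>x1 v\<bar> < M \<and> \<bar>y1 v\<bar> < M \<and> \<bar>x2 v\<bar> < M
      \<and> \<bar>y2 v\<bar> < M \<and> \<bar>x v - x u\<bar> < 1/2 \<and> \<bar>y v - y u\<bar> < 1/2 \<and> P v"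
    unfolding eventually_nhds_metric by blast
  define a where "a = u - e / 2"
  define b where "b = u + e / 2"
  have ab: "a < b" using e by (simp add: a_def b_def)
  have du: "dist v u < e" if "v \<in> {a..b}" for v using that e(1) by (auto simp: a_def b_def dist_real_def abs_less_iff)
  note ev = e(2)[OF du]
  have in01: "v \<in> {0..1}" if "v \<in> {a..b}" for v using ev[OF that] st by blast
  have "curved_arc x y x1 y1 x2 y2 a b M \<kappa>"
  proof
    show "continuous_on {a..b} x2" "continuous_on {a..b} y2"
      using D(5,6) in01 by (auto intro!: continuous_at_imp_continuous_on)
    fix v w assume v: "v \<in> {a..b}" and w: "w \<in> {a..b}"
    have d: "((\<lambda>\<tau>. x1 v * y1 \<tau> - y1 v * x1 \<tau>) has_real_derivative (x1 v * y2 \<tau> - y1 v * x2 \<tau>)) (at \<tau>)"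
      if "\<tau> \<in> {a..b}" for \<tau>
      using D(3,4)[OF in01[OF that]] by (auto intro!: derivative_eq_intros)
    have step: "\<kappa> * \<bar>q - p\<bar> \<le> \<bar>(x1 v * y1 q - y1 v * x1 q) - (x1 v * y1 p - y1 v * x1 p)\<bar>"
      if pq: "p < q" "p \<in> {a..b}" "q \<in> {a..b}" for p q
    proof -
      obtain \<tau> where \<tau>: "p < \<tau>" "\<tau> < q"
        "(x1 v * y1 q - y1 v * x1 q) - (x1 v * y1 p - y1 v * x1 p) = (q - p) * (x1 v * y2 \<tau> - y1 v * x2 \<tau>)"
        using MVT2[OF pq(1), of "\<lambda>\<tau>. x1 v * y1 \<tau> - y1 v * x1 \<tau>" "\<lambda>\<tau>. x1 v * y2 \<tau> - y1 v * x2 \<tau>"] d pq by auto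
      have "\<tau> \<in> {a..b}" using \<tau> pq by auto
      then have "\<kappa> \<le> \<bar>x1 v * y2 \<tau> - y1 v * x2 \<tau>\<bar>" using P(2) ev v by (meson less_imp_le)
      then have "\<kappa> * \<bar>q - p\<bar> \<le> \<bar>x1 v * y2 \<tau> - y1 v * x2 \<tau>\<bar> * \<bar>q - p\<bar>" by (intro mult_right_mono) auto
      then show ?thesis unfolding \<tau>(3) abs_mult by (simp add: mult.commute)
    qed
    \<comment> \<open>As a function of w the cross product vanishes at w = v, so \<open>step\<close>
      between v and w is the claim.\<close>
    show "\<kappa> * \<bar>v - w\<bar> \<le> \<bar>x1 v * y1 w - y1 v * x1 w\<bar>"
      using step[of v w] step[of w v] v w by (cases v w rule: linorder_cases) (auto simp: abs_minus_commute mult.commute)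
  qed (use ab D(1-4)[OF in01] ev \<kappa>0 in \<open>auto intro: less_imp_le\<close>)
  moreover have "inj_on (\<lambda>t. torus_proj (x t, y t)) {a..b}"
  proof (rule linorder_inj_onI')
    fix v w assume v: "v \<in> {a..b}" and w: "w \<in> {a..b}" and "v < w"
    show "torus_proj (x v, y v) \<noteq> torus_proj (x w, y w)"
    proof
      assume "torus_proj (x v, y v) = torus_proj (x w, y w)"
      then have fr: "frac (x v) = frac (x w)" "frac (y v) = frac (y w)" by (auto simp: torus_proj_def)
      \<comment> \<open>Staying within 1/2 of the centre rules out a nonzero integer difference;
        then the coordinate \<open>z\<close>, whose derivative has no zero, separates v from
        w.\<close>
      have "\<bar>x v - x u\<bar> < 1/2" "\<bar>x w - x u\<bar> < 1/2" "\<bar>y v - y u\<bar> < 1/2" "\<bar>y w - y u\<bar> < 1/2"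
        using ev[OF v] ev[OF w] by blast+
      then have "\<bar>x v - x w\<bar> < 1" "\<bar>y v - y w\<bar> < 1" by linarith+
      then have "x v = x w" "y v = y w" using frac_eq_imp_eq[OF fr(1)] frac_eq_imp_eq[OF fr(2)] by blast+
      then have zz: "z v = z w" using z by auto
      have dz: "(z has_real_derivative z1 \<tau>) (at \<tau>)" if "\<tau> \<in> {a..b}" for \<tau>
        using D(1,2)[OF in01[OF that]] z(1) by auto
      obtain \<tau> where \<tau>: "v < \<tau>" "\<tau> < w" "z w - z v = (w - v) * z1 \<tau>"
        using MVT2[OF \<open>v < w\<close>, of z z1] dz v w by auto
      have "\<tau> \<in> {a..b}" using \<tau> v w by auto
      then have "z1 \<tau> \<noteq> 0" using ev by blast
      then show False using zz \<open>v < w\<close> \<tau>(3) by simp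
    qed
  qed
  moreover have "{a..b} \<subseteq> {s<..<t}" using ev by blast
  ultimately show ?thesis using that by (simp add: x1_def y1_def x2_def y2_def)
qed

text \<open>Jensen's bound is centred at a point t of a nearby curved subarc where |wave|^2 is at
  least c' A. In 4^card <= (K R / c') exp(8 pi B R) the exponential absorbs the polynomial factor,
  so a crude lattice point count suffices.\<close>

lemma local_zero_bound:
  assumes x0: "x0 \<in> {0..1}"
  shows "\<exists>\<rho>>0. \<exists>(E0::nat) C. \<forall>E\<ge>E0. \<forall>c. (\<exists>\<xi>\<in>lattice_circle E. c \<xi> \<noteq> 0) \<longrightarrow>
     finite {t. \<bar>t - x0\<bar> < \<rho> \<and> eigf E c (x t, y t) = 0} \<and>
     real (card {t. \<bar>t - x0\<bar> < \<rho> \<and> eigf E c (x t, y t) = 0}) \<le> C * sqrt (real E)"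
proof -
  obtain rx gx where rx: "rx > 0" "complexifies gx x x0 rx" using an_x[OF x0] by (auto simp: real_analytic_at_def)
  obtain ry gy where ry: "ry > 0" "complexifies gy y x0 ry" using an_y[OF x0] by (auto simp: real_analytic_at_def)
  define r where "r = min rx ry"
  have r0: "r > 0" using rx ry by (simp add: r_def)
  have gx: "complexifies gx x x0 r" and gy: "complexifies gy y x0 r"
    using complexifies_subset[OF rx(2), of x0 r] complexifies_subset[OF ry(2), of x0 r] by (auto simp: r_def)
  \<comment> \<open>Room for all the discs: the zeros are within 2 \<rho> of t, the circle of radius
    6 \<rho> about t stays within 7 \<rho> of x0, and r = 8 \<rho>.\<close>
  define \<rho> where "\<rho> = r / 8"
  have \<rho>0: "\<rho> > 0" using r0 by (simp add: \<rho>_def)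
  have sub: "cball (complex_of_real x0) (7 * \<rho>) \<subseteq> ball (of_real x0) r" using r0 by (auto simp: \<rho>_def)
  have hol: "gx holomorphic_on ball (of_real x0) r" "gy holomorphic_on ball (of_real x0) r"
    using gx gy by (auto simp: complexifies_def)
  have "compact (gx ` cball (of_real x0) (7 * \<rho>) \<union> gy ` cball (of_real x0) (7 * \<rho>))"
    using sub hol by (intro compact_Un compact_continuous_image compact_cball)
      (auto intro: continuous_on_subset holomorphic_on_imp_continuous_on)
  then obtain B where B: "B > 0" "\<And>w. w \<in> gx ` cball (of_real x0) (7 * \<rho>) \<union> gy ` cball (of_real x0) (7 * \<rho>) \<Longrightarrow> norm w \<le> B"
    using compact_imp_bounded bounded_pos by metis
  have "max 0 (x0 - \<rho>) < min 1 (x0 + \<rho>)" using x0 \<rho>0 by auto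
  moreover have "{max 0 (x0 - \<rho>)<..<min 1 (x0 + \<rho>)} \<subseteq> {0..1}" by auto
  ultimately obtain a b M \<kappa> where arc: "{a..b} \<subseteq> {max 0 (x0 - \<rho>)<..<min 1 (x0 + \<rho>)}"
    "curved_arc x y (deriv x) (deriv y) (deriv (deriv x)) (deriv (deriv y)) a b M \<kappa>"
    using curved_subarc by metis
  interpret curved_arc x y "deriv x" "deriv y" "deriv (deriv x)" "deriv (deriv y)" a b M \<kappa> by (rule arc)
  obtain E0 :: nat and c0 where c0: "c0 > 0"
    "\<And>E c. E \<ge> E0 \<Longrightarrow> c0 * (\<Sum>\<xi>\<in>lattice_circle E. (norm (c \<xi>))\<^sup>2) \<le> integral {a..b} (\<lambda>t. (norm (wave E c t))\<^sup>2)"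
    using that by (rule wave_energy_lower_bound)
  obtain K where K: "K > 0" "\<And>E. E > 0 \<Longrightarrow> real (card (lattice_circle E)) \<le> K * real E powr (1/2)"
    using card_lattice_circle_bound[of "1/2"] by auto
  \<comment> \<open>Half of the guaranteed mean energy density; the half makes the contradiction
    strict.\<close>
  define c' where "c' = c0 / 2 / (b - a)"
  have c'0: "c' > 0" using c0 ab by (simp add: c'_def)
  have "b - a \<noteq> 0" using ab by simp
  then have c'L: "(b - a) * c' = c0 / 2"
    unfolding c'_def by (rule trans[OF times_divide_eq_right nonzero_mult_div_cancel_left])
  define C where "C = K / c' + 8 * pi * B"
  have main: "real (card Z) \<le> C * sqrt (real E)"
    if E: "E \<ge> Suc E0" and nz: "\<exists>\<xi>\<in>lattice_circle E. c \<xi> \<noteq> 0"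
      and Z: "finite Z" "Z \<subseteq> {t. \<bar>t - x0\<bar> < \<rho> \<and> eigf E c (x t, y t) = 0}" for E c Z
  proof -
    define S where "S = lattice_circle E"
    have finS: "finite S" by (simp add: S_def finite_lattice_circle)
    define R where "R = sqrt (real E)"
    have R0: "R \<ge> 0" by (simp add: R_def)
    define A where "A = (\<Sum>\<xi>\<in>S. (norm (c \<xi>))\<^sup>2)"
    define T where "T = (\<Sum>\<xi>\<in>S. norm (c \<xi>))"
    obtain \<xi>0 where \<xi>0: "\<xi>0 \<in> S" "c \<xi>0 \<noteq> 0" using nz by (auto simp: S_def)
    have A0: "A > 0" unfolding A_def using \<xi>0 finS by (intro sum_pos2[of S \<xi>0]) auto
    have T0: "T \<ge> 0" unfolding T_def by (intro sum_nonneg) auto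
    have TA: "T\<^sup>2 \<le> (K * R) * A"
    proof -
      have "T\<^sup>2 \<le> real (card S) * A" unfolding T_def A_def by (rule sum_norm_squared_le)
      also have "\<dots> \<le> (K * R) * A"
        using K(2)[of E] E A0 by (intro mult_right_mono) (auto simp: S_def R_def powr_half_sqrt)
      finally show ?thesis .
    qed
    have "\<exists>t\<in>{a..b}. c' * A \<le> (norm (wave E c t))\<^sup>2"
    proof (rule ccontr)
      assume "\<not> ?thesis"
      then have le: "\<And>t. t \<in> {a..b} \<Longrightarrow> (norm (wave E c t))\<^sup>2 \<le> c' * A" by (meson le_cases)
      have "integral {a..b} (\<lambda>t. (norm (wave E c t))\<^sup>2) \<le> integral {a..b} (\<lambda>t. c' * A)"
      proof (rule integral_le)
        show "(\<lambda>t. (norm (wave E c t))\<^sup>2) integrable_on {a..b}" "(\<lambda>t. c' * A) integrable_on {a..b}"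
          by (intro integrable_continuous_real continuous_intros cont_wave)+
      qed (rule le)
      also have "\<dots> = ((b - a) * c') * A" using ab by (simp only: integral_const_real content_real less_imp_le) simp
      also have "\<dots> < c0 * A"
        unfolding c'L using c0(1) A0 by (intro mult_strict_right_mono) simp_all
      also have "\<dots> \<le> integral {a..b} (\<lambda>t. (norm (wave E c t))\<^sup>2)"
        unfolding A_def S_def by (rule c0(2)) (use E in simp)
      finally show False by simp
    qed
    then obtain t where t: "t \<in> {a..b}" "c' * A \<le> (norm (wave E c t))\<^sup>2" by blast
    have tx: "\<bar>t - x0\<bar> < \<rho>" using t(1) arc(1) by (auto simp: abs_less_iff)
    \<comment> \<open>The eigenfunction along the complexified curve; its exponentials are at most
      exp(4 pi B R), since gx, gy are bounded by B and the frequencies by R.\<close>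
    define G where "G z = (\<Sum>\<xi>\<in>S. c \<xi> * exp (2 * of_real pi * \<i> * (gx z * of_int (fst \<xi>) + gy z * of_int (snd \<xi>))))" for z
    have Geq: "G (of_real s) = eigf E c (x s, y s)" if "\<bar>s - x0\<bar> < r" for s
      using gx gy that by (simp add: G_def eigf_def S_def complexifies_def)
    have "2 ^ card (complex_of_real ` Z) * norm (G (of_real t)) \<le> T * exp (4 * pi * B * R)"
    proof (rule jensen_zero_bound[of _ G "ball (of_real x0) r" _ "2 * \<rho>"])
      show "G holomorphic_on ball (of_real x0) r"
        unfolding G_def using hol by (intro holomorphic_intros)
      have incl: "cball (complex_of_real t) (6 * \<rho>) \<subseteq> cball (of_real x0) (7 * \<rho>)"
      proof
        fix z assume "z \<in> cball (complex_of_real t) (6 * \<rho>)"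
        moreover have "dist (complex_of_real x0) z \<le> dist (complex_of_real x0) (of_real t) + dist (complex_of_real t) z"
          by (rule dist_triangle)
        moreover have "dist (complex_of_real x0) (of_real t) = \<bar>t - x0\<bar>"
          by (simp add: dist_of_real dist_real_def abs_minus_commute)
        ultimately show "z \<in> cball (of_real x0) (7 * \<rho>)" using tx by simp
      qed
      then show "cball (complex_of_real t) (3 * (2 * \<rho>)) \<subseteq> ball (of_real x0) r" using sub by simp
      show "norm (G z) \<le> T * exp (4 * pi * B * R)" if z: "norm (z - of_real t) = 3 * (2 * \<rho>)" for z
      proof -
        have "z \<in> cball (complex_of_real t) (6 * \<rho>)" using z by (simp add: dist_norm norm_minus_commute)
        then have "z \<in> cball (of_real x0) (7 * \<rho>)" using incl by blast
        then have gB: "norm (gx z) \<le> B" "norm (gy z) \<le> B" using B(2) by auto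
        have "norm (G z) \<le> (\<Sum>\<xi>\<in>S. norm (c \<xi>) * exp (4 * pi * B * R))"
          unfolding G_def
        proof (rule order.trans[OF norm_sum], rule sum_mono)
          fix \<xi> assume \<xi>: "\<xi> \<in> S"
          have "(real_of_int (fst \<xi>))\<^sup>2 + (real_of_int (snd \<xi>))\<^sup>2 = real E"
            using \<xi> by (simp add: S_def lattice_circle_of_int)
          then have \<xi>R: "\<bar>real_of_int (fst \<xi>)\<bar> \<le> R" "\<bar>real_of_int (snd \<xi>)\<bar> \<le> R"
            unfolding R_def by (metis real_sqrt_ge_abs1, metis real_sqrt_ge_abs2)
          have "norm (gx z * of_int (fst \<xi>) + gy z * of_int (snd \<xi>)) \<le> B * R + B * R"
            using gB \<xi>R B(1) by (intro order.trans[OF norm_triangle_ineq] add_mono) (auto simp: norm_mult intro!: mult_mono)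
          then have "norm (2 * of_real pi * \<i> * (gx z * of_int (fst \<xi>) + gy z * of_int (snd \<xi>))) \<le> 2 * pi * (B * R + B * R)"
            by (simp add: norm_mult)
          then have ne: "norm (exp (2 * of_real pi * \<i> * (gx z * of_int (fst \<xi>) + gy z * of_int (snd \<xi>)))) \<le> exp (4 * pi * B * R)"
            by (intro order.trans[OF norm_exp]) (simp add: algebra_simps)
          show "norm (c \<xi> * exp (2 * of_real pi * \<i> * (gx z * of_int (fst \<xi>) + gy z * of_int (snd \<xi>))))
              \<le> norm (c \<xi>) * exp (4 * pi * B * R)"
            unfolding norm_mult by (rule mult_left_mono[OF ne norm_ge_zero])
        qed
        then show ?thesis by (simp add: T_def sum_distrib_right)
      qed
      have Zs: "\<bar>s - x0\<bar> < \<rho>" "eigf E c (x s, y s) = 0" if "s \<in> Z" for s using Z(2) that by auto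
      show "complex_of_real ` Z \<subseteq> cball (of_real t) (2 * \<rho>)"
      proof
        fix z assume "z \<in> complex_of_real ` Z"
        then obtain s where s: "s \<in> Z" "z = of_real s" by blast
        have "\<bar>t - s\<bar> \<le> 2 * \<rho>" using Zs(1)[OF s(1)] tx by linarith
        then show "z \<in> cball (of_real t) (2 * \<rho>)" by (simp add: s(2) dist_of_real dist_real_def)
      qed
      show "G z = 0" if z: "z \<in> complex_of_real ` Z" for z
      proof -
        obtain s where s: "s \<in> Z" "z = of_real s" using z by blast
        have "\<bar>s - x0\<bar> < r" using Zs(1)[OF s(1)] r0 by (simp add: \<rho>_def)
        then show ?thesis using Geq[of s] Zs(2)[OF s(1)] s(2) by simp
      qed
    qed (use Z \<rho>0 in auto)
    moreover have "card (complex_of_real ` Z) = card Z" by (intro card_image) (auto simp: inj_on_def)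
    moreover have "G (of_real t) = wave E c t" using Geq[of t] tx r0 by (simp add: \<rho>_def eigf_eq_wave)
    ultimately have "2 ^ card Z * norm (wave E c t) \<le> T * exp (4 * pi * B * R)" by simp
    then have "(2 ^ card Z * norm (wave E c t))\<^sup>2 \<le> (T * exp (4 * pi * B * R))\<^sup>2" by (intro power_mono) auto
    then have sq: "4 ^ card Z * (norm (wave E c t))\<^sup>2 \<le> T\<^sup>2 * exp (8 * pi * B * R)"
    proof -
      have "((2::real) ^ card Z)\<^sup>2 = 4 ^ card Z" by (simp add: power2_eq_square flip: power_mult_distrib)
      moreover have "(exp (4 * pi * B * R))\<^sup>2 = exp (8 * pi * B * R)" by (simp flip: exp_double)
      ultimately show ?thesis using \<open>(2 ^ card Z * norm (wave E c t))\<^sup>2 \<le> (T * exp (4 * pi * B * R))\<^sup>2\<close>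
        by (simp only: power_mult_distrib)
    qed
    have "4 ^ card Z * (c' * A) \<le> 4 ^ card Z * (norm (wave E c t))\<^sup>2" by (intro mult_left_mono t) auto
    also note sq
    also have "T\<^sup>2 * exp (8 * pi * B * R) \<le> (K * R) * A * exp (8 * pi * B * R)" by (intro mult_right_mono TA) auto
    finally have "(4 ^ card Z * c') * A \<le> ((K * R) * exp (8 * pi * B * R)) * A" by (simp add: mult_ac)
    then have "4 ^ card Z * c' \<le> (K * R) * exp (8 * pi * B * R)" using A0 by (simp only: mult_le_cancel_right_pos)
    then have "4 ^ card Z \<le> (K / c' * R) * exp (8 * pi * B * R)" using c'0 by (simp add: field_simps)
    \<comment> \<open>Turning the linear factor into an exponential produces the summand K / c' of
      \<open>C\<close>.\<close>
    also have "\<dots> \<le> exp (K / c' * R) * exp (8 * pi * B * R)"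
      using exp_ge_add_one_self[of "K / c' * R"] by (intro mult_right_mono) (linarith, simp)
    also have "\<dots> = exp (C * R)" by (simp add: C_def algebra_simps exp_add[symmetric])
    finally have "4 ^ card Z \<le> exp (C * R)" .
    moreover have "exp (real (card Z)) \<le> 4 ^ card Z"
    proof -
      have "exp (real (card Z)) = exp 1 ^ card Z" by (simp add: exp_of_nat_mult[symmetric])
      also have "\<dots> \<le> 4 ^ card Z" using exp_le by (intro power_mono) auto
      finally show ?thesis .
    qed
    ultimately show ?thesis by (metis R_def exp_le_cancel_iff order.trans)
  qed
  have "\<forall>E\<ge>Suc E0. \<forall>c. (\<exists>\<xi>\<in>lattice_circle E. c \<xi> \<noteq> 0) \<longrightarrow>
     finite {t. \<bar>t - x0\<bar> < \<rho> \<and> eigf E c (x t, y t) = 0} \<and>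
     real (card {t. \<bar>t - x0\<bar> < \<rho> \<and> eigf E c (x t, y t) = 0}) \<le> C * sqrt (real E)"
  proof (intro conjI allI impI)
    fix E :: nat and c :: "int \<times> int \<Rightarrow> complex" assume E: "Suc E0 \<le> E" and nz: "\<exists>\<xi>\<in>lattice_circle E. c \<xi> \<noteq> 0"
    define Z where "Z = {t. \<bar>t - x0\<bar> < \<rho> \<and> eigf E c (x t, y t) = 0}"
    \<comment> \<open>A uniform bound on finite subsets yields finiteness too, without which a bound
      on \<open>card\<close> would be void.\<close>
    have "finite Z \<and> card Z \<le> nat \<lfloor>C * sqrt (real E)\<rfloor>"
    proof (rule finite_if_finite_subsets_card_bdd)
      fix F assume "F \<subseteq> Z" "finite F"
      then have "real (card F) \<le> C * sqrt (real E)" using main[OF E nz, of F] by (simp add: Z_def)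
      then show "card F \<le> nat \<lfloor>C * sqrt (real E)\<rfloor>" by linarith
    qed
    then show "finite {t. \<bar>t - x0\<bar> < \<rho> \<and> eigf E c (x t, y t) = 0}"
      "real (card {t. \<bar>t - x0\<bar> < \<rho> \<and> eigf E c (x t, y t) = 0}) \<le> C * sqrt (real E)"
      using main[OF E nz, of Z] by (simp_all add: Z_def)
  qed
  then show ?thesis
    by - (rule exI[of _ \<rho>], rule conjI[OF \<rho>0], rule exI[of _ "Suc E0"], rule exI[of _ C])
qed

text \<open>Compactness of the parameter interval: finitely many local bounds add up, and the sum of
  their thresholds dominates each one.\<close>

lemma zero_bound:
  obtains E0 :: nat and C :: real where
    "\<And>E c. E \<ge> E0 \<Longrightarrow> \<exists>\<xi>\<in>lattice_circle E. c \<xi> \<noteq> 0 \<Longrightarrow> finite {t \<in> {0..1}. eigf E c (x t, y t) = 0}"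
    "\<And>E c. E \<ge> E0 \<Longrightarrow> \<exists>\<xi>\<in>lattice_circle E. c \<xi> \<noteq> 0 \<Longrightarrow>
       real (card {t \<in> {0..1}. eigf E c (x t, y t) = 0}) \<le> C * sqrt (real E)"
proof -
  define Zl where "Zl u \<rho> E c = {t. \<bar>t - u\<bar> < \<rho> \<and> eigf E c (x t, y t) = 0}" for u \<rho> :: real and E c
  define good where "good u w \<longleftrightarrow> fst w > 0 \<and> (\<forall>E\<ge>fst (snd w). \<forall>c. (\<exists>\<xi>\<in>lattice_circle E. c \<xi> \<noteq> 0) \<longrightarrow>
     finite (Zl u (fst w) E c) \<and> real (card (Zl u (fst w) E c)) \<le> snd (snd w) * sqrt (real E))"
    for u and w :: "real \<times> nat \<times> real"
  have "\<forall>u\<in>{0..1}. \<exists>w. good u w"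
  proof
    fix u :: real assume "u \<in> {0..1}"
    from local_zero_bound[OF this, folded Zl_def] obtain \<rho> E0 C where
      "\<rho> > 0" "\<forall>E\<ge>E0. \<forall>c. (\<exists>\<xi>\<in>lattice_circle E. c \<xi> \<noteq> 0) \<longrightarrow>
        finite (Zl u \<rho> E c) \<and> real (card (Zl u \<rho> E c)) \<le> C * sqrt (real E)"
      by (elim exE conjE)
    then have "good u (\<rho>, E0, C)" unfolding good_def fst_conv snd_conv by (rule conjI)
    then show "\<exists>w. good u w" ..
  qed
  then obtain w where w: "\<forall>u\<in>{0..1}. good u (w u)" by (rule bchoice[THEN exE])
  define \<rho> where "\<rho> u = fst (w u)" for u
  define E0 where "E0 u = fst (snd (w u))" for u
  define C where "C u = snd (snd (w u))" for u
  have \<rho>0: "\<rho> u > 0" if "u \<in> {0..1}" for u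
    using w that unfolding good_def \<rho>_def by blast
  have loc: "finite (Zl u (\<rho> u) E c) \<and> real (card (Zl u (\<rho> u) E c)) \<le> C u * sqrt (real E)"
    if "u \<in> {0..1}" "E0 u \<le> E" "\<exists>\<xi>\<in>lattice_circle E. c \<xi> \<noteq> 0" for u E c
    using bspec[OF w that(1)] that(2,3) unfolding good_def \<rho>_def E0_def C_def by blast
  have "{0..1} \<subseteq> (\<Union>u\<in>{0..1}. ball u (\<rho> u))" using \<rho>0 by (intro subsetI UN_I) (auto simp del: atLeastAtMost_iff)
  then obtain D where D: "D \<subseteq> {0..1}" "finite D" "{0..1} \<subseteq> (\<Union>u\<in>D. ball u (\<rho> u))"
    using compactE_image[of "{0..1::real}" "{0..1}" "\<lambda>u. ball u (\<rho> u)"] by auto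
  show ?thesis
  proof (rule that)
    fix E :: nat and c :: "int \<times> int \<Rightarrow> complex" assume E: "sum E0 D \<le> E" and nz: "\<exists>\<xi>\<in>lattice_circle E. c \<xi> \<noteq> 0"
    have ED: "finite (Zl u (\<rho> u) E c)" "real (card (Zl u (\<rho> u) E c)) \<le> C u * sqrt (real E)" if u: "u \<in> D" for u
    proof -
      have "E0 u \<le> E" using member_le_sum[of u D E0] u D(2) E by simp
      then show "finite (Zl u (\<rho> u) E c)" "real (card (Zl u (\<rho> u) E c)) \<le> C u * sqrt (real E)"
        using loc[OF subsetD[OF D(1) u] _ nz] by blast+
    qed
    have sub: "{t \<in> {0..1}. eigf E c (x t, y t) = 0} \<subseteq> (\<Union>u\<in>D. Zl u (\<rho> u) E c)"
    proof
      fix t assume t: "t \<in> {t \<in> {0..1}. eigf E c (x t, y t) = 0}"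
      then obtain u where "u \<in> D" "t \<in> ball u (\<rho> u)" using D(3) by blast
      then show "t \<in> (\<Union>u\<in>D. Zl u (\<rho> u) E c)"
        using t by (intro UN_I[of u]) (simp_all add: Zl_def dist_real_def abs_minus_commute)
    qed
    have fin: "finite (\<Union>u\<in>D. Zl u (\<rho> u) E c)" using ED D(2) by blast
    then show "finite {t \<in> {0..1}. eigf E c (x t, y t) = 0}" using sub finite_subset by blast
    have "card {t \<in> {0..1}. eigf E c (x t, y t) = 0} \<le> (\<Sum>u\<in>D. card (Zl u (\<rho> u) E c))"
      using card_mono[OF fin sub] card_UN_le[OF D(2)] order.trans by blast
    then have "real (card {t \<in> {0..1}. eigf E c (x t, y t) = 0}) \<le> (\<Sum>u\<in>D. real (card (Zl u (\<rho> u) E c)))"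
      unfolding of_nat_sum[symmetric] of_nat_le_iff .
    also have "\<dots> \<le> (\<Sum>u\<in>D. C u * sqrt (real E))" by (intro sum_mono ED)
    finally show "real (card {t \<in> {0..1}. eigf E c (x t, y t) = 0}) \<le> sum C D * sqrt (real E)"
      by (simp add: sum_distrib_right)
  qed
qed

end

section \<open>From the given curve to its coordinate functions\<close>

lemma nonlinear_analytic_curve_lift:
  assumes "analytic_curve \<gamma>" "\<not> is_geodesic_curve \<gamma>"
  shows "nonlinear_analytic_curve (\<lambda>t. fst (\<gamma> t)) (\<lambda>t. snd (\<gamma> t))"
proof
  obtain U where U: "{0..1} \<subseteq> U" "real_analytic_on (\<lambda>t. fst (\<gamma> t)) U" "real_analytic_on (\<lambda>t. snd (\<gamma> t)) U"
    using assms(1) by (auto simp: analytic_curve_def)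
  fix t :: real assume t: "t \<in> {0..1}"
  show "real_analytic_at (\<lambda>t. fst (\<gamma> t)) t" "real_analytic_at (\<lambda>t. snd (\<gamma> t)) t"
    using real_analytic_on_imp_at[OF U(2)] real_analytic_on_imp_at[OF U(3)] U(1) t by auto
  obtain v where v: "v \<noteq> 0" "(\<gamma> has_vector_derivative v) (at t)"
    using assms(1) t unfolding analytic_curve_def by blast
  have "((\<lambda>t. fst (\<gamma> t)) has_real_derivative fst v) (at t)" "((\<lambda>t. snd (\<gamma> t)) has_real_derivative snd v) (at t)"
    using bounded_linear.has_vector_derivative[OF bounded_linear_fst v(2)]
      bounded_linear.has_vector_derivative[OF bounded_linear_snd v(2)]
    by (simp_all add: has_real_derivative_iff_has_vector_derivative)
  then have "deriv (\<lambda>t. fst (\<gamma> t)) t = fst v" "deriv (\<lambda>t. snd (\<gamma> t)) t = snd v" by (auto intro: DERIV_imp_deriv)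
  then show "deriv (\<lambda>t. fst (\<gamma> t)) t \<noteq> 0 \<or> deriv (\<lambda>t. snd (\<gamma> t)) t \<noteq> 0"
    using v(1) by (auto simp: prod_eq_iff)
next
  fix \<alpha> \<beta> k :: real assume nz: "\<alpha> \<noteq> 0 \<or> \<beta> \<noteq> 0"
  show "\<exists>t\<in>{0..1}. \<alpha> * fst (\<gamma> t) + \<beta> * snd (\<gamma> t) \<noteq> k"
  proof (rule ccontr)
    assume "\<not> ?thesis"
    then have line: "\<alpha> * fst (\<gamma> t) + \<beta> * snd (\<gamma> t) = k" if "t \<in> {0..1}" for t using that by blast
    define q where "q = \<alpha>\<^sup>2 + \<beta>\<^sup>2"
    have q: "q \<noteq> 0" using nz by (simp add: q_def sum_power2_eq_zero_iff)
    \<comment> \<open>The foot of the perpendicular from the origin plus a multiple of the direction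
      orthogonal to \<open>(\<alpha>, \<beta>)\<close>.\<close>
    have "\<gamma> t = (\<alpha> * k / q, \<beta> * k / q) + ((\<alpha> * snd (\<gamma> t) - \<beta> * fst (\<gamma> t)) / q) *\<^sub>R (- \<beta>, \<alpha>)" if "t \<in> {0..1}" for t
    proof -
      have "fst (\<gamma> t) * q = \<alpha> * k - (\<alpha> * snd (\<gamma> t) - \<beta> * fst (\<gamma> t)) * \<beta>"
        "snd (\<gamma> t) * q = \<beta> * k + (\<alpha> * snd (\<gamma> t) - \<beta> * fst (\<gamma> t)) * \<alpha>"
        unfolding line[OF that, symmetric] by (simp_all add: q_def algebra_simps power2_eq_square)
      then show ?thesis using q by (simp add: prod_eq_iff field_simps)
    qed
    then have "is_geodesic_curve \<gamma>" unfolding is_geodesic_curve_def by blast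
    then show False using assms(2) by simp
  qed
qed

lemma is_eigenfunction_imp_coeff:
  assumes "is_eigenfunction E c"
  shows "\<exists>\<xi>\<in>lattice_circle E. c \<xi> \<noteq> 0"
proof (rule ccontr)
  assume "\<not> ?thesis"
  then have "eigf E c p = 0" for p unfolding eigf_def by (intro sum.neutral) auto
  then show False using assms by (simp add: is_eigenfunction_def)
qed

section \<open>The lower bound with its final exponents\<close>

context nonlinear_analytic_curve
begin

lemma zero_count_lower_bound:
  assumes "\<epsilon> > 0"
  obtains E1 :: nat and c :: real where "E1 > 0" "c > 0"
    "\<And>E \<phi>. E \<ge> E1 \<Longrightarrow> is_eigenfunction E \<phi> \<Longrightarrow>
       c * real E powr (1/2 - \<epsilon>) \<le> real (card ((\<lambda>t. torus_proj (x t, y t)) ` {t \<in> {0..1}. eigf E \<phi> (x t, y t) = 0}))"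
proof -
  obtain a b M \<kappa> where arc: "{a..b} \<subseteq> {0<..<1}"
    "curved_arc x y (deriv x) (deriv y) (deriv (deriv x)) (deriv (deriv y)) a b M \<kappa>"
    "inj_on (\<lambda>t. torus_proj (x t, y t)) {a..b}"
    using curved_subarc[of 0 1] by (metis greaterThanLessThan_subseteq_atLeastAtMost_iff less_numeral_extra(1) order_refl)
  interpret curved_arc x y "deriv x" "deriv y" "deriv (deriv x)" "deriv (deriv y)" a b M \<kappa> by (rule arc)
  obtain E0 :: nat and n0 c1 :: real where c1: "c1 > 0"
    "\<And>E c n. E \<ge> E0 \<Longrightarrow> n \<ge> n0 \<Longrightarrow> real (card (lattice_circle E)) \<le> n \<Longrightarrow> n ^ 8 \<le> sqrt (real E) \<Longrightarrow>
       \<forall>t\<in>{a..b}. Im (wave E c t) = 0 \<Longrightarrow> \<exists>\<xi>\<in>lattice_circle E. c \<xi> \<noteq> 0 \<Longrightarrow>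
       finite {t \<in> {a..<b}. wave E c t = 0} \<Longrightarrow>
       c1 * sqrt (real E) / n ^ 6 \<le> real (card {t \<in> {a..<b}. wave E c t = 0})"
    using that by (rule wave_sign_change_lower_bound)
  obtain Eu :: nat and Cu where fin: "\<And>E c. E \<ge> Eu \<Longrightarrow> \<exists>\<xi>\<in>lattice_circle E. c \<xi> \<noteq> 0 \<Longrightarrow> finite {t \<in> {0..1}. eigf E c (x t, y t) = 0}"
    using that by (rule zero_bound)
  \<comment> \<open>For n = E^\<eta>, the bound by \<epsilon> / 6 keeps the loss n^6 below
    E^\<epsilon>, and the bound by 1/16 gives n^8 <= E^(1/2).\<close>
  define \<eta> where "\<eta> = min (\<epsilon> / 6) (1 / 16)"
  have \<eta>: "\<eta> > 0" "6 * \<eta> \<le> \<epsilon>" "16 * \<eta> \<le> 1" using assms by (auto simp: \<eta>_def min_def)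
  \<comment> \<open>The other half of the exponent is kept to absorb K for large E.\<close>
  obtain K where K: "K > 0" "\<And>E. E > 0 \<Longrightarrow> real (card (lattice_circle E)) \<le> K * real E powr (\<eta> / 2)"
    using card_lattice_circle_bound[of "\<eta> / 2"] \<eta> by auto
  obtain Ea :: nat where Ea: "Ea > 0" "\<And>E. E \<ge> Ea \<Longrightarrow> K * real E powr (- (\<eta> / 2)) \<le> 1"
    using powr_decay[of "\<eta> / 2" 1 K] \<eta> by auto
  obtain Eb :: nat where Eb: "Eb > 0" "\<And>E. E \<ge> Eb \<Longrightarrow> n0 * real E powr (- \<eta>) \<le> 1"
    using powr_decay[of \<eta> 1 n0] \<eta> by auto
  show ?thesis
  proof (rule that[of "E0 + Eu + Ea + Eb" c1])
    fix E \<phi> assume E: "E \<ge> E0 + Eu + Ea + Eb" and eig: "is_eigenfunction E \<phi>"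
    have E1: "real E \<ge> 1" "E > 0" using E Ea(1) by auto
    define n where "n = real E powr \<eta>"
    note nz = is_eigenfunction_imp_coeff[OF eig]
    define Z where "Z = {t \<in> {a..<b}. wave E \<phi> t = 0}"
    have sub: "Z \<subseteq> {t \<in> {0..1}. eigf E \<phi> (x t, y t) = 0}"
    proof
      fix t assume t: "t \<in> Z"
      then have "t \<in> {0<..<1}" using subsetD[OF arc(1), of t] by (simp add: Z_def)
      then show "t \<in> {t \<in> {0..1}. eigf E \<phi> (x t, y t) = 0}" using t by (simp add: Z_def eigf_eq_wave)
    qed
    \<comment> \<open>The upper bound supplies the finiteness under which cardinalities can be
      compared.\<close>
    have finZ: "finite {t \<in> {0..1}. eigf E \<phi> (x t, y t) = 0}" using fin[OF _ nz] E by simp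
    have "n0 \<le> n" using Eb(2)[of E] E E1 by (simp add: n_def powr_minus_divide field_simps)
    moreover have "real (card (lattice_circle E)) \<le> n"
    proof -
      have "K \<le> real E powr (\<eta> / 2)" using Ea(2)[of E] E E1 by (simp add: powr_minus_divide field_simps)
      then have "K * real E powr (\<eta> / 2) \<le> real E powr (\<eta> / 2) * real E powr (\<eta> / 2)" by (intro mult_right_mono) auto
      also have "\<dots> = n" by (simp add: n_def powr_add[symmetric])
      finally show ?thesis using K(2)[OF E1(2)] by linarith
    qed
    moreover have "n ^ 8 \<le> sqrt (real E)"
    proof -
      have "n ^ 8 = n powr 8" using E1 by (simp add: n_def)
      also have "\<dots> = real E powr (8 * \<eta>)" unfolding n_def powr_powr by (simp add: mult.commute)
      also have "\<dots> \<le> real E powr (1/2)" using E1 \<eta> by (intro powr_mono) auto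
      finally show ?thesis using E1 by (simp add: powr_half_sqrt)
    qed
    moreover have "Im (wave E \<phi> t) = 0" for t
      using eig by (simp add: is_eigenfunction_def flip: eigf_eq_wave)
    moreover have "finite Z" using finite_subset[OF sub finZ] .
    ultimately have low: "c1 * sqrt (real E) / n ^ 6 \<le> real (card Z)"
      unfolding Z_def using c1(2)[of E n \<phi>] nz E by simp
    have "real E powr (1/2 - \<epsilon>) \<le> real E powr (1/2 - 6 * \<eta>)" using E1 \<eta> by (intro powr_mono) auto
    also have "\<dots> = sqrt (real E) / n ^ 6"
    proof -
      have "n ^ 6 = n powr 6" using E1 by (simp add: n_def)
      also have "\<dots> = real E powr (6 * \<eta>)" unfolding n_def powr_powr by (simp add: mult.commute)
      finally show ?thesis using E1 by (simp add: powr_diff powr_half_sqrt)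
    qed
    finally have "c1 * real E powr (1/2 - \<epsilon>) \<le> c1 * (sqrt (real E) / n ^ 6)" using c1(1) by (intro mult_left_mono) auto
    also have "\<dots> \<le> real (card Z)" using low by simp
    \<comment> \<open>The projection is injective on the subarc, so no zeros are lost on the
      torus.\<close>
    also have "card Z = card ((\<lambda>t. torus_proj (x t, y t)) ` Z)"
      by (rule card_image[symmetric], rule inj_on_subset[OF arc(3)]) (auto simp: Z_def)
    also have "\<dots> \<le> card ((\<lambda>t. torus_proj (x t, y t)) ` {t \<in> {0..1}. eigf E \<phi> (x t, y t) = 0})"
      using finZ sub by (intro card_mono image_mono) auto
    finally show "c1 * real E powr (1/2 - \<epsilon>) \<le> real (card ((\<lambda>t. torus_proj (x t, y t)) ` {t \<in> {0..1}. eigf E \<phi> (x t, y t) = 0}))"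
      by simp
  qed (use Ea c1 in auto)
qed

end

theorem theorem10p8:
  fixes \<gamma> :: "real \<Rightarrow> real \<times> real"
  assumes "analytic_curve \<gamma>"
    and "\<not> is_geodesic_curve \<gamma>"
  shows "\<exists>E\<^sub>\<Sigma>::nat. \<exists>C>0::real. \<forall>\<epsilon>>0::real. \<exists>c>0::real.
           \<forall>E \<ge> E\<^sub>\<Sigma>. \<forall>\<phi>. is_eigenfunction E \<phi> \<longrightarrow>
             c * real E powr (1/2 - \<epsilon>) < real (nodal_count E \<phi> \<gamma>) \<and>
             real (nodal_count E \<phi> \<gamma>) < C * real E powr (1/2)"
proof -
  define x where "x t = fst (\<gamma> t)" for t
  define y where "y t = snd (\<gamma> t)" for t
  interpret nonlinear_analytic_curve x y
    using nonlinear_analytic_curve_lift[OF assms] by (simp add: x_def[abs_def] y_def[abs_def])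
  have \<gamma>: "\<gamma> t = (x t, y t)" for t by (simp add: x_def y_def)
  have count: "nodal_count E \<phi> \<gamma> = card ((\<lambda>t. torus_proj (x t, y t)) ` {t \<in> {0..1}. eigf E \<phi> (x t, y t) = 0})" for E \<phi>
  proof -
    have "{p \<in> curve_set \<gamma>. eigf E \<phi> p = 0} = (\<lambda>t. torus_proj (x t, y t)) ` {t \<in> {0..1}. eigf E \<phi> (x t, y t) = 0}"
      by (auto simp: curve_set_def \<gamma> eigf_torus_proj)
    then show ?thesis by (simp add: nodal_count_def)
  qed
  obtain Eu :: nat and Cu where upper:
    "\<And>E c. E \<ge> Eu \<Longrightarrow> \<exists>\<xi>\<in>lattice_circle E. c \<xi> \<noteq> 0 \<Longrightarrow> finite {t \<in> {0..1}. eigf E c (x t, y t) = 0}"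
    "\<And>E c. E \<ge> Eu \<Longrightarrow> \<exists>\<xi>\<in>lattice_circle E. c \<xi> \<noteq> 0 \<Longrightarrow>
       real (card {t \<in> {0..1}. eigf E c (x t, y t) = 0}) \<le> Cu * sqrt (real E)"
    using that by (rule zero_bound)
  \<comment> \<open>A fixed exponent shows that there is a zero at all, with a threshold independent
    of the later \<epsilon>.\<close>
  obtain El :: nat and cl where lower: "El > 0" "cl > 0"
    "\<And>E \<phi>. E \<ge> El \<Longrightarrow> is_eigenfunction E \<phi> \<Longrightarrow> cl * real E powr (1/2 - 1/4) \<le> real (nodal_count E \<phi> \<gamma>)"
    using zero_count_lower_bound[of "1/4"] unfolding count by auto
  show ?thesis
  proof (rule exI[of _ "Eu + El"], rule exI[of _ "\<bar>Cu\<bar> + 1"], intro conjI allI impI)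
    show "0 < \<bar>Cu\<bar> + 1" by simp
    fix \<epsilon> :: real assume "\<epsilon> > 0"
    obtain E1 :: nat and c1 where c1: "E1 > 0" "c1 > 0"
      "\<And>E \<phi>. E \<ge> E1 \<Longrightarrow> is_eigenfunction E \<phi> \<Longrightarrow> c1 * real E powr (1/2 - \<epsilon>) \<le> real (nodal_count E \<phi> \<gamma>)"
      using zero_count_lower_bound[OF \<open>\<epsilon> > 0\<close>] unfolding count by auto
    \<comment> \<open>\<open>c < c1\<close> gives strictness for E >= E1. Below E1, E^(1/2 -
      \<epsilon>) <= E <= E1, so the left side is less than 1 and the one zero already found
      suffices.\<close>
    define c where "c = min (c1 / 2) (1 / (2 * real E1))"
    have c: "c > 0" "c < c1" "c * real E1 < 1" using c1 by (auto simp: c_def min_def field_simps)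
    have "c * real E powr (1/2 - \<epsilon>) < real (nodal_count E \<phi> \<gamma>) \<and> real (nodal_count E \<phi> \<gamma>) < (\<bar>Cu\<bar> + 1) * real E powr (1/2)"
      if E: "E \<ge> Eu + El" and eig: "is_eigenfunction E \<phi>" for E \<phi>
    proof
      have E0: "real E \<ge> 1" "E \<ge> Eu" "E \<ge> El" using E lower(1) by auto
      note nz = is_eigenfunction_imp_coeff[OF eig]
      show "c * real E powr (1/2 - \<epsilon>) < real (nodal_count E \<phi> \<gamma>)"
      proof (cases "E \<ge> E1")
        case True
        have "c * real E powr (1/2 - \<epsilon>) < c1 * real E powr (1/2 - \<epsilon>)"
          using c E0 by (intro mult_strict_right_mono) auto
        then show ?thesis using c1(3)[OF True eig] by simp
      next
        case False
        have "0 < cl * real E powr (1/2 - 1/4)" using lower(2) E0 by simp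
        then have "0 < real (nodal_count E \<phi> \<gamma>)" using lower(3)[OF E0(3) eig] by linarith
        then have one: "1 \<le> real (nodal_count E \<phi> \<gamma>)" by simp
        have "real E powr (1/2 - \<epsilon>) \<le> real E powr 1" using E0 \<open>\<epsilon> > 0\<close> by (intro powr_mono) auto
        also have "\<dots> \<le> real E1" using False E0 by simp
        finally have "c * real E powr (1/2 - \<epsilon>) \<le> c * real E1" using c by (intro mult_left_mono) auto
        then show ?thesis using c(3) one by linarith
      qed
      \<comment> \<open>Parameters projecting to the same torus point can only lower the
        count.\<close>
      have "nodal_count E \<phi> \<gamma> \<le> card {t \<in> {0..1}. eigf E \<phi> (x t, y t) = 0}"
        unfolding count by (intro card_image_le upper(1) E0 nz)
      then have "real (nodal_count E \<phi> \<gamma>) \<le> Cu * sqrt (real E)" using upper(2)[OF E0(2) nz] by linarith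
      also have "\<dots> < (\<bar>Cu\<bar> + 1) * sqrt (real E)" using E0 by (intro mult_strict_right_mono) auto
      finally show "real (nodal_count E \<phi> \<gamma>) < (\<bar>Cu\<bar> + 1) * real E powr (1/2)"
        by (simp add: powr_half_sqrt)
    qed
    then show "\<exists>c>0. \<forall>E\<ge>Eu + El. \<forall>\<phi>. is_eigenfunction E \<phi> \<longrightarrow>
        c * real E powr (1/2 - \<epsilon>) < real (nodal_count E \<phi> \<gamma>) \<and> real (nodal_count E \<phi> \<gamma>) < (\<bar>Cu\<bar> + 1) * real E powr (1/2)"
      using c(1) by blast
  qed
qed

end
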